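(* For every integer $k \geq 1$, any (randomized) $k$-phase communication protocol that outputs the correct solution to the $k$-step hidden-pointer chasing problem $\mathsf{HPC}_k$ with constant probability requires $\Omega(n^2/k^2 + n)$ bits of communication.
   Context: Set intersection ($\mathsf{Set\text{-}Int}$): two players hold sets $A, B$ over a universe with the promise $|A \cap B| = 1$; the unique common element is the target element. Hidden-pointer chasing ($\mathsf{HPC}$) is a four-player communication problem with players $P_A, P_B, P_C, P_D$. Let $\mathcal{X} = \{x_1,\dots,x_n\}$ and $\mathcal{Y} = \{y_1,\dots,y_n\}$ be disjoint universes. For each $x \in \mathcal{X}$, $P_A$ holds $A_x \subseteq \mathcal{Y}$ and $P_B$ holds $B_x \subseteq \mathcal{Y}$ with $A_x \cap B_x = \{t_x\}$; for each $y \in \mathcal{Y}$, $P_C$ holds $C_y \subseteq \mathcal{X}$ and $P_D$ holds $D_y \subseteq \mathcal{X}$ with $C_y \cap D_y = \{t_y\}$. Define $f_{AB}(x) = t_x$ and $f_{CD}(y) = t_y$. With $z_0 := x_1$ (known to all players), define $z_1 = f_{AB}(z_0)$, $z_2 = f_{CD}(z_1)$, $z_3 = f_{AB}(z_2)$, and so on alternately. $\mathsf{HPC}_k$ is the problem of finding $z_k$. Phases: the communication of a protocol is partitioned into phases; in an odd phase only $P_C$ and $P_D$ communicate with each other (arbitrarily many rounds), and the phase ends as soon as one of them sends a message to $P_A$ or $P_B$; in an even phase only $P_A$ and $P_B$ communicate, and the phase ends as soon as one of them sends a message to $P_C$ or $P_D$. A $k$-phase protocol is one whose communication consists of at most $k$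 phases. Communication is the total number of bits sent. *)

theory Defs
  imports "HOL-Probability.Probability_Mass_Function"
begin

datatype player = PA | PB | PC | PD

text \<open>The two universes are indexed: the number \<open>i\<close> stands for \<open>x\<^sub>i\<close> or for \<open>y\<^sub>i\<close>, and the
  position in which it is used decides which. The input of \<open>PA\<close> maps \<open>x\<close> to the set \<open>A\<^sub>x\<close> of
  \<open>y\<close>-indices, the input of \<open>PC\<close> maps \<open>y\<close> to the set \<open>C\<^sub>y\<close> of \<open>x\<close>-indices, and so on.\<close>

type_synonym input = "nat \<Rightarrow> nat set"
type_synonym hpc_input = "player \<Rightarrow> input"

definition set_int_instance :: "'a set \<Rightarrow> 'a set \<Rightarrow> 'a set \<Rightarrow> bool" where
  "set_int_instance U A B \<longleftrightarrow> A \<subseteq> U \<and> B \<subseteq> U \<and> card (A \<inter> B) = 1"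

definition target :: "'a set \<Rightarrow> 'a set \<Rightarrow> 'a" where
  "target A B = the_elem (A \<inter> B)"

text \<open>Outside \<open>{1..n}\<close> the inputs carry no information; they are normalised to the empty set.\<close>

definition hpc_instance :: "nat \<Rightarrow> hpc_input \<Rightarrow> bool" where
  "hpc_instance n I \<longleftrightarrow>
     (\<forall>x\<in>{1..n}. set_int_instance {1..n} (I PA x) (I PB x)) \<and>
     (\<forall>y\<in>{1..n}. set_int_instance {1..n} (I PC y) (I PD y)) \<and>
     (\<forall>p. \<forall>i. i \<notin> {1..n} \<longrightarrow> I p i = {})"

definition f_AB :: "hpc_input \<Rightarrow> nat \<Rightarrow> nat" where
  "f_AB I x = target (I PA x) (I PB x)"

definition f_CD :: "hpc_input \<Rightarrow> nat \<Rightarrow> nat" where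
  "f_CD I y = target (I PC y) (I PD y)"

primrec pointer :: "hpc_input \<Rightarrow> nat \<Rightarrow> nat" where
  "pointer I 0 = 1"
| "pointer I (Suc j) = (if even j then f_AB I (pointer I j) else f_CD I (pointer I j))"

text \<open>Deterministic protocol trees with messages visible to all players. In \<open>Speak p m P Q\<close> player
  \<open>p\<close> sends the single bit \<open>m\<close>, which depends on its own input and (through the position in the
  tree) on all bits sent so far; the protocol continues with \<open>P\<close> if the bit is true and with \<open>Q\<close>
  otherwise. At a leaf \<open>Output p g\<close> player \<open>p\<close> announces the answer, which may depend on its own
  input as well as on the transcript and is not counted as communication.\<close>

datatype protocol =
    Output player "input \<Rightarrow> nat"
  | Speak player "input \<Rightarrow> bool" protocol protocol

primrec answer :: "protocol \<Rightarrow> hpc_input \<Rightarrow> nat" where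
  "answer (Output p g) I = g (I p)"
| "answer (Speak p m P Q) I = (if m (I p) then answer P I else answer Q I)"

text \<open>The senders of the successive bits of the execution on a given input.\<close>

primrec speakers :: "protocol \<Rightarrow> hpc_input \<Rightarrow> player list" where
  "speakers (Output p g) I = []"
| "speakers (Speak p m P Q) I = p # (if m (I p) then speakers P I else speakers Q I)"

definition bits_sent :: "protocol \<Rightarrow> hpc_input \<Rightarrow> nat" where
  "bits_sent P I = length (speakers P I)"

definition phase_players :: "nat \<Rightarrow> player set" where
  "phase_players j = (if odd j then {PC, PD} else {PA, PB})"

text \<open>The list \<open>phs\<close> is the partition of the communication into phases; phases are numbered from 1,
  so its entry at position \<open>j\<close> is phase \<open>Suc j\<close>. A phase may be empty, so a protocol in which \<open>PA\<close>
  or \<open>PB\<close> speaks first has used up phase 1.\<close>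

definition within_phases :: "nat \<Rightarrow> player list \<Rightarrow> bool" where
  "within_phases k ps \<longleftrightarrow>
     (\<exists>phs. ps = concat phs \<and> length phs \<le> k \<and>
        (\<forall>j<length phs. set (phs ! j) \<subseteq> phase_players (Suc j)))"

text \<open>A randomized protocol is a distribution over deterministic protocols, that is, the players
  share public coins. Private coins are the special case in which part of the public coins is read
  by one player only.\<close>

type_synonym rand_protocol = "protocol pmf"

definition k_phase :: "nat \<Rightarrow> nat \<Rightarrow> rand_protocol \<Rightarrow> bool" where
  "k_phase n k R \<longleftrightarrow>
     (\<forall>P\<in>set_pmf R. \<forall>I. hpc_instance n I \<longrightarrow> within_phases k (speakers P I))"

definition solves_hpc :: "nat \<Rightarrow> nat \<Rightarrow> real \<Rightarrow> rand_protocol \<Rightarrow> bool" where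
  "solves_hpc n k \<delta> R \<longleftrightarrow>
     (\<forall>I. hpc_instance n I \<longrightarrow> measure_pmf.prob R {P. answer P I = pointer I k} \<ge> \<delta>)"

text \<open>Worst-case communication, over all inputs and all coin tosses.\<close>

definition comm_at_most :: "nat \<Rightarrow> rand_protocol \<Rightarrow> nat \<Rightarrow> bool" where
  "comm_at_most n R b \<longleftrightarrow>
     (\<forall>P\<in>set_pmf R. \<forall>I. hpc_instance n I \<longrightarrow> bits_sent P I \<le> b)"

end

theory Submission
  imports Defs
begin

text \<open>Each of the pairs \<open>PA, PB\<close> and \<open>PC, PD\<close> receives a random instance with uniform targets, in
  which every coordinate off the targets is a free bit for one random player and \<open>0\<close> for the other.
  The transcripts divide the inputs into rectangles, at most exponentially many in the number of
  bits sent. By the level-one inequality a transcript gives little information about most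
  coordinates, so the transcript distributions for the bit pairs \<open>00\<close>, \<open>01\<close> and \<open>10\<close> in a random
  coordinate are close in Hellinger distance, and the cut-and-paste property extends this to \<open>11\<close>.
  Hence planting a second common element \<open>y\<close> in a random row \<open>x\<close> is hardly noticed, and since the
  doubly planted input is symmetric in \<open>t x\<close> and \<open>y\<close>, the transcript hardly depends on the target
  \<open>t x\<close>. A protocol with \<open>b\<close> bits moves the targets of an average row away from the uniform
  distribution by \<open>O(\<surd>b / n)\<close>.

  The pointer \<open>z\<^sub>j\<^sub>+\<^sub>1\<close> is the target of one pair in the row \<open>z\<^sub>j\<close>, which the other pair
  determines, and phase \<open>j + 1\<close> is spoken by that other pair. Given the earlier history the two pairs
  are independent, so \<open>z\<^sub>j\<^sub>+\<^sub>1\<close> is nearly uniform if \<open>z\<^sub>j\<close> is; the additional error is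
  \<open>O(\<surd>b / n + k / n)\<close>, where \<open>k / n\<close> accounts for rows visited before. Nor can the player who
  announces the answer single out the target among the elements of its own set. This proves the
  theorem for \<open>k = O(\<surd>n)\<close>. For larger \<open>k\<close> the bound is linear, and a single instance of set
  intersection, repeated in all rows, suffices.\<close>

subsection \<open>Level-one inequality and entropy\<close>

text \<open>Where \<open>n^2 / k^2\<close> comes from: the transcript bits are shared by
  \<open>n * n\<close> coordinates, so the squared Hellinger distances of all coordinates sum to
  \<open>O(b)\<close>. By Cauchy-Schwarz the distances sum to \<open>O(n * sqrt b)\<close>, that is
  \<open>O(sqrt b / n)\<close> for an average coordinate, and \<open>k\<close> steps lose
  \<open>k * sqrt b / n\<close>. The visited rows cost \<open>k / n\<close> at each of
  \<open>k\<close> steps; \<open>k^2 / n\<close> must stay small, and beyond that range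
  \<open>n^2 / k^2\<close> is itself \<open>O(n)\<close>. Three obstacles shape the proof. The
  promise correlates the two sets; fixing \<open>d\<close> makes them independent, so that
  transcript probabilities factorise. A doubly planted input violates the promise, so nothing is
  guaranteed about the protocol on it; only the rectangle structure controls its transcripts.
  Finally, the announcing player sees its own set, so near-uniformity given the transcript does not
  bound its success; a separate count of the other elements of its row does.\<close>

lemma sum_Pow_halve:
  fixes f :: "'q set \<Rightarrow> real"
  assumes "finite Q" "q \<in> Q"
  shows "(\<Sum>r\<in>Pow Q. f r) = (\<Sum>r\<in>Pow Q. (f (insert q r) + f (r - {q})) / 2)"
proof -
  obtain R where R: "Q = insert q R" "q \<notin> R"
    using assms(2) by (meson mk_disjoint_insert)
  have fin: "finite R" using assms(1) R by simp
  have inj: "inj_on (insert q) (Pow R)"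
    using R(2) by (auto simp: inj_on_def)
  have split: "(\<Sum>r\<in>Pow Q. g r) = (\<Sum>r\<in>Pow R. g r + g (insert q r))" for g :: "'q set \<Rightarrow> real"
  proof -
    have "(\<Sum>r\<in>Pow Q. g r) = (\<Sum>r\<in>Pow R. g r) + (\<Sum>r\<in>insert q ` Pow R. g r)"
      unfolding R(1) Pow_insert by (rule sum.union_disjoint) (use fin R(2) in auto)
    also have "(\<Sum>r\<in>insert q ` Pow R. g r) = (\<Sum>r\<in>Pow R. g (insert q r))"
      using inj by (simp add: sum.reindex)
    finally show ?thesis by (simp add: sum.distrib)
  qed
  have "f (r - {q}) = f r \<and> f (insert q r - {q}) = f r" if "r \<in> Pow R" for r
  proof -
    have "r - {q} = r" "insert q r - {q} = r" using that R(2) by auto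
    thus ?thesis by simp
  qed
  thus ?thesis unfolding split by (intro sum.cong) (auto simp: field_simps)
qed

lemma exp_le_quadratic:
  fixes x :: real
  assumes "\<bar>x\<bar> \<le> 1"
  shows "exp x \<le> 1 + x + x\<^sup>2"
proof (cases "x \<ge> 0")
  case True
  thus ?thesis using assms by (intro exp_bound) auto
next
  case False
  define y where "y = - x"
  have y: "y > 0" using False y_def by simp
  have "exp (- y) \<le> 1 / (1 + y)"
    using y exp_ge_add_one_self[of y] by (simp add: exp_minus inverse_eq_divide frac_le)
  also have "1 / (1 + y) \<le> 1 - y + y\<^sup>2"
  proof -
    have "(1 - y + y\<^sup>2) * (1 + y) = 1 + y ^ 3" by (simp add: algebra_simps power2_eq_square power3_eq_cube)
    thus ?thesis using y by (simp add: pos_divide_le_eq)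
  qed
  finally show ?thesis by (simp add: y_def)
qed

lemma sum_Pow_exp:
  fixes l :: "'q \<Rightarrow> real"
  assumes "finite Q"
  shows "(\<Sum>r\<in>Pow Q. exp (\<Sum>q\<in>Q. if q \<in> r then l q else - l q)) = (\<Prod>q\<in>Q. exp (l q) + exp (- l q))"
proof -
  have "exp (\<Sum>q\<in>Q. if q \<in> r then l q else - l q) = (\<Prod>q\<in>r. exp (l q)) * (\<Prod>q\<in>Q - r. exp (- l q))"
    if "r \<in> Pow Q" for r
  proof -
    have "exp (\<Sum>q\<in>Q. if q \<in> r then l q else - l q) = (\<Prod>q\<in>Q. if q \<in> r then exp (l q) else exp (- l q))"
      using assms by (simp add: exp_sum if_distrib)
    also have "\<dots> = (\<Prod>q\<in>r. exp (l q)) * (\<Prod>q\<in>Q - r. exp (- l q))"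
    proof -
      have "Q \<inter> r = r" using that by auto
      thus ?thesis using assms prod.If_cases[of Q "\<lambda>q. q \<in> r" "\<lambda>q. exp (l q)" "\<lambda>q. exp (- l q)"]
        by (simp add: Diff_eq)
    qed
    finally show ?thesis .
  qed
  thus ?thesis using assms by (simp add: prod_add)
qed

text \<open>Jensen's inequality for the exponential moment of \<open>\<Sum>\<^sub>q m\<^sub>q \<chi>\<^sub>q / 2\<close> over \<open>S\<close>.\<close>

lemma level_one_inequality:
  fixes Q :: "'q set" and S :: "'q set set" and m :: "'q \<Rightarrow> real"
  assumes Q: "finite Q" and S: "S \<subseteq> Pow Q" "S \<noteq> {}"
  defines "m \<equiv> \<lambda>q. (\<Sum>r\<in>S. if q \<in> r then 1 else - 1) / card S"
  shows "(\<Sum>q\<in>Q. (m q)\<^sup>2) \<le> 4 * ln (2 ^ card Q / card S)"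
proof -
  have finS: "finite S" using S Q finite_subset by auto
  have c0: "card S > 0" using finS S by (simp add: card_gt_0_iff)
  \<comment> \<open>For \<open>l q = c * m q\<close> the argument gives \<open>c - c^2\<close> times
    the sum of squares as a lower bound for the logarithm; \<open>c = 1 / 2\<close> is optimal and
    yields the factor 4.\<close>
  define l where "l q = m q / 2" for q
  have m1: "\<bar>m q\<bar> \<le> 1" for q
  proof -
    have "\<bar>\<Sum>r\<in>S. if q \<in> r then 1 else - 1 :: real\<bar> \<le> (\<Sum>r\<in>S. \<bar>if q \<in> r then 1 else - 1 :: real\<bar>)"
      by (rule sum_abs)
    also have "\<dots> \<le> (\<Sum>r\<in>S. 1)" by (intro sum_mono) auto
    finally show ?thesis using c0 by (simp add: m_def abs_divide divide_le_eq)
  qed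
  define X where "X r = (\<Sum>q\<in>Q. if q \<in> r then l q else - l q)" for r
  define M where "M = (\<Sum>q\<in>Q. l q * m q)"
  have sumX: "(\<Sum>r\<in>S. X r) = card S * M"
  proof -
    have "(\<Sum>r\<in>S. X r) = (\<Sum>q\<in>Q. \<Sum>r\<in>S. if q \<in> r then l q else - l q)"
      unfolding X_def by (rule sum.swap)
    also have "\<dots> = (\<Sum>q\<in>Q. l q * (\<Sum>r\<in>S. if q \<in> r then 1 else - 1))"
      unfolding sum_distrib_left by (intro sum.cong) auto
    also have "\<dots> = (\<Sum>q\<in>Q. card S * (l q * m q))"
      using c0 by (intro sum.cong) (auto simp: m_def)
    finally show ?thesis by (simp add: M_def sum_distrib_left)
  qed
  \<comment> \<open>The summand is the tangent of \<open>exp\<close> at the mean \<open>M\<close> of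
    \<open>X\<close> over \<open>S\<close>, which lies below \<open>exp\<close>.\<close>
  have "card S * exp M = (\<Sum>r\<in>S. exp M * (1 + (X r - M)))"
    using sumX by (simp add: sum_distrib_left[symmetric] sum.distrib sum_subtractf)
  also have "\<dots> \<le> (\<Sum>r\<in>S. exp (X r))"
  proof (rule sum_mono)
    fix r
    have "exp M * (1 + (X r - M)) \<le> exp M * exp (X r - M)"
      using exp_ge_add_one_self[of "X r - M"] by (intro mult_left_mono) auto
    thus "exp M * (1 + (X r - M)) \<le> exp (X r)" by (simp add: exp_add[symmetric])
  qed
  also have "\<dots> \<le> (\<Sum>r\<in>Pow Q. exp (X r))"
    using Q S by (intro sum_mono2) auto
  also have "\<dots> = (\<Prod>q\<in>Q. exp (l q) + exp (- l q))"
    unfolding X_def using Q by (rule sum_Pow_exp)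
  also have "\<dots> \<le> (\<Prod>q\<in>Q. 2 * exp ((l q)\<^sup>2))"
  proof (intro prod_mono conjI)
    fix q
    have b: "\<bar>l q\<bar> \<le> 1" using m1[of q] by (simp add: l_def)
    \<comment> \<open>The linear terms of the two quadratic bounds cancel.\<close>
    have "exp (l q) + exp (- l q) \<le> 2 * (1 + (l q)\<^sup>2)"
      using exp_le_quadratic[OF b] exp_le_quadratic[of "- l q"] b by simp
    also have "\<dots> \<le> 2 * exp ((l q)\<^sup>2)" by (intro mult_left_mono exp_ge_add_one_self) simp
    finally show "exp (l q) + exp (- l q) \<le> 2 * exp ((l q)\<^sup>2)" .
  qed (simp add: add_nonneg_nonneg)
  also have "\<dots> = 2 ^ card Q * exp (\<Sum>q\<in>Q. (l q)\<^sup>2)"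
    using Q by (simp add: prod.distrib exp_sum)
  finally have "card S * exp M \<le> 2 ^ card Q * exp (\<Sum>q\<in>Q. (l q)\<^sup>2)" .
  hence "exp (M - (\<Sum>q\<in>Q. (l q)\<^sup>2)) \<le> 2 ^ card Q / card S"
    using c0 by (simp add: exp_diff field_simps)
  hence "M - (\<Sum>q\<in>Q. (l q)\<^sup>2) \<le> ln (2 ^ card Q / card S)"
    using c0 by (subst ln_ge_iff) auto
  moreover have "M = (\<Sum>q\<in>Q. (m q)\<^sup>2) / 2"
    by (simp add: M_def l_def power2_eq_square sum_divide_distrib)
  moreover have "(\<Sum>q\<in>Q. (l q)\<^sup>2) = (\<Sum>q\<in>Q. (m q)\<^sup>2) / 4"
    by (simp add: l_def power_divide sum_divide_distrib)
  ultimately show ?thesis by simp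
qed

text \<open>Gibbs' inequality against the uniform distribution, termwise from
  \<open>ln x \<le> x - 1\<close>.\<close>

lemma entropy_le_ln_card:
  fixes p :: "'l \<Rightarrow> real"
  assumes "finite L" and p: "\<And>l. l \<in> L \<Longrightarrow> p l \<ge> 0" and "(\<Sum>l\<in>L. p l) = 1"
  shows "(\<Sum>l\<in>L. p l * ln (1 / p l)) \<le> ln (card L)"
proof -
  have L: "L \<noteq> {}" using assms(3) by auto
  have K: "real (card L) > 0" using assms(1) L by (simp add: card_gt_0_iff)
  have "p l * ln (1 / p l) - p l * ln (card L) \<le> 1 / card L - p l" if "l \<in> L" for l
  proof (cases "p l = 0")
    case True
    thus ?thesis using K by simp
  next
    case False
    hence pos: "p l > 0" using p[OF that] by simp
    have "ln (1 / (p l * card L)) \<le> 1 / (p l * card L) - 1"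
      using pos K by (intro ln_le_minus_one) auto
    hence "p l * ln (1 / (p l * card L)) \<le> p l * (1 / (p l * card L) - 1)"
      using pos by (intro mult_left_mono) auto
    also have "\<dots> = 1 / card L - p l" using pos by (simp add: field_simps)
    finally show ?thesis using pos K by (simp add: ln_div ln_mult algebra_simps)
  qed
  hence "(\<Sum>l\<in>L. p l * ln (1 / p l) - p l * ln (card L)) \<le> (\<Sum>l\<in>L. 1 / card L - p l)"
    by (rule sum_mono)
  also have "\<dots> = 0" using K assms(3) by (simp add: sum_subtractf)
  finally show ?thesis
    using assms(3) by (simp add: sum_subtractf sum_distrib_right[symmetric])
qed

lemma sum_sqrt_le:
  fixes f :: "'i \<Rightarrow> real"
  assumes "\<And>i. i \<in> I \<Longrightarrow> f i \<ge> 0"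
  shows "(\<Sum>i\<in>I. sqrt (f i)) \<le> sqrt (card I * (\<Sum>i\<in>I. f i))"
proof -
  have "(\<Sum>i\<in>I. 1 * sqrt (f i))\<^sup>2 \<le> (\<Sum>i\<in>I. 1\<^sup>2) * (\<Sum>i\<in>I. (sqrt (f i))\<^sup>2)"
    by (rule Cauchy_Schwarz_ineq_sum)
  also have "(\<Sum>i\<in>I. (sqrt (f i))\<^sup>2) = (\<Sum>i\<in>I. f i)"
    using assms by (intro sum.cong) auto
  finally show ?thesis by (intro real_le_rsqrt) simp
qed

subsection \<open>Hellinger distance of transcript distributions\<close>

text \<open>The probability that one player's set lies in \<open>F\<close>: \<open>W\<close> is
  planted and the coordinates in \<open>d\<close> are uniform bits. The average runs over bits for
  all of \<open>Q\<close>, so the denominator does not change with \<open>d\<close>.\<close>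

definition pr :: "'q set \<Rightarrow> 'q set \<Rightarrow> 'q set \<Rightarrow> 'q set set \<Rightarrow> real" where
  "pr Q W d F = (\<Sum>r\<in>Pow Q. of_bool (W \<union> d \<inter> r \<in> F)) / 2 ^ card Q"

lemma pr_nonneg: "pr Q W d F \<ge> 0"
  unfolding pr_def by (intro divide_nonneg_nonneg sum_nonneg) auto

lemma pr_le_1:
  assumes "finite Q"
  shows "pr Q W d F \<le> 1"
proof -
  have "(\<Sum>r\<in>Pow Q. of_bool (W \<union> d \<inter> r \<in> F) :: real) \<le> (\<Sum>r\<in>Pow Q. 1)"
    by (intro sum_mono) auto
  thus ?thesis using assms by (simp add: pr_def card_Pow divide_le_eq)
qed

lemma pr_insert_planted: "pr Q (insert q W) d F = pr Q (insert q W) (d - {q}) F"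
proof -
  have "insert q W \<union> d \<inter> r = insert q W \<union> (d - {q}) \<inter> r" for r by auto
  thus ?thesis by (simp only: pr_def)
qed

lemma pr_halve:
  assumes "finite Q" "q \<in> Q" "q \<in> d"
  shows "pr Q W d F = (pr Q W (d - {q}) F + pr Q (insert q W) (d - {q}) F) / 2"
proof -
  have 1: "W \<union> d \<inter> insert q r = insert q W \<union> (d - {q}) \<inter> r" for r using assms(3) by auto
  have 2: "W \<union> d \<inter> (r - {q}) = W \<union> (d - {q}) \<inter> r" for r by auto
  show ?thesis
    unfolding pr_def sum_Pow_halve[OF assms(1,2), of "\<lambda>r. of_bool (W \<union> d \<inter> r \<in> F)"] 1 2
    by (simp add: sum.distrib add_divide_distrib sum_divide_distrib[symmetric])
qed

lemma sqrt_diff_squared_le: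
  fixes a b :: real
  assumes "a \<ge> 0" "b \<ge> 0" "a + b > 0"
  shows "(sqrt a - sqrt b)\<^sup>2 \<le> (a - b)\<^sup>2 / (a + b)"
proof -
  have "(a - b)\<^sup>2 = (sqrt a - sqrt b)\<^sup>2 * (sqrt a + sqrt b)\<^sup>2"
  proof -
    have "a - b = (sqrt a - sqrt b) * (sqrt a + sqrt b)"
      using assms by (simp add: algebra_simps)
    thus ?thesis by (simp add: power_mult_distrib)
  qed
  also have "\<dots> \<ge> (sqrt a - sqrt b)\<^sup>2 * (a + b)"
  proof (intro mult_left_mono)
    show "a + b \<le> (sqrt a + sqrt b)\<^sup>2"
      using assms by (simp add: power2_sum)
  qed simp
  finally show ?thesis using assms by (simp add: le_divide_eq)
qed

lemma sum_sqrt_pr_diff_le: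
  fixes Q d W :: "'q set" and F :: "'q set set"
  assumes Q: "finite Q" and d: "d \<subseteq> Q"
  defines "\<mu> \<equiv> pr Q W d F"
  shows "(\<Sum>q\<in>d - W. (sqrt (pr Q W (d - {q}) F) - sqrt (pr Q (insert q W) (d - {q}) F))\<^sup>2)
           \<le> 8 * (\<mu> * ln (1 / \<mu>))"
proof -
  define a0 where "a0 q = pr Q W (d - {q}) F" for q
  define a1 where "a1 q = pr Q (insert q W) (d - {q}) F" for q
  have half: "\<mu> = (a0 q + a1 q) / 2" if "q \<in> d" for q
    using pr_halve[OF Q, of q d W F] that d by (auto simp: \<mu>_def a0_def a1_def)
  have nn: "a0 q \<ge> 0" "a1 q \<ge> 0" for q by (simp_all add: a0_def a1_def pr_nonneg)
  show ?thesis
  proof (cases "\<mu> = 0")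
    case True
    hence "a0 q = 0 \<and> a1 q = 0" if "q \<in> d" for q
      using half[OF that] nn[of q] True by (simp add: add_nonneg_eq_0_iff)
    thus ?thesis using True by (auto simp: a0_def a1_def)
  next
    case False
    hence \<mu>: "\<mu> > 0" using pr_nonneg[of Q W d F] by (simp add: \<mu>_def)
    define S where "S = {r\<in>Pow Q. W \<union> d \<inter> r \<in> F}"
    have sumS: "(\<Sum>r\<in>S. g r) = (\<Sum>r\<in>Pow Q. of_bool (W \<union> d \<inter> r \<in> F) * g r)" for g :: "'q set \<Rightarrow> real"
    proof -
      have "(\<Sum>r\<in>S. g r) = (\<Sum>r\<in>S. of_bool (W \<union> d \<inter> r \<in> F) * g r)"
        by (intro sum.cong) (auto simp: S_def)
      also have "\<dots> = (\<Sum>r\<in>Pow Q. of_bool (W \<union> d \<inter> r \<in> F) * g r)"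
        using Q by (intro sum.mono_neutral_left) (auto simp: S_def)
      finally show ?thesis .
    qed
    have cS: "card S = \<mu> * 2 ^ card Q"
      using sumS[of "\<lambda>_. 1"] by (simp add: \<mu>_def pr_def)
    have S0: "S \<noteq> {}"
    proof
      assume "S = {}"
      hence "real (card S) = 0" by simp
      thus False using cS \<mu> by simp
    qed
    define m where "m q = (\<Sum>r\<in>S. if q \<in> r then 1 else - 1 :: real) / card S" for q
    have m: "m q = (a1 q - a0 q) / (2 * \<mu>)" if q: "q \<in> d" for q
    proof -
      have qQ: "q \<in> Q" using q d by auto
      have 1: "W \<union> d \<inter> insert q r = insert q W \<union> (d - {q}) \<inter> r" for r using q by auto
      have 2: "W \<union> d \<inter> (r - {q}) = W \<union> (d - {q}) \<inter> r" for r by auto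
      have "(\<Sum>r\<in>S. if q \<in> r then 1 else - 1 :: real) =
          (\<Sum>r\<in>Pow Q. of_bool (W \<union> d \<inter> r \<in> F) * (if q \<in> r then 1 else - 1))"
        by (rule sumS)
      also have "\<dots> = (\<Sum>r\<in>Pow Q. (of_bool (insert q W \<union> (d - {q}) \<inter> r \<in> F) - of_bool (W \<union> (d - {q}) \<inter> r \<in> F)) / 2)"
        unfolding sum_Pow_halve[OF Q qQ, of "\<lambda>r. of_bool (W \<union> d \<inter> r \<in> F) * (if q \<in> r then 1 else - 1)"] 1 2
        by (intro sum.cong) auto
      also have "\<dots> = 2 ^ card Q * (a1 q - a0 q) / 2"
        by (simp add: a0_def a1_def pr_def sum_subtractf sum_divide_distrib[symmetric] field_simps)
      finally have s: "(\<Sum>r\<in>S. if q \<in> r then 1 else - 1 :: real) = 2 ^ card Q * (a1 q - a0 q) / 2" .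
      show ?thesis unfolding m_def cS s using \<mu> by (simp add: field_simps)
    qed
    have "(\<Sum>q\<in>d - W. (sqrt (a0 q) - sqrt (a1 q))\<^sup>2) \<le> (\<Sum>q\<in>d - W. 2 * \<mu> * (m q)\<^sup>2)"
    proof (rule sum_mono)
      fix q assume q: "q \<in> d - W"
      have s: "a0 q + a1 q = 2 * \<mu>" using half[of q] q by simp
      have "(sqrt (a0 q) - sqrt (a1 q))\<^sup>2 \<le> (a0 q - a1 q)\<^sup>2 / (a0 q + a1 q)"
        using nn[of q] s \<mu> by (intro sqrt_diff_squared_le) auto
      also have "\<dots> = 2 * \<mu> * (m q)\<^sup>2"
        using \<mu> q by (simp add: m s power_divide power_mult_distrib power2_commute field_simps power2_eq_square)
      finally show "(sqrt (a0 q) - sqrt (a1 q))\<^sup>2 \<le> 2 * \<mu> * (m q)\<^sup>2" .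
    qed
    also have "\<dots> \<le> 2 * \<mu> * (\<Sum>q\<in>Q. (m q)\<^sup>2)"
      unfolding sum_distrib_left[symmetric] using \<mu> Q d
      by (intro mult_left_mono sum_mono2) auto
    also have "\<dots> \<le> 2 * \<mu> * (4 * ln (2 ^ card Q / card S))"
      using \<mu> level_one_inequality[OF Q _ S0, folded m_def] by (intro mult_left_mono) (auto simp: S_def)
    also have "2 ^ card Q / card S = 1 / \<mu>" using \<mu> by (simp add: cS)
    finally show ?thesis by (simp add: a0_def a1_def algebra_simps)
  qed
qed

lemma sum_Pow_complement:
  shows "(\<Sum>d\<in>Pow Q. f (Q - d)) = (\<Sum>d\<in>Pow Q. f d)"
  by (rule sum.reindex_bij_witness[of _ "\<lambda>d. Q - d" "\<lambda>d. Q - d"]) auto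

lemma sum_Pow_mem_half:
  fixes f :: "'q set \<Rightarrow> real"
  assumes "finite Q" "q \<in> Q" and "\<And>d. f (insert q d) = f d"
  shows "(\<Sum>d\<in>Pow Q. of_bool (q \<in> d) * f d) = (\<Sum>d\<in>Pow Q. f d) / 2"
  by (subst sum_Pow_halve[OF assms(1,2)]) (simp add: assms(3) sum_divide_distrib)

text \<open>Factor \<open>p - r\<close> as a difference of squares of roots and apply
  Cauchy-Schwarz; the factor with the sums of roots contributes at most 4 under the root. Total mass
  at most 1 suffices, as needed for doubly planted inputs.\<close>

lemma sum_abs_diff_le_Hellinger:
  fixes p r :: "'l \<Rightarrow> real"
  assumes nn: "\<And>l. l \<in> L \<Longrightarrow> p l \<ge> 0" "\<And>l. l \<in> L \<Longrightarrow> r l \<ge> 0"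
    and "(\<Sum>l\<in>L. p l) \<le> 1" "(\<Sum>l\<in>L. r l) \<le> 1"
  shows "(\<Sum>l\<in>L. \<bar>p l - r l\<bar>) \<le> 2 * sqrt (\<Sum>l\<in>L. (sqrt (p l) - sqrt (r l))\<^sup>2)"
proof -
  let ?H = "\<Sum>l\<in>L. (sqrt (p l) - sqrt (r l))\<^sup>2"
  have H0: "?H \<ge> 0" by (intro sum_nonneg) auto
  have "(\<Sum>l\<in>L. \<bar>p l - r l\<bar>) = (\<Sum>l\<in>L. \<bar>sqrt (p l) - sqrt (r l)\<bar> * (sqrt (p l) + sqrt (r l)))"
  proof (rule sum.cong)
    fix l assume l: "l \<in> L"
    have "p l - r l = (sqrt (p l) - sqrt (r l)) * (sqrt (p l) + sqrt (r l))"
      using nn[OF l] by (simp add: algebra_simps)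
    moreover have "sqrt (p l) + sqrt (r l) \<ge> 0" using nn[OF l] by simp
    ultimately show "\<bar>p l - r l\<bar> = \<bar>sqrt (p l) - sqrt (r l)\<bar> * (sqrt (p l) + sqrt (r l))"
      by (simp add: abs_mult)
  qed simp
  also have "\<dots> \<le> sqrt (4 * ?H)"
  proof (rule real_le_rsqrt)
    have "(\<Sum>l\<in>L. \<bar>sqrt (p l) - sqrt (r l)\<bar> * (sqrt (p l) + sqrt (r l)))\<^sup>2
        \<le> (\<Sum>l\<in>L. \<bar>sqrt (p l) - sqrt (r l)\<bar>\<^sup>2) * (\<Sum>l\<in>L. (sqrt (p l) + sqrt (r l))\<^sup>2)"
      by (rule Cauchy_Schwarz_ineq_sum)
    also have "(\<Sum>l\<in>L. (sqrt (p l) + sqrt (r l))\<^sup>2) \<le> (\<Sum>l\<in>L. 2 * p l + 2 * r l)"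
    proof (rule sum_mono)
      fix l assume l: "l \<in> L"
      have "(sqrt (p l) + sqrt (r l))\<^sup>2 + (sqrt (p l) - sqrt (r l))\<^sup>2 = 2 * p l + 2 * r l"
        using nn[OF l] by (simp add: power2_sum power2_diff)
      thus "(sqrt (p l) + sqrt (r l))\<^sup>2 \<le> 2 * p l + 2 * r l"
        using zero_le_power2[of "sqrt (p l) - sqrt (r l)"] by linarith
    qed
    also have "\<dots> = 2 * (\<Sum>l\<in>L. p l) + 2 * (\<Sum>l\<in>L. r l)"
      by (simp add: sum.distrib sum_distrib_left)
    also have "\<dots> \<le> 4" using assms(3,4) by simp
    finally have "(\<Sum>l\<in>L. \<bar>sqrt (p l) - sqrt (r l)\<bar> * (sqrt (p l) + sqrt (r l)))\<^sup>2 \<le> ?H * 4"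
      using H0 by (simp add: mult_left_mono)
    thus "(\<Sum>l\<in>L. \<bar>sqrt (p l) - sqrt (r l)\<bar> * (sqrt (p l) + sqrt (r l)))\<^sup>2 \<le> 4 * ?H"
      by (simp only: mult.commute)
  qed
  finally show ?thesis using H0 by (simp add: real_sqrt_mult)
qed

text \<open>The products \<open>a\<^sub>i b\<^sub>j\<close> are the transcript distributions when the two players' bits in one
  coordinate are \<open>i\<close> and \<open>j\<close>. The Hellinger affinity of the distributions for \<open>00\<close> and \<open>11\<close> is that
  of \<open>01\<close> and \<open>10\<close>.\<close>

lemma cut_and_paste:
  fixes a0 a1 b0 b1 :: "'l \<Rightarrow> real"
  assumes nn: "\<And>l. a0 l \<ge> 0" "\<And>l. a1 l \<ge> 0" "\<And>l. b0 l \<ge> 0" "\<And>l. b1 l \<ge> 0"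
    and s: "(\<Sum>l\<in>L. a0 l * b0 l) = 1" "(\<Sum>l\<in>L. a0 l * b1 l) = 1" "(\<Sum>l\<in>L. a1 l * b0 l) = 1"
      "(\<Sum>l\<in>L. a1 l * b1 l) \<le> 1"
  defines "e \<equiv> (\<Sum>l\<in>L. b0 l * (sqrt (a0 l) - sqrt (a1 l))\<^sup>2) + (\<Sum>l\<in>L. a0 l * (sqrt (b0 l) - sqrt (b1 l))\<^sup>2)"
  shows "(\<Sum>l\<in>L. \<bar>a0 l * b0 l - a1 l * b1 l\<bar>) \<le> 3 * sqrt e"
    and "(\<Sum>l\<in>L. \<bar>a1 l * b0 l - a1 l * b1 l\<bar>) \<le> 5 * sqrt e"
    and "(\<Sum>l\<in>L. \<bar>a0 l * b1 l - a1 l * b1 l\<bar>) \<le> 5 * sqrt e"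
proof -
  define e1 where "e1 = (\<Sum>l\<in>L. b0 l * (sqrt (a0 l) - sqrt (a1 l))\<^sup>2)"
  define e2 where "e2 = (\<Sum>l\<in>L. a0 l * (sqrt (b0 l) - sqrt (b1 l))\<^sup>2)"
  have e: "e = e1 + e2" by (simp add: e_def e1_def e2_def)
  have e0: "e1 \<ge> 0" "e2 \<ge> 0" unfolding e1_def e2_def using nn by (auto intro!: sum_nonneg)
  have h1: "(sqrt (a0 l * b0 l) - sqrt (a1 l * b0 l))\<^sup>2 = b0 l * (sqrt (a0 l) - sqrt (a1 l))\<^sup>2" for l
  proof -
    have "sqrt (a0 l * b0 l) - sqrt (a1 l * b0 l) = sqrt (b0 l) * (sqrt (a0 l) - sqrt (a1 l))"
      by (simp add: real_sqrt_mult algebra_simps)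
    thus ?thesis using nn by (simp add: power_mult_distrib)
  qed
  have h2: "(sqrt (a0 l * b0 l) - sqrt (a0 l * b1 l))\<^sup>2 = a0 l * (sqrt (b0 l) - sqrt (b1 l))\<^sup>2" for l
  proof -
    have "sqrt (a0 l * b0 l) - sqrt (a0 l * b1 l) = sqrt (a0 l) * (sqrt (b0 l) - sqrt (b1 l))"
      by (simp add: real_sqrt_mult algebra_simps)
    thus ?thesis using nn by (simp add: power_mult_distrib)
  qed
  have L10: "(\<Sum>l\<in>L. \<bar>a0 l * b0 l - a1 l * b0 l\<bar>) \<le> 2 * sqrt e"
  proof -
    have "(\<Sum>l\<in>L. \<bar>a0 l * b0 l - a1 l * b0 l\<bar>) \<le> 2 * sqrt e1"
      unfolding e1_def h1[symmetric] by (rule sum_abs_diff_le_Hellinger) (use nn s in auto)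
    also have "sqrt e1 \<le> sqrt e" using e0 e by simp
    finally show ?thesis by simp
  qed
  have L01: "(\<Sum>l\<in>L. \<bar>a0 l * b0 l - a0 l * b1 l\<bar>) \<le> 2 * sqrt e"
  proof -
    have "(\<Sum>l\<in>L. \<bar>a0 l * b0 l - a0 l * b1 l\<bar>) \<le> 2 * sqrt e2"
      unfolding e2_def h2[symmetric] by (rule sum_abs_diff_le_Hellinger) (use nn s in auto)
    also have "sqrt e2 \<le> sqrt e" using e0 e by simp
    finally show ?thesis by simp
  qed
  \<comment> \<open>The affinity shared by the pairs \<open>00, 11\<close> and
    \<open>01, 10\<close>. Since the mass of \<open>11\<close> is at most 1, the distance of the
    first pair is at most that of the second.\<close>
  define M where "M = (\<Sum>l\<in>L. sqrt (a0 l) * sqrt (b0 l) * sqrt (a1 l) * sqrt (b1 l))"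
  have sq: "(sqrt (x * y) - sqrt (z * w))\<^sup>2 = x * y + z * w - 2 * (sqrt x * sqrt y * sqrt z * sqrt w)"
    if "x \<ge> 0" "y \<ge> 0" "z \<ge> 0" "w \<ge> 0" for x y z w :: real
    using that by (simp add: power2_diff real_sqrt_mult power_mult_distrib)
  have "(\<Sum>l\<in>L. (sqrt (a0 l * b0 l) - sqrt (a1 l * b1 l))\<^sup>2) = (\<Sum>l\<in>L. a0 l * b0 l) + (\<Sum>l\<in>L. a1 l * b1 l) - 2 * M"
    by (simp add: sq nn sum.distrib sum_subtractf M_def sum_distrib_left)
  also have "\<dots> \<le> (\<Sum>l\<in>L. a0 l * b1 l) + (\<Sum>l\<in>L. a1 l * b0 l) - 2 * M"
    using s by simp
  also have "\<dots> = (\<Sum>l\<in>L. (sqrt (a0 l * b1 l) - sqrt (a1 l * b0 l))\<^sup>2)"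
    by (simp add: sq nn sum.distrib sum_subtractf M_def sum_distrib_left mult_ac)
  also have "\<dots> \<le> (\<Sum>l\<in>L. 2 * (a0 l * (sqrt (b0 l) - sqrt (b1 l))\<^sup>2) + 2 * (b0 l * (sqrt (a0 l) - sqrt (a1 l))\<^sup>2))"
  proof (rule sum_mono)
    fix l
    have tri: "(x - z)\<^sup>2 \<le> 2 * (y - x)\<^sup>2 + 2 * (y - z)\<^sup>2" for x y z :: real
    proof -
      have "2 * (y - x)\<^sup>2 + 2 * (y - z)\<^sup>2 - (x - z)\<^sup>2 = (2 * y - x - z)\<^sup>2"
        by (simp add: power2_eq_square algebra_simps)
      thus ?thesis using zero_le_power2[of "2 * y - x - z"] by linarith
    qed
    show "(sqrt (a0 l * b1 l) - sqrt (a1 l * b0 l))\<^sup>2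
       \<le> 2 * (a0 l * (sqrt (b0 l) - sqrt (b1 l))\<^sup>2) + 2 * (b0 l * (sqrt (a0 l) - sqrt (a1 l))\<^sup>2)"
      unfolding h1[symmetric] h2[symmetric] by (rule tri)
  qed
  also have "\<dots> = 2 * e" by (simp add: e e1_def e2_def sum.distrib sum_distrib_left)
  finally have h11: "(\<Sum>l\<in>L. (sqrt (a0 l * b0 l) - sqrt (a1 l * b1 l))\<^sup>2) \<le> 2 * e" .
  have "(\<Sum>l\<in>L. \<bar>a0 l * b0 l - a1 l * b1 l\<bar>) \<le> 2 * sqrt (\<Sum>l\<in>L. (sqrt (a0 l * b0 l) - sqrt (a1 l * b1 l))\<^sup>2)"
    by (rule sum_abs_diff_le_Hellinger) (use nn s in auto)
  also have "\<dots> \<le> 2 * sqrt (2 * e)" using h11 by simp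
  also have "\<dots> \<le> sqrt (3\<^sup>2 * e)"
    using e e0 by (intro real_le_rsqrt) (simp add: power_mult_distrib)
  also have "\<dots> = 3 * sqrt e" by (simp add: real_sqrt_mult)
  finally show L11: "(\<Sum>l\<in>L. \<bar>a0 l * b0 l - a1 l * b1 l\<bar>) \<le> 3 * sqrt e" .
  have "(\<Sum>l\<in>L. \<bar>a1 l * b0 l - a1 l * b1 l\<bar>)
      \<le> (\<Sum>l\<in>L. \<bar>a0 l * b0 l - a1 l * b0 l\<bar> + \<bar>a0 l * b0 l - a1 l * b1 l\<bar>)"
    by (intro sum_mono) linarith
  thus "(\<Sum>l\<in>L. \<bar>a1 l * b0 l - a1 l * b1 l\<bar>) \<le> 5 * sqrt e"
    using L10 L11 by (simp add: sum.distrib)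
  have "(\<Sum>l\<in>L. \<bar>a0 l * b1 l - a1 l * b1 l\<bar>)
      \<le> (\<Sum>l\<in>L. \<bar>a0 l * b0 l - a0 l * b1 l\<bar> + \<bar>a0 l * b0 l - a1 l * b1 l\<bar>)"
    by (intro sum_mono) linarith
  thus "(\<Sum>l\<in>L. \<bar>a0 l * b1 l - a1 l * b1 l\<bar>) \<le> 5 * sqrt e"
    using L01 L11 by (simp add: sum.distrib)
qed

section \<open>Transcript distributions of a family of disjoint rectangles\<close>

locale rectangles =
  fixes Q :: "'q set" and L :: "'l set" and A B :: "'l \<Rightarrow> 'q set set"
  assumes finite_Q: "finite Q" and finite_L: "finite L"
    and disjoint: "\<And>l l' a b. a \<in> A l \<Longrightarrow> a \<in> A l' \<Longrightarrow> b \<in> B l \<Longrightarrow> b \<in> B l' \<Longrightarrow> l = l'"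
begin

text \<open>Only pairs of sets with intersection exactly \<open>W\<close> are considered, so
  \<open>covers\<close> can hold for the graph of the targets and fail once a second element is
  planted.\<close>

definition covers :: "'q set \<Rightarrow> bool" where
  "covers W \<longleftrightarrow> (\<forall>d\<in>Pow Q. \<forall>r\<in>Pow Q. \<forall>r'\<in>Pow Q. \<exists>l\<in>L. W \<union> d \<inter> r \<in> A l \<and> W \<union> (Q - d) \<inter> r' \<in> B l)"

definition prob :: "'q set \<Rightarrow> 'q set \<Rightarrow> 'l \<Rightarrow> real" where
  "prob W d l = pr Q W d (A l) * pr Q W (Q - d) (B l)"

text \<open>The squared Hellinger distance, without the factor 1/2, between the transcripts for the
  bits \<open>00\<close> and \<open>10\<close> at \<open>q\<close>. Removing \<open>q\<close> on
  both sides makes it independent of whether \<open>q \<in> d\<close>.\<close>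

definition divergence :: "'q set \<Rightarrow> 'q set \<Rightarrow> 'q \<Rightarrow> real" where
  "divergence W d q = (\<Sum>l\<in>L. pr Q W (Q - d - {q}) (B l) *
     (sqrt (pr Q W (d - {q}) (A l)) - sqrt (pr Q (insert q W) (d - {q}) (A l)))\<^sup>2)"

lemma pr_mult:
  "pr Q W d F * pr Q W' d' G =
     (\<Sum>r\<in>Pow Q. \<Sum>r'\<in>Pow Q. of_bool (W \<union> d \<inter> r \<in> F \<and> W' \<union> d' \<inter> r' \<in> G)) / 4 ^ card Q"
  by (simp add: pr_def sum_product of_bool_conj power_mult_distrib[symmetric])

lemma sum_of_bool_le_1: "(\<Sum>l\<in>L. of_bool (a \<in> A l \<and> b \<in> B l) :: real) \<le> 1"
proof (cases "\<exists>l\<in>L. a \<in> A l \<and> b \<in> B l")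
  case True
  then obtain l where l: "l \<in> L" "a \<in> A l" "b \<in> B l" by auto
  have "(\<Sum>l'\<in>L. of_bool (a \<in> A l' \<and> b \<in> B l') :: real) = (\<Sum>l'\<in>L. if l' = l then 1 else 0)"
    using l disjoint by (intro sum.cong) (auto simp: of_bool_def)
  thus ?thesis using l finite_L by simp
qed (auto intro!: order.trans[OF eq_refl[OF sum.neutral]])

lemma sum_of_bool_eq_1:
  assumes "l \<in> L" "a \<in> A l" "b \<in> B l"
  shows "(\<Sum>l\<in>L. of_bool (a \<in> A l \<and> b \<in> B l) * f l) = (f l :: real)"
proof -
  have "(\<Sum>l'\<in>L. of_bool (a \<in> A l' \<and> b \<in> B l') * f l') = (\<Sum>l'\<in>L. if l' = l then f l else 0)"
    using assms disjoint by (intro sum.cong) (auto simp: of_bool_def)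
  thus ?thesis using assms finite_L by simp
qed

lemma sum_pr_mult:
  "(\<Sum>l\<in>L. pr Q W d (A l) * pr Q W' d' (B l)) =
     (\<Sum>r\<in>Pow Q. \<Sum>r'\<in>Pow Q. \<Sum>l\<in>L. of_bool (W \<union> d \<inter> r \<in> A l \<and> W' \<union> d' \<inter> r' \<in> B l)) / 4 ^ card Q"
  unfolding pr_mult sum_divide_distrib[symmetric]
  by (subst sum.swap, intro arg_cong2[of _ _ _ _ "(/)"] sum.cong refl sum.swap)

lemma sum_Pow_Pow_1: "(\<Sum>r\<in>Pow Q. \<Sum>r'\<in>Pow Q. 1 :: real) = 4 ^ card Q"
  using finite_Q by (simp add: card_Pow power_mult_distrib[symmetric])

lemma sum_pr_mult_le_1: "(\<Sum>l\<in>L. pr Q W d (A l) * pr Q W' d' (B l)) \<le> 1"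
proof -
  have "(\<Sum>r\<in>Pow Q. \<Sum>r'\<in>Pow Q. \<Sum>l\<in>L. of_bool (W \<union> d \<inter> r \<in> A l \<and> W' \<union> d' \<inter> r' \<in> B l) :: real)
      \<le> (\<Sum>r\<in>Pow Q. \<Sum>r'\<in>Pow Q. 1)"
    by (intro sum_mono sum_of_bool_le_1)
  thus ?thesis unfolding sum_pr_mult sum_Pow_Pow_1 by simp
qed

lemma prob_nonneg: "prob W d l \<ge> 0"
  by (simp add: prob_def pr_nonneg)

lemma sum_prob:
  assumes "covers W" "d \<subseteq> Q"
  shows "(\<Sum>l\<in>L. prob W d l) = 1"
proof -
  have "(\<Sum>r\<in>Pow Q. \<Sum>r'\<in>Pow Q. \<Sum>l\<in>L. of_bool (W \<union> d \<inter> r \<in> A l \<and> W \<union> (Q - d) \<inter> r' \<in> B l) :: real)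
      = (\<Sum>r\<in>Pow Q. \<Sum>r'\<in>Pow Q. 1)"
  proof (intro sum.cong refl)
    fix r r' assume "r \<in> Pow Q" "r' \<in> Pow Q"
    then obtain l where "l \<in> L" "W \<union> d \<inter> r \<in> A l" "W \<union> (Q - d) \<inter> r' \<in> B l"
      using assms unfolding covers_def by blast
    thus "(\<Sum>l\<in>L. of_bool (W \<union> d \<inter> r \<in> A l \<and> W \<union> (Q - d) \<inter> r' \<in> B l) :: real) = 1"
      using sum_of_bool_eq_1[of l _ _ "\<lambda>_. 1"] by simp
  qed
  thus ?thesis unfolding prob_def sum_pr_mult sum_Pow_Pow_1 by simp
qed

text \<open>For each label the sum over \<open>q\<close> is at most
  \<open>8 * \<alpha> l * ln (1 / \<alpha> l)\<close>. Weighted with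
  \<open>\<beta> l \<le> 1\<close>, these terms are dominated by 8 times the entropy of the
  transcript, whose probabilities are \<open>\<alpha> l * \<beta> l\<close>.\<close>

lemma sum_divergence_le:
  assumes W: "covers W" and d: "d \<subseteq> Q"
  shows "(\<Sum>q\<in>d - W. divergence W d q) \<le> 8 * ln (card L)"
proof -
  define \<alpha> where "\<alpha> l = pr Q W d (A l)" for l
  define \<beta> where "\<beta> l = pr Q W (Q - d) (B l)" for l
  define D where "D q l = (sqrt (pr Q W (d - {q}) (A l)) - sqrt (pr Q (insert q W) (d - {q}) (A l)))\<^sup>2" for q l
  have "(\<Sum>q\<in>d - W. divergence W d q) = (\<Sum>q\<in>d - W. \<Sum>l\<in>L. \<beta> l * D q l)"
  proof (rule sum.cong)
    fix q assume "q \<in> d - W"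
    hence "Q - d - {q} = Q - d" by auto
    thus "divergence W d q = (\<Sum>l\<in>L. \<beta> l * D q l)" by (simp only: divergence_def \<beta>_def D_def)
  qed simp
  also have "\<dots> = (\<Sum>l\<in>L. \<beta> l * (\<Sum>q\<in>d - W. D q l))"
    unfolding sum_distrib_left by (rule sum.swap)
  also have "\<dots> \<le> (\<Sum>l\<in>L. \<beta> l * (8 * (\<alpha> l * ln (1 / \<alpha> l))))"
    unfolding D_def \<alpha>_def using d finite_Q
    by (intro sum_mono mult_left_mono sum_sqrt_pr_diff_le) (simp_all add: \<beta>_def pr_nonneg)
  also have "\<dots> \<le> (\<Sum>l\<in>L. 8 * (prob W d l * ln (1 / prob W d l)))"
  proof (rule sum_mono)
    fix l
    show "\<beta> l * (8 * (\<alpha> l * ln (1 / \<alpha> l))) \<le> 8 * (prob W d l * ln (1 / prob W d l))"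
    proof (cases "\<alpha> l = 0 \<or> \<beta> l = 0")
      case True
      thus ?thesis by (auto simp: prob_def \<alpha>_def \<beta>_def)
    next
      case False
      hence pos: "\<alpha> l > 0" "\<beta> l > 0" "\<beta> l \<le> 1"
        using pr_nonneg[of Q W d "A l"] pr_nonneg[of Q W "Q - d" "B l"] pr_le_1[OF finite_Q]
        by (auto simp: \<alpha>_def \<beta>_def)
      hence "ln (1 / \<alpha> l) \<le> ln (1 / (\<alpha> l * \<beta> l))"
        by (simp add: ln_div ln_mult)
      hence "\<alpha> l * \<beta> l * ln (1 / \<alpha> l) \<le> \<alpha> l * \<beta> l * ln (1 / (\<alpha> l * \<beta> l))"
        using pos by (intro mult_left_mono) auto
      thus ?thesis by (simp add: prob_def \<alpha>_def \<beta>_def mult_ac)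
    qed
  qed
  also have "\<dots> = 8 * (\<Sum>l\<in>L. prob W d l * ln (1 / prob W d l))"
    by (simp add: sum_distrib_left)
  also have "\<dots> \<le> 8 * ln (card L)"
    using sum_prob[OF W d] by (intro mult_left_mono entropy_le_ln_card finite_L prob_nonneg) auto
  finally show ?thesis .
qed

lemma divergence_nonneg: "divergence W d q \<ge> 0"
  unfolding divergence_def by (intro sum_nonneg mult_nonneg_nonneg pr_nonneg) auto

text \<open>The previous bound sees only \<open>q \<in> d\<close>. As \<open>divergence\<close>
  ignores whether \<open>q \<in> d\<close>, and half of all \<open>d\<close> contain
  \<open>q\<close>, the sum over all coordinates is on average just twice as large.\<close>

lemma sum_Pow_divergence_le:
  assumes W: "covers W"
  shows "(\<Sum>d\<in>Pow Q. \<Sum>q\<in>Q - W. divergence W d q) \<le> 2 ^ card Q * (16 * ln (card L))"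
proof -
  have half: "(\<Sum>d\<in>Pow Q. divergence W d q) = 2 * (\<Sum>d\<in>Pow Q. of_bool (q \<in> d) * divergence W d q)"
    if "q \<in> Q - W" for q
  proof -
    have "Q - insert q d - {q} = Q - d - {q}" "insert q d - {q} = d - {q}" for d by auto
    hence "divergence W (insert q d) q = divergence W d q" for d
      by (simp only: divergence_def)
    thus ?thesis using that by (subst sum_Pow_mem_half[OF finite_Q]) auto
  qed
  have "(\<Sum>d\<in>Pow Q. \<Sum>q\<in>Q - W. divergence W d q)
      = (\<Sum>q\<in>Q - W. 2 * (\<Sum>d\<in>Pow Q. of_bool (q \<in> d) * divergence W d q))"
    by (subst sum.swap, intro sum.cong refl half)
  also have "\<dots> = 2 * (\<Sum>d\<in>Pow Q. \<Sum>q\<in>Q - W. of_bool (q \<in> d) * divergence W d q)"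
    unfolding sum_distrib_left[symmetric] by (subst sum.swap) simp
  also have "\<dots> = 2 * (\<Sum>d\<in>Pow Q. \<Sum>q\<in>d - W. divergence W d q)"
  proof -
    have "(\<Sum>q\<in>Q - W. of_bool (q \<in> d) * divergence W d q) = (\<Sum>q\<in>d - W. divergence W d q)"
      if "d \<in> Pow Q" for d
    proof -
      have "(\<Sum>q\<in>d - W. divergence W d q) = (\<Sum>q\<in>d - W. of_bool (q \<in> d) * divergence W d q)"
        by (intro sum.cong) auto
      also have "\<dots> = (\<Sum>q\<in>Q - W. of_bool (q \<in> d) * divergence W d q)"
        using that finite_Q by (intro sum.mono_neutral_left) auto
      finally show ?thesis by simp
    qed
    thus ?thesis by simp
  qed
  also have "\<dots> \<le> 2 * (\<Sum>d\<in>Pow Q. 8 * ln (card L))"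
    by (intro mult_left_mono sum_mono sum_divergence_le[OF W]) auto
  also have "\<dots> = 2 ^ card Q * (16 * ln (card L))"
    using finite_Q by (simp add: card_Pow)
  finally show ?thesis .
qed

lemma rectangles_swap: "rectangles Q L B A"
  using finite_Q finite_L disjoint by unfold_locales auto

lemma covers_swap: "covers W \<Longrightarrow> rectangles.covers Q L B A W"
  unfolding covers_def rectangles.covers_def[OF rectangles_swap]
  by (metis Diff_Diff_Int PowD PowI Diff_subset inf.absorb_iff2 inf_commute)

text \<open>The quantity \<open>e\<close> of \<open>cut_and_paste\<close> at coordinate
  \<open>q\<close>, with the largest of its constants; the second term is the divergence with the
  players exchanged, for whom the free coordinates are \<open>Q - d\<close>.\<close>

definition gap :: "'q set \<Rightarrow> 'q set \<Rightarrow> 'q \<Rightarrow> real" where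
  "gap W d q = 5 * sqrt (divergence W d q + rectangles.divergence Q L B A W (Q - d) q)"

lemma gap_nonneg: "gap W d q \<ge> 0"
  unfolding gap_def using divergence_nonneg rectangles.divergence_nonneg[OF rectangles_swap]
  by (simp add: add_nonneg_nonneg)

lemma sum_gap_le:
  assumes W: "covers W"
  shows "(\<Sum>d\<in>Pow Q. \<Sum>q\<in>Q - W. gap W d q) \<le> 2 ^ card Q * (30 * sqrt (card Q * ln (card L)))"
proof -
  define e where "e d q = divergence W d q + rectangles.divergence Q L B A W (Q - d) q" for d q
  have e0: "e d q \<ge> 0" for d q
    unfolding e_def using divergence_nonneg rectangles.divergence_nonneg[OF rectangles_swap]
    by (simp add: add_nonneg_nonneg)
  have "L \<noteq> {}" using W unfolding covers_def by auto
  hence lnK: "ln (card L) \<ge> 0" using finite_L by (simp add: Suc_leI card_gt_0_iff)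
  have "(\<Sum>d\<in>Pow Q. \<Sum>q\<in>Q - W. e d q) \<le> 2 ^ card Q * (16 * ln (card L)) + 2 ^ card Q * (16 * ln (card L))"
    unfolding e_def sum.distrib
    using sum_Pow_divergence_le[OF W]
      rectangles.sum_Pow_divergence_le[OF rectangles_swap covers_swap[OF W]]
    by (subst sum_Pow_complement[of "\<lambda>d. \<Sum>q\<in>Q - W. rectangles.divergence Q L B A W d q"]) (rule add_mono)
  hence E: "(\<Sum>(d, q)\<in>Pow Q \<times> (Q - W). e d q) \<le> 2 ^ card Q * (32 * ln (card L))"
    by (simp add: sum.cartesian_product algebra_simps)
  have "(\<Sum>d\<in>Pow Q. \<Sum>q\<in>Q - W. sqrt (e d q)) = (\<Sum>(d, q)\<in>Pow Q \<times> (Q - W). sqrt (e d q))"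
    by (simp add: sum.cartesian_product)
  also have "\<dots> \<le> sqrt (card (Pow Q \<times> (Q - W)) * (\<Sum>(d, q)\<in>Pow Q \<times> (Q - W). e d q))"
    using sum_sqrt_le[of "Pow Q \<times> (Q - W)" "\<lambda>(d, q). e d q"] e0
    by (simp add: case_prod_unfold)
  \<comment> \<open>The constant 32 = 16 + 16 is rounded up to the square 36; then 5 * 6 =
    30.\<close>
  also have "\<dots> \<le> sqrt ((2 ^ card Q * card Q) * (2 ^ card Q * (36 * ln (card L))))"
  proof (intro real_sqrt_le_mono mult_mono)
    show "real (card (Pow Q \<times> (Q - W))) \<le> 2 ^ card Q * card Q"
      using finite_Q by (simp add: card_cartesian_product card_Pow card_mono)
    have "2 ^ card Q * (32 * ln (card L)) \<le> 2 ^ card Q * (36 * ln (card L))"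
      using lnK by simp
    thus "(\<Sum>(d, q)\<in>Pow Q \<times> (Q - W). e d q) \<le> 2 ^ card Q * (36 * ln (card L))"
      using E by linarith
  qed (auto intro!: sum_nonneg e0)
  also have "\<dots> = sqrt ((2 ^ card Q * 6)\<^sup>2 * (card Q * ln (card L)))"
    by (simp add: power2_eq_square mult_ac)
  also have "\<dots> = 2 ^ card Q * 6 * sqrt (card Q * ln (card L))"
    unfolding real_sqrt_mult[of "(2 ^ card Q * 6)\<^sup>2"] real_sqrt_abs by simp
  finally have "5 * (\<Sum>d\<in>Pow Q. \<Sum>q\<in>Q - W. sqrt (e d q)) \<le> 5 * (2 ^ card Q * 6 * sqrt (card Q * ln (card L)))"
    by simp
  thus ?thesis unfolding gap_def e_def[symmetric] sum_distrib_left by (simp add: mult_ac)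
qed

context
  fixes W d q
  assumes W: "covers W" and d: "d \<subseteq> Q" and q: "q \<in> Q - W"
begin

text \<open>If \<open>q\<close> is free for one player, the total mass 1 is the mean of the masses
  for its two bit values. Each mass is at most 1, so both equal 1. Giving \<open>q\<close> to either
  player settles \<open>00\<close>, \<open>10\<close> and \<open>01\<close>; for \<open>11\<close>,
  which breaks the promise, only the upper bound remains.\<close>

lemma planted_marginals:
  defines "a0 \<equiv> \<lambda>l. pr Q W (d - {q}) (A l)" and "a1 \<equiv> \<lambda>l. pr Q (insert q W) (d - {q}) (A l)"
    and "b0 \<equiv> \<lambda>l. pr Q W (Q - d - {q}) (B l)" and "b1 \<equiv> \<lambda>l. pr Q (insert q W) (Q - d - {q}) (B l)"
  shows "(\<Sum>l\<in>L. a0 l * b0 l) = 1" "(\<Sum>l\<in>L. a0 l * b1 l) = 1" "(\<Sum>l\<in>L. a1 l * b0 l) = 1"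
      "(\<Sum>l\<in>L. a1 l * b1 l) \<le> 1"
proof -
  have le: "(\<Sum>l\<in>L. a0 l * b0 l) \<le> 1" "(\<Sum>l\<in>L. a0 l * b1 l) \<le> 1" "(\<Sum>l\<in>L. a1 l * b0 l) \<le> 1"
      "(\<Sum>l\<in>L. a1 l * b1 l) \<le> 1"
    unfolding a0_def a1_def b0_def b1_def by (rule sum_pr_mult_le_1)+
  have qQ: "q \<in> Q" using q by auto
  have "(\<Sum>l\<in>L. prob W (insert q d) l) = 1" using W d qQ by (intro sum_prob) auto
  moreover have "prob W (insert q d) l = (a0 l * b0 l + a1 l * b0 l) / 2" for l
  proof -
    have "insert q d - {q} = d - {q}" "Q - insert q d = Q - d - {q}" by auto
    thus ?thesis unfolding prob_def a0_def a1_def b0_def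
      by (simp add: pr_halve[OF finite_Q qQ, of "insert q d"] ring_distribs)
  qed
  ultimately have 1: "(\<Sum>l\<in>L. a0 l * b0 l) + (\<Sum>l\<in>L. a1 l * b0 l) = 2"
    by (simp add: sum.distrib sum_divide_distrib[symmetric])
  have "(\<Sum>l\<in>L. prob W (d - {q}) l) = 1" using W d qQ by (intro sum_prob) auto
  moreover have "prob W (d - {q}) l = (a0 l * b0 l + a0 l * b1 l) / 2" for l
  proof -
    have "Q - (d - {q}) - {q} = Q - d - {q}" "q \<in> Q - (d - {q})" using qQ by auto
    thus ?thesis unfolding prob_def a0_def b1_def b0_def
      by (simp add: pr_halve[OF finite_Q qQ, of "Q - (d - {q})"] ring_distribs)
  qed
  ultimately have 2: "(\<Sum>l\<in>L. a0 l * b0 l) + (\<Sum>l\<in>L. a0 l * b1 l) = 2"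
    by (simp add: sum.distrib sum_divide_distrib[symmetric])
  show "(\<Sum>l\<in>L. a0 l * b0 l) = 1" "(\<Sum>l\<in>L. a0 l * b1 l) = 1" "(\<Sum>l\<in>L. a1 l * b0 l) = 1"
      "(\<Sum>l\<in>L. a1 l * b1 l) \<le> 1"
    using 1 2 le by linarith+
qed

lemma gap_eq:
  "gap W d q = 5 * sqrt (
     (\<Sum>l\<in>L. pr Q W (Q - d - {q}) (B l) * (sqrt (pr Q W (d - {q}) (A l)) - sqrt (pr Q (insert q W) (d - {q}) (A l)))\<^sup>2) +
     (\<Sum>l\<in>L. pr Q W (d - {q}) (A l) * (sqrt (pr Q W (Q - d - {q}) (B l)) - sqrt (pr Q (insert q W) (Q - d - {q}) (B l)))\<^sup>2))"
proof -
  have "Q - (Q - d) = d" using d by auto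
  thus ?thesis by (simp only: gap_def divergence_def rectangles.divergence_def[OF rectangles_swap])
qed

lemmas planted_bounds = cut_and_paste[OF pr_nonneg pr_nonneg pr_nonneg pr_nonneg planted_marginals]

text \<open>The absolute value is on the second player's factor alone, so the first factor may later
  be restricted to an event concerning the first player's own set.\<close>

lemma sum_abs_planted_le_gap:
  "(\<Sum>l\<in>L. pr Q (insert q W) d (A l) * \<bar>pr Q W (Q - d - {q}) (B l) - pr Q (insert q W) (Q - d) (B l)\<bar>) \<le> gap W d q"
proof -
  have "(\<Sum>l\<in>L. pr Q (insert q W) d (A l) * \<bar>pr Q W (Q - d - {q}) (B l) - pr Q (insert q W) (Q - d) (B l)\<bar>)
     = (\<Sum>l\<in>L. \<bar>pr Q (insert q W) (d - {q}) (A l) * pr Q W (Q - d - {q}) (B l) -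
          pr Q (insert q W) (d - {q}) (A l) * pr Q (insert q W) (Q - d - {q}) (B l)\<bar>)"
    using pr_insert_planted[of Q q W d] pr_insert_planted[of Q q W "Q - d"]
    by (intro sum.cong) (auto simp: pr_nonneg abs_mult right_diff_distrib[symmetric])
  thus ?thesis unfolding gap_eq using planted_bounds(2) by simp
qed

text \<open>The free bit at \<open>q\<close> makes \<open>prob W d\<close> the mean of the
  distributions for \<open>00\<close> and for \<open>10\<close> or \<open>01\<close>. Their
  distances from \<open>11\<close> have constants 3 and 5, with mean 4.\<close>

lemma sum_abs_prob_diff_le_gap: "(\<Sum>l\<in>L. \<bar>prob W d l - prob (insert q W) d l\<bar>) \<le> gap W d q"
proof -
  define a0 where "a0 l = pr Q W (d - {q}) (A l)" for l
  define a1 where "a1 l = pr Q (insert q W) (d - {q}) (A l)" for l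
  define b0 where "b0 l = pr Q W (Q - d - {q}) (B l)" for l
  define b1 where "b1 l = pr Q (insert q W) (Q - d - {q}) (B l)" for l
  have qQ: "q \<in> Q" using q by auto
  have p2: "prob (insert q W) d l = a1 l * b1 l" for l
    unfolding prob_def a1_def b1_def using pr_insert_planted[of Q q W] by simp
  define g where "g = gap W d q / 5"
  have bounds: "(\<Sum>l\<in>L. \<bar>a0 l * b0 l - a1 l * b1 l\<bar>) \<le> 3 * g" "(\<Sum>l\<in>L. \<bar>a1 l * b0 l - a1 l * b1 l\<bar>) \<le> 5 * g"
     "(\<Sum>l\<in>L. \<bar>a0 l * b1 l - a1 l * b1 l\<bar>) \<le> 5 * g"
    using planted_bounds unfolding g_def gap_eq a0_def a1_def b0_def b1_def by simp_all
  have mean: "\<bar>(x + y) / 2 - z\<bar> \<le> (\<bar>x - z\<bar> + \<bar>y - z\<bar>) / 2" for x y z :: real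
    by (simp add: abs_if field_simps)
  have g0: "g \<ge> 0" using gap_nonneg by (simp add: g_def)
  show ?thesis
  proof (cases "q \<in> d")
    case True
    hence Qd: "Q - d - {q} = Q - d" by auto
    have p1: "prob W d l = (a0 l * b0 l + a1 l * b0 l) / 2" for l
      unfolding prob_def a0_def a1_def b0_def Qd
      by (simp add: pr_halve[OF finite_Q qQ True] ring_distribs)
    have "(\<Sum>l\<in>L. \<bar>prob W d l - prob (insert q W) d l\<bar>) \<le>
        (\<Sum>l\<in>L. (\<bar>a0 l * b0 l - a1 l * b1 l\<bar> + \<bar>a1 l * b0 l - a1 l * b1 l\<bar>) / 2)"
      unfolding p1 p2 by (intro sum_mono mean)
    thus ?thesis using bounds g0 by (simp add: sum.distrib sum_divide_distrib[symmetric] g_def)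
  next
    case False
    hence Qd: "d - {q} = d" "q \<in> Q - d" using qQ by auto
    have p1: "prob W d l = (a0 l * b0 l + a0 l * b1 l) / 2" for l
      unfolding prob_def a0_def b1_def b0_def Qd
      by (simp add: pr_halve[OF finite_Q qQ Qd(2)] Qd(1) ring_distribs)
    have "(\<Sum>l\<in>L. \<bar>prob W d l - prob (insert q W) d l\<bar>) \<le>
        (\<Sum>l\<in>L. (\<bar>a0 l * b0 l - a1 l * b1 l\<bar> + \<bar>a0 l * b1 l - a1 l * b1 l\<bar>) / 2)"
      unfolding p1 p2 by (intro sum_mono mean)
    thus ?thesis using bounds g0 by (simp add: sum.distrib sum_divide_distrib[symmetric] g_def)
  qed
qed

end

end

subsection \<open>Set intersection with hidden targets\<close>

lemma sum_Pow_power_card_Int: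
  fixes c :: real
  assumes Q: "finite Q" and S: "S \<subseteq> Q"
  shows "(\<Sum>r\<in>Pow Q. c ^ card (r \<inter> S)) = 2 ^ card Q * ((1 + c) / 2) ^ card S"
proof -
  define w where "w q = (if q \<in> S then c else 1)" for q
  have "c ^ card (r \<inter> S) = (\<Prod>q\<in>r. w q) * (\<Prod>q\<in>Q - r. 1)" if "r \<in> Pow Q" for r
  proof -
    have "finite r" using that Q finite_subset by auto
    hence "(\<Prod>q\<in>r. w q) = c ^ card (r \<inter> S)"
      by (simp add: w_def prod.If_cases Int_def)
    thus ?thesis by simp
  qed
  hence "(\<Sum>r\<in>Pow Q. c ^ card (r \<inter> S)) = (\<Sum>r\<in>Pow Q. (\<Prod>q\<in>r. w q) * (\<Prod>q\<in>Q - r. 1))"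
    by (intro sum.cong) auto
  also have "\<dots> = (\<Prod>q\<in>Q. w q + 1)"
    by (rule prod_add[symmetric, OF Q])
  also have "\<dots> = (\<Prod>q\<in>Q. 2 * (if q \<in> S then (1 + c) / 2 else 1))"
    by (intro prod.cong) (auto simp: w_def)
  also have "\<dots> = 2 ^ card Q * (\<Prod>q\<in>Q. if q \<in> S then (1 + c) / 2 else 1)"
    by (simp add: prod.distrib)
  also have "(\<Prod>q\<in>Q. if q \<in> S then (1 + c) / 2 else 1) = ((1 + c) / 2) ^ card S"
    using prod.inter_restrict[OF Q, of "\<lambda>_. (1 + c) / 2" S] S by (simp add: inf.absorb2)
  finally show ?thesis .
qed

text \<open>Each element of \<open>R\<close> lies in \<open>d \<inter> r\<close> with probability
  1/4, hence contributes the factor 3/4 + 1/4 * 1/2 = 7/8.\<close>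

lemma sum_Pow_Pow_power_card_Int:
  assumes "finite Q" "R \<subseteq> Q"
  shows "(\<Sum>d\<in>Pow Q. \<Sum>r\<in>Pow Q. (1 / 2 :: real) ^ card (d \<inter> r \<inter> R)) = 4 ^ card Q * (7 / 8) ^ card R"
proof -
  have "(\<Sum>d\<in>Pow Q. \<Sum>r\<in>Pow Q. (1 / 2 :: real) ^ card (d \<inter> r \<inter> R))
      = (\<Sum>d\<in>Pow Q. \<Sum>r\<in>Pow Q. (1 / 2 :: real) ^ card (r \<inter> (d \<inter> R)))"
    by (simp add: Int_ac)
  also have "\<dots> = (\<Sum>d\<in>Pow Q. 2 ^ card Q * (3 / 4) ^ card (d \<inter> R))"
    by (intro sum.cong refl, subst sum_Pow_power_card_Int) (use assms in auto)
  also have "\<dots> = 2 ^ card Q * (2 ^ card Q * (7 / 8) ^ card R)"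
    unfolding sum_distrib_left[symmetric] by (subst sum_Pow_power_card_Int) (use assms in auto)
  finally show ?thesis by (simp add: power_mult_distrib[symmetric])
qed

lemma pr_mono: "F \<subseteq> G \<Longrightarrow> pr Q W d F \<le> pr Q W d G"
  unfolding pr_def by (intro divide_right_mono sum_mono) auto

definition plant :: "'x set \<Rightarrow> ('x \<Rightarrow> 'y) \<Rightarrow> ('x \<times> 'y) set" where
  "plant X t = (\<lambda>x. (x, t x)) ` X"

lemma plant_iff: "(x, y) \<in> plant X t \<longleftrightarrow> x \<in> X \<and> y = t x"
  by (auto simp: plant_def)

lemma plant_upd:
  assumes "x \<in> X"
  shows "insert (x, t x) (plant X (t(x := y))) = insert (x, y) (plant X t)"
  using assms by (auto simp: plant_def)

text \<open>Exchanging \<open>t x\<close> with \<open>y\<close> is an involution on pairs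
  \<open>(t, y)\<close>, so it preserves the uniform distribution.\<close>

lemma sum_exchange_target:
  assumes "x \<in> X"
  shows "(\<Sum>t\<in>X \<rightarrow>\<^sub>E Y. \<Sum>y\<in>Y. f t y) = (\<Sum>t\<in>X \<rightarrow>\<^sub>E Y. \<Sum>y\<in>Y. f (t(x := y)) (t x))"
proof -
  have "(\<Sum>(t, y)\<in>(X \<rightarrow>\<^sub>E Y) \<times> Y. f t y) = (\<Sum>(t, y)\<in>(X \<rightarrow>\<^sub>E Y) \<times> Y. f (t(x := y)) (t x))"
    by (rule sum.reindex_bij_witness[of _ "\<lambda>(t, y). (t(x := y), t x)" "\<lambda>(t, y). (t(x := y), t x)"])
      (use assms in \<open>auto simp: PiE_iff extensional_def\<close>)
  thus ?thesis by (simp add: sum.cartesian_product)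
qed

text \<open>A seed \<open>(t, d, r, r')\<close> describes a pair of families of sets with intersections \<open>{t x}\<close>: the set
  \<open>d\<close> selects the player for whom a coordinate off the graph of \<open>t\<close> is a free bit, taken from \<open>r\<close>
  or \<open>r'\<close>; the other player's bit is \<open>0\<close>.\<close>

definition seeds :: "'x set \<Rightarrow> 'y set \<Rightarrow> (('x \<Rightarrow> 'y) \<times> ('x \<times> 'y) set \<times> ('x \<times> 'y) set \<times> ('x \<times> 'y) set) set" where
  "seeds X Y = (X \<rightarrow>\<^sub>E Y) \<times> Pow (X \<times> Y) \<times> Pow (X \<times> Y) \<times> Pow (X \<times> Y)"

definition left_sets :: "'x set \<Rightarrow> (('x \<Rightarrow> 'y) \<times> ('x \<times> 'y) set \<times> ('x \<times> 'y) set \<times> ('x \<times> 'y) set) \<Rightarrow> ('x \<times> 'y) set" where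
  "left_sets X = (\<lambda>(t, d, r, r'). plant X t \<union> d \<inter> r)"

definition right_sets :: "'x set \<Rightarrow> 'y set \<Rightarrow> (('x \<Rightarrow> 'y) \<times> ('x \<times> 'y) set \<times> ('x \<times> 'y) set \<times> ('x \<times> 'y) set) \<Rightarrow> ('x \<times> 'y) set" where
  "right_sets X Y = (\<lambda>(t, d, r, r'). plant X t \<union> (X \<times> Y - d) \<inter> r')"

text \<open>Markov's inequality for \<open>2\<close> to the power \<open>- m\<close>, where
  \<open>m\<close> counts the elements of one player's row other than the target: each of the
  \<open>n - 1\<close> candidates contributes 7/8, and \<open>m < n / 8\<close> is the bad
  event.\<close>

definition tail_bound :: "nat \<Rightarrow> real" where
  "tail_bound n = 2 powr (n / 8) * (7 / 8) ^ (n - 1)"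

text \<open>Two players and their transcript \<open>\<tau>\<close>. The value \<open>zs t\<close> is
  side information about the targets, later the earlier pointers; it may depend on the rows in
  \<open>vis t\<close> but is unchanged when a target elsewhere is altered. Transcripts are required
  to lie in \<open>L\<close> only for inputs that keep the promise.\<close>

locale intersection_game =
  fixes X :: "'x set" and Y :: "'y set"
    and \<tau> :: "('x \<times> 'y) set \<Rightarrow> ('x \<times> 'y) set \<Rightarrow> 'l" and L :: "'l set"
    and zs :: "('x \<Rightarrow> 'y) \<Rightarrow> 'z" and vis :: "('x \<Rightarrow> 'y) \<Rightarrow> 'x set" and J :: nat
  assumes finite_X: "finite X" and finite_Y: "finite Y" and Y_nonempty: "Y \<noteq> {}" and finite_L': "finite L"
    and rect: "\<And>a b a' b' l. \<tau> a b = l \<Longrightarrow> \<tau> a' b' = l \<Longrightarrow> \<tau> a b' = l"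
    and transcript_in_L: "\<And>u. u \<in> seeds X Y \<Longrightarrow> \<tau> (left_sets X u) (right_sets X Y u) \<in> L"
    and zs_upd: "\<And>t x y. t \<in> X \<rightarrow>\<^sub>E Y \<Longrightarrow> x \<in> X - vis t \<Longrightarrow> y \<in> Y \<Longrightarrow> zs (t(x := y)) = zs t"
    and card_vis: "\<And>t. t \<in> X \<rightarrow>\<^sub>E Y \<Longrightarrow> card (X \<inter> vis t) \<le> J"
begin

abbreviation "Q \<equiv> X \<times> Y"
abbreviation "T \<equiv> X \<rightarrow>\<^sub>E Y"
definition "A l = {a. \<exists>b. \<tau> a b = l}"
definition "B l = {b. \<exists>a. \<tau> a b = l}"

lemma mem_AB_iff: "a \<in> A l \<and> b \<in> B l \<longleftrightarrow> \<tau> a b = l"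
  unfolding A_def B_def using rect by blast

sublocale rectangles Q L A B
proof unfold_locales
  show "finite Q" using finite_X finite_Y by simp
  show "finite L" by (rule finite_L')
  show "l = l'" if "a \<in> A l" "a \<in> A l'" "b \<in> B l" "b \<in> B l'" for l l' a b
    using that mem_AB_iff[of a l b] mem_AB_iff[of a l' b] by simp
qed

lemma covers_plant:
  assumes "t \<in> T"
  shows "covers (plant X t)"
  unfolding covers_def
proof (intro ballI)
  fix d r r' assume "d \<in> Pow Q" "r \<in> Pow Q" "r' \<in> Pow Q"
  hence "(t, d, r, r') \<in> seeds X Y" using assms by (simp add: seeds_def)
  from transcript_in_L[OF this]
  show "\<exists>l\<in>L. plant X t \<union> d \<inter> r \<in> A l \<and> plant X t \<union> (Q - d) \<inter> r' \<in> B l"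
    unfolding mem_AB_iff by (simp add: left_sets_def right_sets_def)
qed

lemma card_seeds: "real (card (seeds X Y)) = card T * (2 ^ card Q * 4 ^ card Q)"
  using finite_Q finite_X finite_Y
  by (simp add: seeds_def card_cartesian_product card_Pow power_mult_distrib[symmetric])

lemma sum_seeds:
  "(\<Sum>u\<in>seeds X Y. f u) = (\<Sum>t\<in>T. \<Sum>d\<in>Pow Q. \<Sum>r\<in>Pow Q. \<Sum>r'\<in>Pow Q. f (t, d, r, r'))"
  unfolding seeds_def by (simp add: sum.cartesian_product case_prod_unfold)

definition plant_gap :: "('x \<Rightarrow> 'y) \<Rightarrow> ('x \<times> 'y) set \<Rightarrow> 'x \<Rightarrow> 'y \<Rightarrow> real" where
  "plant_gap t d x y = (if y = t x then 0 else gap (plant X t) d (x, y))"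

lemma plant_gap_nonneg: "plant_gap t d x y \<ge> 0"
  by (simp add: plant_gap_def gap_nonneg)

lemma sum_plant_gap_le:
  "(\<Sum>t\<in>T. \<Sum>d\<in>Pow Q. \<Sum>x\<in>X. \<Sum>y\<in>Y. plant_gap t d x y)
     \<le> card T * (2 ^ card Q * (30 * sqrt (card Q * ln (card L))))"
proof -
  have "(\<Sum>x\<in>X. \<Sum>y\<in>Y. plant_gap t d x y) = (\<Sum>q\<in>Q - plant X t. gap (plant X t) d q)" for t d
  proof -
    have "(\<Sum>x\<in>X. \<Sum>y\<in>Y. plant_gap t d x y) = (\<Sum>q\<in>Q. plant_gap t d (fst q) (snd q))"
      by (simp add: sum.cartesian_product case_prod_unfold)
    also have "\<dots> = (\<Sum>q\<in>Q - plant X t. plant_gap t d (fst q) (snd q))"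
      using finite_Q by (intro sum.mono_neutral_right) (auto simp: plant_gap_def plant_iff)
    also have "\<dots> = (\<Sum>q\<in>Q - plant X t. gap (plant X t) d q)"
      by (intro sum.cong) (auto simp: plant_gap_def plant_iff)
    finally show ?thesis .
  qed
  hence "(\<Sum>t\<in>T. \<Sum>d\<in>Pow Q. \<Sum>x\<in>X. \<Sum>y\<in>Y. plant_gap t d x y)
      \<le> (\<Sum>t\<in>T. 2 ^ card Q * (30 * sqrt (card Q * ln (card L))))"
    by (simp only:) (intro sum_mono sum_gap_le covers_plant)
  thus ?thesis by simp
qed

lemma sum_vis_le: "t \<in> T \<Longrightarrow> (\<Sum>x\<in>X. of_bool (x \<in> vis t) :: real) \<le> J"
  using card_vis[of t] finite_X by (simp add: sum_of_bool_eq)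

text \<open>For fixed \<open>t\<close> and \<open>d\<close> the bits \<open>r\<close> and
  \<open>r'\<close> are independent, and a transcript \<open>l\<close> means membership in
  \<open>A l\<close> and \<open>B l\<close> separately. The weight \<open>g\<close> may look at the
  left set without disturbing this product.\<close>

lemma sum_transcript:
  "(\<Sum>r\<in>Pow Q. \<Sum>r'\<in>Pow Q. g (plant X t \<union> d \<inter> r) (\<tau> (plant X t \<union> d \<inter> r) (plant X t \<union> (Q - d) \<inter> r')))
     = (\<Sum>l\<in>L. (\<Sum>r\<in>Pow Q. of_bool (plant X t \<union> d \<inter> r \<in> A l) * g (plant X t \<union> d \<inter> r) l)
          * (\<Sum>r'\<in>Pow Q. of_bool (plant X t \<union> (Q - d) \<inter> r' \<in> B l)) :: real)"
  if t: "t \<in> T" and d: "d \<in> Pow Q"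
proof -
  define a where "a r = plant X t \<union> d \<inter> r" for r
  define b where "b r' = plant X t \<union> (Q - d) \<inter> r'" for r'
  have "(\<Sum>r\<in>Pow Q. \<Sum>r'\<in>Pow Q. g (a r) (\<tau> (a r) (b r'))) =
    (\<Sum>r\<in>Pow Q. \<Sum>r'\<in>Pow Q. \<Sum>l\<in>L. of_bool (a r \<in> A l \<and> b r' \<in> B l) * g (a r) l)"
  proof (intro sum.cong refl)
    fix r r' assume "r \<in> Pow Q" "r' \<in> Pow Q"
    hence "(t, d, r, r') \<in> seeds X Y" using t d by (simp add: seeds_def)
    from transcript_in_L[OF this] have L: "\<tau> (a r) (b r') \<in> L"
      by (simp add: a_def b_def left_sets_def right_sets_def)
    show "g (a r) (\<tau> (a r) (b r')) = (\<Sum>l\<in>L. of_bool (a r \<in> A l \<and> b r' \<in> B l) * g (a r) l)"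
      by (rule sum_of_bool_eq_1[OF L, symmetric]) (use mem_AB_iff in blast)+
  qed
  also have "\<dots> = (\<Sum>r\<in>Pow Q. \<Sum>l\<in>L. \<Sum>r'\<in>Pow Q. of_bool (a r \<in> A l \<and> b r' \<in> B l) * g (a r) l)"
    by (intro sum.cong refl sum.swap)
  also have "\<dots> = (\<Sum>l\<in>L. \<Sum>r\<in>Pow Q. \<Sum>r'\<in>Pow Q. of_bool (a r \<in> A l \<and> b r' \<in> B l) * g (a r) l)"
    by (rule sum.swap)
  also have "\<dots> = (\<Sum>l\<in>L. (\<Sum>r\<in>Pow Q. of_bool (a r \<in> A l) * g (a r) l) * (\<Sum>r'\<in>Pow Q. of_bool (b r' \<in> B l)))"
    unfolding sum_product by (intro sum.cong refl) (simp add: of_bool_conj)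
  finally show ?thesis by (simp add: a_def b_def)
qed

lemma sum_transcript_prob:
  assumes "t \<in> T" "d \<in> Pow Q"
  shows "(\<Sum>r\<in>Pow Q. \<Sum>r'\<in>Pow Q. g (\<tau> (plant X t \<union> d \<inter> r) (plant X t \<union> (Q - d) \<inter> r')))
     = 4 ^ card Q * (\<Sum>l\<in>L. prob (plant X t) d l * g l)"
proof -
  have "(4 :: real) ^ card Q = 2 ^ card Q * 2 ^ card Q" by (simp add: power_mult_distrib[symmetric])
  thus ?thesis
    unfolding sum_transcript[OF assms, of "\<lambda>_. g"] sum_distrib_left[of "4 ^ card Q"]
    by (intro sum.cong refl) (simp only: prob_def pr_def sum_distrib_right[symmetric], simp)
qed

text \<open>The doubly planted set \<open>plant t \<union> {(x, y)}\<close> does not tell which of \<open>t x\<close> and \<open>y\<close> is the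
  target. For \<open>x\<close> outside \<open>vis t\<close> neither does \<open>zs t\<close>.\<close>

lemma sum_exchange_le:
  fixes f :: "('x \<times> 'y) set \<Rightarrow> 'z \<Rightarrow> 'y \<Rightarrow> real"
  assumes x: "x \<in> X" and f: "\<And>W z y. 0 \<le> f W z y \<and> f W z y \<le> 1"
  shows "(\<Sum>t\<in>T. \<Sum>y\<in>Y. of_bool (y \<noteq> t x) * f (insert (x, y) (plant X t)) (zs t) (t x)) \<le>
    (\<Sum>t\<in>T. \<Sum>y\<in>Y. of_bool (y \<noteq> t x) * f (insert (x, y) (plant X t)) (zs t) y + of_bool (x \<in> vis t))"
proof -
  have "(\<Sum>t\<in>T. \<Sum>y\<in>Y. of_bool (y \<noteq> t x) * f (insert (x, y) (plant X t)) (zs t) (t x)) =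
    (\<Sum>t\<in>T. \<Sum>y\<in>Y. of_bool (t x \<noteq> (t(x := y)) x) * f (insert (x, t x) (plant X (t(x := y)))) (zs (t(x := y))) ((t(x := y)) x))"
    by (rule sum_exchange_target[OF x])
  also have "\<dots> = (\<Sum>t\<in>T. \<Sum>y\<in>Y. of_bool (y \<noteq> t x) * f (insert (x, y) (plant X t)) (zs (t(x := y))) y)"
    unfolding plant_upd[OF x] by (intro sum.cong refl) auto
  also have "\<dots> \<le> (\<Sum>t\<in>T. \<Sum>y\<in>Y. of_bool (y \<noteq> t x) * f (insert (x, y) (plant X t)) (zs t) y + of_bool (x \<in> vis t))"
  proof (intro sum_mono)
    fix t y assume t: "t \<in> T" and y: "y \<in> Y"
    show "of_bool (y \<noteq> t x) * f (insert (x, y) (plant X t)) (zs (t(x := y))) y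
       \<le> of_bool (y \<noteq> t x) * f (insert (x, y) (plant X t)) (zs t) y + of_bool (x \<in> vis t)"
    proof (cases "x \<in> vis t")
      case True
      thus ?thesis using f by (auto intro: add_increasing)
    next
      case False
      thus ?thesis using zs_upd[OF t _ y, of x] x by simp
    qed
  qed
  finally show ?thesis .
qed

text \<open>Planting \<open>(x, y)\<close> changes the expectation of a test by at most
  \<open>plant_gap\<close>, once for the value at \<open>t x\<close> and once for the value at
  \<open>y\<close>; after planting, the two are exchangeable. This gives 60 = 2 * 30. A visited row
  costs at most 1, in total \<open>J\<close>. The bound is a sum over all rows, so one uniformly
  random row has this error divided by \<open>card X\<close>.\<close>

theorem target_close_to_uniform:
  fixes \<phi> :: "'x \<Rightarrow> 'l \<Rightarrow> 'z \<Rightarrow> 'y \<Rightarrow> real"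
  assumes \<phi>: "\<And>x l z y. 0 \<le> \<phi> x l z y \<and> \<phi> x l z y \<le> 1"
  shows "(\<Sum>u\<in>seeds X Y. \<Sum>x\<in>X. \<phi> x (\<tau> (left_sets X u) (right_sets X Y u)) (zs (fst u)) (fst u x)
            - (\<Sum>y\<in>Y. \<phi> x (\<tau> (left_sets X u) (right_sets X Y u)) (zs (fst u)) y) / card Y)
         \<le> card (seeds X Y) * (J + 60 * sqrt (card Q * ln (card L)) / card Y)"
proof -
  let ?n = "real (card Y)"
  have n0: "?n > 0" using finite_Y Y_nonempty by (simp add: card_gt_0_iff)
  \<comment> \<open>The expected value of the test; \<open>W\<close> is arbitrary because the doubly
    planted set is inserted below, where the total mass may be less than 1.\<close>
  define e where "e x d W z y = (\<Sum>l\<in>L. prob W d l * \<phi> x l z y)" for x d W z y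
  have e01: "0 \<le> e x d W z y \<and> e x d W z y \<le> 1" for x d W z y
  proof
    show "0 \<le> e x d W z y" unfolding e_def using \<phi> prob_nonneg by (intro sum_nonneg) auto
    have "e x d W z y \<le> (\<Sum>l\<in>L. prob W d l)"
      unfolding e_def using \<phi> prob_nonneg by (intro sum_mono) (auto intro: mult_left_le)
    also have "\<dots> \<le> 1" unfolding prob_def by (rule sum_pr_mult_le_1)
    finally show "e x d W z y \<le> 1" .
  qed
  have close: "\<bar>e x d (plant X t) z y' - e x d (insert (x, y) (plant X t)) z y'\<bar> \<le> plant_gap t d x y"
    if "t \<in> T" "d \<in> Pow Q" "x \<in> X" "y \<in> Y" for t d x y y' z
  proof (cases "y = t x")
    case True
    hence "insert (x, y) (plant X t) = plant X t" using that by (auto simp: plant_def)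
    thus ?thesis by (simp add: plant_gap_nonneg)
  next
    case False
    have "\<bar>e x d (plant X t) z y' - e x d (insert (x, y) (plant X t)) z y'\<bar>
        = \<bar>\<Sum>l\<in>L. (prob (plant X t) d l - prob (insert (x, y) (plant X t)) d l) * \<phi> x l z y'\<bar>"
      by (simp add: e_def sum_subtractf left_diff_distrib)
    also have "\<dots> \<le> (\<Sum>l\<in>L. \<bar>prob (plant X t) d l - prob (insert (x, y) (plant X t)) d l\<bar>)"
    proof (rule order.trans[OF sum_abs sum_mono])
      fix l
      show "\<bar>(prob (plant X t) d l - prob (insert (x, y) (plant X t)) d l) * \<phi> x l z y'\<bar>
         \<le> \<bar>prob (plant X t) d l - prob (insert (x, y) (plant X t)) d l\<bar>"
        using \<phi>[of x l z y'] by (simp add: abs_mult mult_left_le)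
    qed
    also have "\<dots> \<le> gap (plant X t) d (x, y)"
      using that False by (intro sum_abs_prob_diff_le_gap covers_plant) (auto simp: plant_iff)
    finally show ?thesis using False by (simp add: plant_gap_def)
  qed
  have row: "(\<Sum>t\<in>T. \<Sum>y\<in>Y. e x d (plant X t) (zs t) (t x) - e x d (plant X t) (zs t) y)
       \<le> (\<Sum>t\<in>T. \<Sum>y\<in>Y. 2 * plant_gap t d x y + of_bool (x \<in> vis t))"
    if d: "d \<in> Pow Q" and x: "x \<in> X" for d x
  proof -
    have "e x d (plant X t) (zs t) (t x) - e x d (plant X t) (zs t) y
        \<le> of_bool (y \<noteq> t x) * e x d (insert (x, y) (plant X t)) (zs t) (t x)
          - of_bool (y \<noteq> t x) * e x d (insert (x, y) (plant X t)) (zs t) y + 2 * plant_gap t d x y"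
      if "t \<in> T" "y \<in> Y" for t y
      using close[OF that(1) d x that(2), of "zs t" y] close[OF that(1) d x that(2), of "zs t" "t x"]
        plant_gap_nonneg[of t d x y]
      by (cases "y = t x") (simp_all add: abs_le_iff)
    hence "(\<Sum>t\<in>T. \<Sum>y\<in>Y. e x d (plant X t) (zs t) (t x) - e x d (plant X t) (zs t) y)
        \<le> (\<Sum>t\<in>T. \<Sum>y\<in>Y. of_bool (y \<noteq> t x) * e x d (insert (x, y) (plant X t)) (zs t) (t x)
          - of_bool (y \<noteq> t x) * e x d (insert (x, y) (plant X t)) (zs t) y + 2 * plant_gap t d x y)"
      by (intro sum_mono)
    also have "\<dots> \<le> (\<Sum>t\<in>T. \<Sum>y\<in>Y. 2 * plant_gap t d x y + of_bool (x \<in> vis t))"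
      using sum_exchange_le[where f = "e x d", OF x e01] by (simp add: sum.distrib sum_subtractf)
    finally show ?thesis .
  qed
  have "(\<Sum>u\<in>seeds X Y. \<Sum>x\<in>X. \<phi> x (\<tau> (left_sets X u) (right_sets X Y u)) (zs (fst u)) (fst u x)
            - (\<Sum>y\<in>Y. \<phi> x (\<tau> (left_sets X u) (right_sets X Y u)) (zs (fst u)) y) / ?n)
      = (\<Sum>t\<in>T. \<Sum>d\<in>Pow Q. 4 ^ card Q * (\<Sum>x\<in>X. e x d (plant X t) (zs t) (t x) - (\<Sum>y\<in>Y. e x d (plant X t) (zs t) y) / ?n))"
    unfolding sum_seeds
  proof (intro sum.cong refl)
    fix t d assume t: "t \<in> T" and d: "d \<in> Pow Q"
    have "(\<Sum>r\<in>Pow Q. \<Sum>r'\<in>Pow Q. \<Sum>x\<in>X. \<phi> x (\<tau> (left_sets X (t, d, r, r')) (right_sets X Y (t, d, r, r'))) (zs (fst (t, d, r, r'))) (fst (t, d, r, r') x)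
            - (\<Sum>y\<in>Y. \<phi> x (\<tau> (left_sets X (t, d, r, r')) (right_sets X Y (t, d, r, r'))) (zs (fst (t, d, r, r'))) y) / ?n)
      = (\<Sum>r\<in>Pow Q. \<Sum>r'\<in>Pow Q. (\<lambda>l. \<Sum>x\<in>X. \<phi> x l (zs t) (t x) - (\<Sum>y\<in>Y. \<phi> x l (zs t) y) / ?n)
           (\<tau> (plant X t \<union> d \<inter> r) (plant X t \<union> (Q - d) \<inter> r')))"
      by (simp add: left_sets_def right_sets_def)
    also have "\<dots> = 4 ^ card Q * (\<Sum>l\<in>L. prob (plant X t) d l * (\<Sum>x\<in>X. \<phi> x l (zs t) (t x) - (\<Sum>y\<in>Y. \<phi> x l (zs t) y) / ?n))"
      by (rule sum_transcript_prob[OF t d])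
    also have "(\<Sum>l\<in>L. prob (plant X t) d l * (\<Sum>x\<in>X. \<phi> x l (zs t) (t x) - (\<Sum>y\<in>Y. \<phi> x l (zs t) y) / ?n)) =
      (\<Sum>x\<in>X. \<Sum>l\<in>L. prob (plant X t) d l * (\<phi> x l (zs t) (t x) - (\<Sum>y\<in>Y. \<phi> x l (zs t) y) / ?n))"
      unfolding sum_distrib_left by (rule sum.swap)
    also have "\<dots> = (\<Sum>x\<in>X. e x d (plant X t) (zs t) (t x) - (\<Sum>y\<in>Y. e x d (plant X t) (zs t) y) / ?n)"
    proof (intro sum.cong refl)
      fix x
      have E: "(\<Sum>y\<in>Y. e x d (plant X t) (zs t) y) = (\<Sum>l\<in>L. prob (plant X t) d l * (\<Sum>y\<in>Y. \<phi> x l (zs t) y))"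
        unfolding e_def sum_distrib_left by (rule sum.swap)
      show "(\<Sum>l\<in>L. prob (plant X t) d l * (\<phi> x l (zs t) (t x) - (\<Sum>y\<in>Y. \<phi> x l (zs t) y) / ?n))
        = e x d (plant X t) (zs t) (t x) - (\<Sum>y\<in>Y. e x d (plant X t) (zs t) y) / ?n"
        unfolding E unfolding e_def
        by (simp only: right_diff_distrib sum_subtractf times_divide_eq_right sum_divide_distrib[of _ L])
    qed
    finally show "(\<Sum>r\<in>Pow Q. \<Sum>r'\<in>Pow Q. \<Sum>x\<in>X. \<phi> x (\<tau> (left_sets X (t, d, r, r')) (right_sets X Y (t, d, r, r'))) (zs (fst (t, d, r, r'))) (fst (t, d, r, r') x)
            - (\<Sum>y\<in>Y. \<phi> x (\<tau> (left_sets X (t, d, r, r')) (right_sets X Y (t, d, r, r'))) (zs (fst (t, d, r, r'))) y) / ?n)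
      = 4 ^ card Q * (\<Sum>x\<in>X. e x d (plant X t) (zs t) (t x) - (\<Sum>y\<in>Y. e x d (plant X t) (zs t) y) / ?n)" .
  qed
  also have "\<dots> = 4 ^ card Q / ?n * (\<Sum>t\<in>T. \<Sum>d\<in>Pow Q. \<Sum>x\<in>X. \<Sum>y\<in>Y. e x d (plant X t) (zs t) (t x) - e x d (plant X t) (zs t) y)"
  proof -
    have "(\<Sum>x\<in>X. e x d (plant X t) (zs t) (t x) - (\<Sum>y\<in>Y. e x d (plant X t) (zs t) y) / ?n)
      = (\<Sum>x\<in>X. \<Sum>y\<in>Y. e x d (plant X t) (zs t) (t x) - e x d (plant X t) (zs t) y) / ?n" for t d
      unfolding sum_divide_distrib[of _ X] using n0
      by (intro sum.cong refl) (simp add: sum_subtractf diff_divide_distrib)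
    thus ?thesis
      by (simp only: sum_distrib_left[symmetric] times_divide_eq_right times_divide_eq_left sum_divide_distrib[symmetric])
  qed
  also have "(\<Sum>t\<in>T. \<Sum>d\<in>Pow Q. \<Sum>x\<in>X. \<Sum>y\<in>Y. e x d (plant X t) (zs t) (t x) - e x d (plant X t) (zs t) y)
     = (\<Sum>d\<in>Pow Q. \<Sum>x\<in>X. \<Sum>t\<in>T. \<Sum>y\<in>Y. e x d (plant X t) (zs t) (t x) - e x d (plant X t) (zs t) y)"
    by (subst sum.swap) (intro sum.cong refl sum.swap)
  also have "\<dots> \<le> (\<Sum>d\<in>Pow Q. \<Sum>x\<in>X. \<Sum>t\<in>T. \<Sum>y\<in>Y. 2 * plant_gap t d x y + of_bool (x \<in> vis t))"
    by (intro sum_mono row)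
  also have "\<dots> = (\<Sum>t\<in>T. \<Sum>d\<in>Pow Q. \<Sum>x\<in>X. \<Sum>y\<in>Y. 2 * plant_gap t d x y + of_bool (x \<in> vis t))"
    by (subst (2) sum.swap) (intro sum.cong refl sum.swap)
  also have "\<dots> = 2 * (\<Sum>t\<in>T. \<Sum>d\<in>Pow Q. \<Sum>x\<in>X. \<Sum>y\<in>Y. plant_gap t d x y)
      + (\<Sum>t\<in>T. 2 ^ card Q * (?n * (\<Sum>x\<in>X. of_bool (x \<in> vis t))))"
    using finite_Q by (simp add: sum.distrib sum_distrib_left card_Pow)
  also have "\<dots> \<le> 2 * (card T * (2 ^ card Q * (30 * sqrt (card Q * ln (card L))))) + (\<Sum>t\<in>T. 2 ^ card Q * (?n * J))"
    using sum_plant_gap_le by (intro add_mono mult_left_mono sum_mono sum_vis_le) auto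
  finally have "(\<Sum>u\<in>seeds X Y. \<Sum>x\<in>X. \<phi> x (\<tau> (left_sets X u) (right_sets X Y u)) (zs (fst u)) (fst u x)
            - (\<Sum>y\<in>Y. \<phi> x (\<tau> (left_sets X u) (right_sets X Y u)) (zs (fst u)) y) / ?n)
     \<le> 4 ^ card Q / ?n * (2 * (card T * (2 ^ card Q * (30 * sqrt (card Q * ln (card L))))) + card T * (2 ^ card Q * (?n * J)))"
    by (simp add: mult_left_mono divide_right_mono)
  also have "\<dots> = card (seeds X Y) * (J + 60 * sqrt (card Q * ln (card L)) / ?n)"
    unfolding card_seeds using n0 by (simp add: field_simps)
  finally show ?thesis .
qed

text \<open>Call an element \<open>y' \<noteq> t x\<close> of the left row \<open>x\<close> a decoy.
  Planting a decoy in the right set too is hardly noticed and does not change the left set, and then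
  decoy and target are exchangeable. So the target is guessed about as often as any one decoy, while
  a guess names at most one element. Since rows have at least \<open>n / 8\<close> decoys outside an
  event of probability \<open>tail_bound\<close>, correct guesses have frequency about
  \<open>8 / n\<close>.\<close>

theorem left_guess_le:
  fixes \<gamma> :: "'x \<Rightarrow> 'l \<Rightarrow> 'z \<Rightarrow> ('x \<times> 'y) set \<Rightarrow> 'y"
  shows "(\<Sum>u\<in>seeds X Y. \<Sum>x\<in>X. of_bool (\<gamma> x (\<tau> (left_sets X u) (right_sets X Y u)) (zs (fst u)) (left_sets X u) = fst u x))
         \<le> card (seeds X Y) * (card X * (tail_bound (card Y) + 8 / card Y)
              + 120 * sqrt (card Q * ln (card L)) / card Y + 2 * J)"
proof -
  let ?n = "real (card Y)" and ?N = "card Q"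
  have n0: "?n > 0" using finite_Y Y_nonempty by (simp add: card_gt_0_iff)
  define F where "F x l z y = {a. \<gamma> x l z a = y}" for x l z y
  \<comment> \<open>In \<open>single\<close> only the left player holds \<open>y'\<close>; in
    \<open>double\<close>, with \<open>(x, y')\<close> inserted into \<open>W\<close>, both do. Both
    measure how often the guess is \<open>y\<close>.\<close>
  define single where "single x d W y' z y =
    (\<Sum>l\<in>L. pr Q (insert (x, y') W) d (A l \<inter> F x l z y) * pr Q W (Q - d - {(x, y')}) (B l))" for x d W y' z y
  define double where "double x d W z y = (\<Sum>l\<in>L. pr Q W d (A l \<inter> F x l z y) * pr Q W (Q - d) (B l))" for x d W z y
  have double01: "0 \<le> double x d W z y \<and> double x d W z y \<le> 1" for x d W z y
  proof
    show "0 \<le> double x d W z y" unfolding double_def by (intro sum_nonneg mult_nonneg_nonneg pr_nonneg)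
    have "double x d W z y \<le> (\<Sum>l\<in>L. pr Q W d (A l) * pr Q W (Q - d) (B l))"
      unfolding double_def by (intro sum_mono mult_right_mono pr_mono pr_nonneg) auto
    also have "\<dots> \<le> 1" by (rule sum_pr_mult_le_1)
    finally show "double x d W z y \<le> 1" .
  qed
  have close: "\<bar>single x d (plant X t) y' z y - double x d (insert (x, y') (plant X t)) z y\<bar> \<le> plant_gap t d x y'"
    if "t \<in> T" "d \<in> Pow Q" "x \<in> X" "y' \<in> Y" "y' \<noteq> t x" for t d x y y' z
  proof -
    let ?W = "plant X t" and ?q = "(x, y')"
    have "\<bar>single x d ?W y' z y - double x d (insert ?q ?W) z y\<bar>
        = \<bar>\<Sum>l\<in>L. pr Q (insert ?q ?W) d (A l \<inter> F x l z y) * (pr Q ?W (Q - d - {?q}) (B l) - pr Q (insert ?q ?W) (Q - d) (B l))\<bar>"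
      by (simp add: single_def double_def sum_subtractf right_diff_distrib)
    also have "\<dots> \<le> (\<Sum>l\<in>L. pr Q (insert ?q ?W) d (A l) * \<bar>pr Q ?W (Q - d - {?q}) (B l) - pr Q (insert ?q ?W) (Q - d) (B l)\<bar>)"
      by (rule order.trans[OF sum_abs sum_mono])
        (simp add: abs_mult pr_nonneg mult_right_mono pr_mono)
    also have "\<dots> \<le> gap ?W d ?q"
      using that by (intro sum_abs_planted_le_gap covers_plant) (auto simp: plant_iff)
    finally show ?thesis using that by (simp add: plant_gap_def)
  qed
  have row: "(\<Sum>t\<in>T. \<Sum>y\<in>Y. of_bool (y \<noteq> t x) * single x d (plant X t) y (zs t) (t x))
     \<le> (\<Sum>t\<in>T. \<Sum>y\<in>Y. of_bool (y \<noteq> t x) * single x d (plant X t) y (zs t) y + 2 * plant_gap t d x y + of_bool (x \<in> vis t))"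
    if d: "d \<in> Pow Q" and x: "x \<in> X" for d x
  proof -
    have "(\<Sum>t\<in>T. \<Sum>y\<in>Y. of_bool (y \<noteq> t x) * single x d (plant X t) y (zs t) (t x))
      \<le> (\<Sum>t\<in>T. \<Sum>y\<in>Y. of_bool (y \<noteq> t x) * double x d (insert (x, y) (plant X t)) (zs t) (t x) + plant_gap t d x y)"
    proof (intro sum_mono)
      fix t y assume "t \<in> T" "y \<in> Y"
      from close[OF this(1) d x this(2), of "zs t" "t x"]
      show "of_bool (y \<noteq> t x) * single x d (plant X t) y (zs t) (t x)
         \<le> of_bool (y \<noteq> t x) * double x d (insert (x, y) (plant X t)) (zs t) (t x) + plant_gap t d x y"
        using plant_gap_nonneg[of t d x y] by (cases "y = t x") (simp_all add: abs_le_iff)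
    qed
    also have "\<dots> \<le> (\<Sum>t\<in>T. \<Sum>y\<in>Y. of_bool (y \<noteq> t x) * double x d (insert (x, y) (plant X t)) (zs t) y
        + of_bool (x \<in> vis t) + plant_gap t d x y)"
      using sum_exchange_le[where f = "double x d", OF x double01] by (simp add: sum.distrib)
    also have "\<dots> \<le> (\<Sum>t\<in>T. \<Sum>y\<in>Y. of_bool (y \<noteq> t x) * single x d (plant X t) y (zs t) y + 2 * plant_gap t d x y + of_bool (x \<in> vis t))"
    proof (intro sum_mono)
      fix t y assume "t \<in> T" "y \<in> Y"
      from close[OF this(1) d x this(2), of "zs t" y]
      show "of_bool (y \<noteq> t x) * double x d (insert (x, y) (plant X t)) (zs t) y + of_bool (x \<in> vis t) + plant_gap t d x y
         \<le> of_bool (y \<noteq> t x) * single x d (plant X t) y (zs t) y + 2 * plant_gap t d x y + of_bool (x \<in> vis t)"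
        using plant_gap_nonneg[of t d x y] by (cases "y = t x") (simp_all add: abs_le_iff)
    qed
    finally show ?thesis .
  qed
  define a where "a t d r = plant X t \<union> d \<inter> r" for t :: "'x \<Rightarrow> 'y" and d r
  define b where "b t d r' = plant X t \<union> (Q - d) \<inter> r'" for t :: "'x \<Rightarrow> 'y" and d r'
  define hit where "hit t d x y' y = (\<Sum>r\<in>Pow Q. \<Sum>r'\<in>Pow Q.
      of_bool ((x, y') \<in> a t d r) * of_bool (\<gamma> x (\<tau> (a t d r) (b t d r')) (zs t) (a t d r) = y) :: real)" for t d x y' y
  \<comment> \<open>The element \<open>y'\<close> is a decoy exactly if its coordinate lies in both
    \<open>d\<close> and \<open>r\<close>, each for half of the choices, hence the quarter.\<close>
  have hit_single: "(\<Sum>d\<in>Pow Q. hit t d x y' y) = 4 ^ ?N / 4 * (\<Sum>d\<in>Pow Q. single x d (plant X t) y' (zs t) y)"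
    if t: "t \<in> T" and x: "x \<in> X" and y': "y' \<in> Y" "y' \<noteq> t x" for t x y' y
  proof -
    let ?q = "(x, y')" and ?W = "plant X t"
    have q: "?q \<in> Q" "?q \<notin> ?W" using x y' by (auto simp: plant_iff)
    have "hit t d x y' y = of_bool (?q \<in> d) * (4 ^ ?N / 2 * single x d ?W y' (zs t) y)" if d: "d \<in> Pow Q" for d
    proof -
      have sumr: "(\<Sum>r\<in>Pow Q. of_bool (a t d r \<in> A l) * (of_bool (?q \<in> a t d r) * of_bool (\<gamma> x l (zs t) (a t d r) = y)))
          = of_bool (?q \<in> d) * (2 ^ ?N / 2 * pr Q (insert ?q ?W) d (A l \<inter> F x l (zs t) y))" for l
      proof (cases "?q \<in> d")
        case True
        hence 1: "a t d (insert ?q r) = insert ?q ?W \<union> d \<inter> r" for r by (auto simp: a_def)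
        have 2: "?q \<notin> a t d (r - {?q})" for r using q by (auto simp: a_def)
        show ?thesis using True
          by (subst sum_Pow_halve[OF finite_Q q(1)])
            (simp add: 1 2 pr_def F_def sum_divide_distrib[symmetric] of_bool_conj)
      next
        case False
        hence "?q \<notin> a t d r" for r using q by (auto simp: a_def)
        thus ?thesis using False by simp
      qed
      have "hit t d x y' y = (\<Sum>l\<in>L. (\<Sum>r\<in>Pow Q. of_bool (a t d r \<in> A l) *
            (of_bool (?q \<in> a t d r) * of_bool (\<gamma> x l (zs t) (a t d r) = y))) * (\<Sum>r'\<in>Pow Q. of_bool (b t d r' \<in> B l)))"
        unfolding hit_def a_def b_def
        by (rule sum_transcript[OF t d, of "\<lambda>a l. of_bool (?q \<in> a) * of_bool (\<gamma> x l (zs t) a = y)"])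
      also have "\<dots> = (\<Sum>l\<in>L. of_bool (?q \<in> d) * (2 ^ ?N / 2 * pr Q (insert ?q ?W) d (A l \<inter> F x l (zs t) y))
            * (2 ^ ?N * pr Q ?W (Q - d - {?q}) (B l)))"
      proof (intro sum.cong refl)
        fix l
        have "of_bool (?q \<in> d) * (\<Sum>r'\<in>Pow Q. of_bool (b t d r' \<in> B l)) = of_bool (?q \<in> d) * (2 ^ ?N * pr Q ?W (Q - d - {?q}) (B l))"
        proof (cases "?q \<in> d")
          case True
          hence "Q - d - {?q} = Q - d" by auto
          thus ?thesis by (simp add: pr_def b_def)
        qed simp
        thus "(\<Sum>r\<in>Pow Q. of_bool (a t d r \<in> A l) *
            (of_bool (?q \<in> a t d r) * of_bool (\<gamma> x l (zs t) (a t d r) = y))) * (\<Sum>r'\<in>Pow Q. of_bool (b t d r' \<in> B l))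
          = of_bool (?q \<in> d) * (2 ^ ?N / 2 * pr Q (insert ?q ?W) d (A l \<inter> F x l (zs t) y))
            * (2 ^ ?N * pr Q ?W (Q - d - {?q}) (B l))"
          unfolding sumr by (cases "?q \<in> d") simp_all
      qed
      also have "\<dots> = of_bool (?q \<in> d) * (4 ^ ?N / 2 * single x d ?W y' (zs t) y)"
      proof -
        have p4: "(4 :: real) ^ ?N = 2 ^ ?N * 2 ^ ?N" by (simp add: power_mult_distrib[symmetric])
        show ?thesis unfolding single_def p4 sum_distrib_left
          by (intro sum.cong refl) simp
      qed
      finally show ?thesis .
    qed
    hence "(\<Sum>d\<in>Pow Q. hit t d x y' y) = (\<Sum>d\<in>Pow Q. of_bool (?q \<in> d) * (4 ^ ?N / 2 * single x d ?W y' (zs t) y))"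
      by (intro sum.cong) auto
    also have "\<dots> = (\<Sum>d\<in>Pow Q. 4 ^ ?N / 2 * single x d ?W y' (zs t) y) / 2"
    proof (rule sum_Pow_mem_half[OF finite_Q q(1)])
      fix d
      have 1: "pr Q (insert ?q ?W) (insert ?q d) G = pr Q (insert ?q ?W) d G" for G
        using pr_insert_planted[of Q ?q ?W "insert ?q d" G] pr_insert_planted[of Q ?q ?W d G] by simp
      have 2: "Q - insert ?q d - {?q} = Q - d - {?q}" by auto
      show "4 ^ ?N / 2 * single x (insert ?q d) ?W y' (zs t) y = 4 ^ ?N / 2 * single x d ?W y' (zs t) y"
        by (simp only: single_def 1 2)
    qed
    finally show ?thesis unfolding sum_distrib_left[symmetric] by simp
  qed
  define M where "M = (\<Sum>x\<in>X. \<Sum>t\<in>T. \<Sum>y\<in>Y. of_bool (y \<noteq> t x) * (\<Sum>d\<in>Pow Q. hit t d x y (t x)))"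
  \<comment> \<open>After the exchange the guess has to equal the decoy, which happens for at most
    one \<open>y\<close> per choice of the bits.\<close>
  have hit_row: "(\<Sum>y\<in>Y. of_bool (y \<noteq> t x) * (\<Sum>d\<in>Pow Q. hit t d x y y)) \<le> 2 ^ ?N * 4 ^ ?N" for t x
  proof -
    have "(\<Sum>y\<in>Y. of_bool (y \<noteq> t x) * (\<Sum>d\<in>Pow Q. hit t d x y y)) \<le> (\<Sum>y\<in>Y. \<Sum>d\<in>Pow Q. hit t d x y y)"
      by (intro sum_mono) (auto simp: hit_def intro!: sum_nonneg)
    also have "\<dots> = (\<Sum>d\<in>Pow Q. \<Sum>y\<in>Y. hit t d x y y)" by (rule sum.swap)
    also have "\<dots> = (\<Sum>d\<in>Pow Q. \<Sum>r\<in>Pow Q. \<Sum>r'\<in>Pow Q. \<Sum>y\<in>Y.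
        of_bool ((x, y) \<in> a t d r) * of_bool (\<gamma> x (\<tau> (a t d r) (b t d r')) (zs t) (a t d r) = y))"
      unfolding hit_def by (intro sum.cong refl, subst sum.swap) (intro sum.cong refl sum.swap)
    also have "\<dots> \<le> (\<Sum>d\<in>Pow Q. \<Sum>r\<in>Pow Q. \<Sum>r'\<in>Pow Q. 1)"
    proof (intro sum_mono)
      fix d r r'
      let ?g = "\<gamma> x (\<tau> (a t d r) (b t d r')) (zs t) (a t d r)"
      have "(\<Sum>y\<in>Y. of_bool ((x, y) \<in> a t d r) * of_bool (?g = y) :: real) \<le> (\<Sum>y\<in>Y. if y = ?g then 1 else 0)"
        by (intro sum_mono) auto
      also have "\<dots> \<le> 1" using finite_Y by simp
      finally show "(\<Sum>y\<in>Y. of_bool ((x, y) \<in> a t d r) * of_bool (?g = y) :: real) \<le> 1" .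
    qed
    also have "\<dots> = 2 ^ ?N * 4 ^ ?N"
      using finite_Q by (simp add: sum_Pow_Pow_1 card_Pow del: sum_constant) (simp add: card_Pow)
    finally show ?thesis .
  qed
  have M_single: "(\<Sum>x\<in>X. \<Sum>t\<in>T. \<Sum>y\<in>Y. of_bool (y \<noteq> t x) * (\<Sum>d\<in>Pow Q. hit t d x y (f t x y)))
     = 4 ^ ?N / 4 * (\<Sum>x\<in>X. \<Sum>d\<in>Pow Q. \<Sum>t\<in>T. \<Sum>y\<in>Y. of_bool (y \<noteq> t x) * single x d (plant X t) y (zs t) (f t x y))" for f
  proof -
    have "(\<Sum>x\<in>X. \<Sum>t\<in>T. \<Sum>y\<in>Y. of_bool (y \<noteq> t x) * (\<Sum>d\<in>Pow Q. hit t d x y (f t x y)))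
      = (\<Sum>x\<in>X. \<Sum>t\<in>T. \<Sum>y\<in>Y. 4 ^ ?N / 4 * (\<Sum>d\<in>Pow Q. of_bool (y \<noteq> t x) * single x d (plant X t) y (zs t) (f t x y)))"
    proof (intro sum.cong refl)
      fix x t y assume "x \<in> X" "t \<in> T" "y \<in> Y"
      thus "of_bool (y \<noteq> t x) * (\<Sum>d\<in>Pow Q. hit t d x y (f t x y))
        = 4 ^ ?N / 4 * (\<Sum>d\<in>Pow Q. of_bool (y \<noteq> t x) * single x d (plant X t) y (zs t) (f t x y))"
        using hit_single[of t x y "f t x y"] by (cases "y = t x") auto
    qed
    also have "\<dots> = 4 ^ ?N / 4 * (\<Sum>x\<in>X. \<Sum>t\<in>T. \<Sum>y\<in>Y. \<Sum>d\<in>Pow Q. of_bool (y \<noteq> t x) * single x d (plant X t) y (zs t) (f t x y))"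
      by (simp only: sum_distrib_left[symmetric])
    also have "(\<Sum>x\<in>X. \<Sum>t\<in>T. \<Sum>y\<in>Y. \<Sum>d\<in>Pow Q. of_bool (y \<noteq> t x) * single x d (plant X t) y (zs t) (f t x y))
      = (\<Sum>x\<in>X. \<Sum>t\<in>T. \<Sum>d\<in>Pow Q. \<Sum>y\<in>Y. of_bool (y \<noteq> t x) * single x d (plant X t) y (zs t) (f t x y))"
      by (intro sum.cong refl sum.swap)
    also have "\<dots> = (\<Sum>x\<in>X. \<Sum>d\<in>Pow Q. \<Sum>t\<in>T. \<Sum>y\<in>Y. of_bool (y \<noteq> t x) * single x d (plant X t) y (zs t) (f t x y))"
      by (intro sum.cong refl sum.swap)
    finally show ?thesis .
  qed
  have "M \<le> 4 ^ ?N / 4 * (\<Sum>x\<in>X. \<Sum>d\<in>Pow Q. \<Sum>t\<in>T. \<Sum>y\<in>Y.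
      of_bool (y \<noteq> t x) * single x d (plant X t) y (zs t) y + 2 * plant_gap t d x y + of_bool (x \<in> vis t))"
    unfolding M_def M_single[of "\<lambda>t x y. t x"] by (intro mult_left_mono sum_mono row) auto
  also have "\<dots> = (\<Sum>x\<in>X. \<Sum>t\<in>T. \<Sum>y\<in>Y. of_bool (y \<noteq> t x) * (\<Sum>d\<in>Pow Q. hit t d x y y))
     + 4 ^ ?N / 4 * (2 * (\<Sum>x\<in>X. \<Sum>d\<in>Pow Q. \<Sum>t\<in>T. \<Sum>y\<in>Y. plant_gap t d x y)
          + (\<Sum>x\<in>X. \<Sum>d\<in>Pow Q. \<Sum>t\<in>T. \<Sum>y\<in>Y. of_bool (x \<in> vis t)))"
    unfolding M_single[of "\<lambda>t x y. y"] by (simp only: sum.distrib distrib_left sum_distrib_left[symmetric] add.assoc)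
  also have "(\<Sum>x\<in>X. \<Sum>d\<in>Pow Q. \<Sum>t\<in>T. \<Sum>y\<in>Y. plant_gap t d x y) = (\<Sum>t\<in>T. \<Sum>d\<in>Pow Q. \<Sum>x\<in>X. \<Sum>y\<in>Y. plant_gap t d x y)"
  proof -
    have "(\<Sum>x\<in>X. \<Sum>d\<in>Pow Q. \<Sum>t\<in>T. \<Sum>y\<in>Y. plant_gap t d x y) = (\<Sum>x\<in>X. \<Sum>t\<in>T. \<Sum>d\<in>Pow Q. \<Sum>y\<in>Y. plant_gap t d x y)"
      by (intro sum.cong refl sum.swap)
    also have "\<dots> = (\<Sum>t\<in>T. \<Sum>x\<in>X. \<Sum>d\<in>Pow Q. \<Sum>y\<in>Y. plant_gap t d x y)" by (rule sum.swap)
    also have "\<dots> = (\<Sum>t\<in>T. \<Sum>d\<in>Pow Q. \<Sum>x\<in>X. \<Sum>y\<in>Y. plant_gap t d x y)"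
      by (intro sum.cong refl sum.swap)
    finally show ?thesis .
  qed
  also have "(\<Sum>x\<in>X. \<Sum>d\<in>Pow Q. \<Sum>t\<in>T. \<Sum>y\<in>Y. of_bool (x \<in> vis t)) = 2 ^ ?N * ?n * (\<Sum>t\<in>T. \<Sum>x\<in>X. of_bool (x \<in> vis t))"
    using finite_Q by (subst (2) sum.swap) (simp add: card_Pow sum_distrib_left mult_ac)
  also have "(\<Sum>x\<in>X. \<Sum>t\<in>T. \<Sum>y\<in>Y. of_bool (y \<noteq> t x) * (\<Sum>d\<in>Pow Q. hit t d x y y))
      + 4 ^ ?N / 4 * (2 * (\<Sum>t\<in>T. \<Sum>d\<in>Pow Q. \<Sum>x\<in>X. \<Sum>y\<in>Y. plant_gap t d x y)
          + 2 ^ ?N * ?n * (\<Sum>t\<in>T. \<Sum>x\<in>X. of_bool (x \<in> vis t)))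
     \<le> (\<Sum>x\<in>X. \<Sum>t\<in>T. 2 ^ ?N * 4 ^ ?N)
      + 4 ^ ?N / 4 * (2 * (card T * (2 ^ ?N * (30 * sqrt (?N * ln (card L))))) + 2 ^ ?N * ?n * (\<Sum>t\<in>T. real J))"
    by (intro add_mono mult_left_mono sum_mono hit_row sum_plant_gap_le sum_vis_le) (use n0 in auto)
  also have "\<dots> = card (seeds X Y) * (card X + 15 * sqrt (?N * ln (card L)) + ?n * J / 4)"
    unfolding card_seeds by (simp add: field_simps)
  finally have M_le: "M \<le> card (seeds X Y) * (card X + 15 * sqrt (?N * ln (card L)) + ?n * J / 4)" .

  \<comment> \<open>The number of decoys, with mean \<open>(n - 1) / 4\<close>. \<open>M\<close>
    counts correct guesses weighted by \<open>c\<close>; the threshold \<open>n / 8\<close> turns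
    this into a bound on their number.\<close>
  define c where "c u x = (\<Sum>y\<in>Y. of_bool (y \<noteq> fst u x) * of_bool ((x, y) \<in> left_sets X u) :: real)" for u x
  define win where "win u x = (\<gamma> x (\<tau> (left_sets X u) (right_sets X Y u)) (zs (fst u)) (left_sets X u) = fst u x)" for u x
  have tail: "(\<Sum>u\<in>seeds X Y. of_bool (8 * c u x < ?n)) \<le> card (seeds X Y) * tail_bound (card Y)" if x: "x \<in> X" for x
  proof -
    have inner: "(\<Sum>d\<in>Pow Q. \<Sum>r\<in>Pow Q. \<Sum>r'\<in>Pow Q. of_bool (8 * c (t, d, r, r') x < ?n)) \<le> 2 ^ ?N * 4 ^ ?N * tail_bound (card Y)"
      if t: "t \<in> T" for t
    proof -
      define R where "R = Pair x ` (Y - {t x})"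
      have RQ: "R \<subseteq> Q" using x by (auto simp: R_def)
      have "t x \<in> Y" using t x by auto
      hence cR: "card R = card Y - 1" using finite_Y by (simp add: R_def card_image inj_on_def)
      have "c (t, d, r, r') x = card (d \<inter> r \<inter> R)" for d r r'
      proof -
        have "c (t, d, r, r') x = (\<Sum>y\<in>Y - {t x}. of_bool ((x, y) \<in> d \<inter> r))"
          unfolding c_def using finite_Y
          by (intro sum.mono_neutral_cong_right) (auto simp: left_sets_def plant_iff)
        also have "\<dots> = (\<Sum>q\<in>R. of_bool (q \<in> d \<inter> r))"
          unfolding R_def by (subst sum.reindex) (auto simp: inj_on_def)
        also have "\<dots> = card (R \<inter> (d \<inter> r))"
          using RQ finite_subset[OF RQ finite_Q] by (simp add: sum_of_bool_eq Int_def)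
        finally show ?thesis by (simp add: Int_ac)
      qed
      moreover have "of_bool (8 * real m < ?n) \<le> 2 powr (?n / 8) * (1 / 2) ^ m" for m :: nat
      proof (cases "8 * real m < ?n")
        case True
        hence "2 powr real m \<le> 2 powr (?n / 8)" by (intro powr_mono) auto
        hence "(2 :: real) ^ m \<le> 2 powr (?n / 8)" by (simp add: powr_realpow)
        thus ?thesis using True by (simp add: power_one_over field_simps)
      qed simp
      ultimately have "(\<Sum>d\<in>Pow Q. \<Sum>r\<in>Pow Q. \<Sum>r'\<in>Pow Q. of_bool (8 * c (t, d, r, r') x < ?n))
         \<le> (\<Sum>d\<in>Pow Q. \<Sum>r\<in>Pow Q. \<Sum>r'\<in>Pow Q. 2 powr (?n / 8) * (1 / 2) ^ card (d \<inter> r \<inter> R))"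
        by (simp only:) (intro sum_mono)
      also have "\<dots> = 2 ^ ?N * 2 powr (?n / 8) * (\<Sum>d\<in>Pow Q. \<Sum>r\<in>Pow Q. (1 / 2) ^ card (d \<inter> r \<inter> R))"
        using finite_Q by (simp add: card_Pow sum_distrib_left mult_ac)
      also have "\<dots> = 2 ^ ?N * 4 ^ ?N * tail_bound (card Y)"
        by (simp add: sum_Pow_Pow_power_card_Int[OF finite_Q RQ] cR tail_bound_def)
      finally show ?thesis .
    qed
    have "(\<Sum>u\<in>seeds X Y. of_bool (8 * c u x < ?n)) \<le> (\<Sum>t\<in>T. 2 ^ ?N * 4 ^ ?N * tail_bound (card Y))"
      unfolding sum_seeds by (intro sum_mono inner)
    thus ?thesis by (simp add: card_seeds)
  qed
  have M_win: "M = (\<Sum>u\<in>seeds X Y. \<Sum>x\<in>X. of_bool (win u x) * c u x)"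
  proof -
    have "M = (\<Sum>x\<in>X. \<Sum>t\<in>T. \<Sum>d\<in>Pow Q. \<Sum>r\<in>Pow Q. \<Sum>r'\<in>Pow Q. of_bool (win (t, d, r, r') x) * c (t, d, r, r') x)"
      unfolding M_def
    proof (intro sum.cong refl)
      fix x t
      have "(\<Sum>y\<in>Y. of_bool (y \<noteq> t x) * (\<Sum>d\<in>Pow Q. hit t d x y (t x)))
        = (\<Sum>y\<in>Y. \<Sum>d\<in>Pow Q. \<Sum>r\<in>Pow Q. \<Sum>r'\<in>Pow Q.
            of_bool (win (t, d, r, r') x) * (of_bool (y \<noteq> t x) * of_bool ((x, y) \<in> a t d r)))"
        unfolding hit_def sum_distrib_left
        by (intro sum.cong refl) (simp add: win_def left_sets_def right_sets_def a_def b_def)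
      also have "\<dots> = (\<Sum>d\<in>Pow Q. \<Sum>r\<in>Pow Q. \<Sum>r'\<in>Pow Q. \<Sum>y\<in>Y.
            of_bool (win (t, d, r, r') x) * (of_bool (y \<noteq> t x) * of_bool ((x, y) \<in> a t d r)))"
        by (subst sum.swap, intro sum.cong refl, subst sum.swap) (intro sum.cong refl sum.swap)
      also have "\<dots> = (\<Sum>d\<in>Pow Q. \<Sum>r\<in>Pow Q. \<Sum>r'\<in>Pow Q. of_bool (win (t, d, r, r') x) * c (t, d, r, r') x)"
        by (simp add: c_def sum_distrib_left left_sets_def a_def)
      finally show "(\<Sum>y\<in>Y. of_bool (y \<noteq> t x) * (\<Sum>d\<in>Pow Q. hit t d x y (t x)))
        = (\<Sum>d\<in>Pow Q. \<Sum>r\<in>Pow Q. \<Sum>r'\<in>Pow Q. of_bool (win (t, d, r, r') x) * c (t, d, r, r') x)" .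
    qed
    also have "\<dots> = (\<Sum>x\<in>X. \<Sum>u\<in>seeds X Y. of_bool (win u x) * c u x)" by (simp only: sum_seeds)
    also have "\<dots> = (\<Sum>u\<in>seeds X Y. \<Sum>x\<in>X. of_bool (win u x) * c u x)" by (rule sum.swap)
    finally show ?thesis .
  qed
  have c0: "c u x \<ge> 0" for u x unfolding c_def by (intro sum_nonneg) auto
  have "?n / 8 * (\<Sum>u\<in>seeds X Y. \<Sum>x\<in>X. of_bool (win u x))
     \<le> (\<Sum>u\<in>seeds X Y. \<Sum>x\<in>X. of_bool (win u x) * c u x + ?n / 8 * of_bool (8 * c u x < ?n))"
    unfolding sum_distrib_left
  proof (intro sum_mono)
    fix u x
    show "?n / 8 * of_bool (win u x) \<le> of_bool (win u x) * c u x + ?n / 8 * of_bool (8 * c u x < ?n)"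
      using c0[of u x] n0 by (cases "win u x"; cases "8 * c u x < ?n") auto
  qed
  also have "\<dots> = M + ?n / 8 * (\<Sum>x\<in>X. \<Sum>u\<in>seeds X Y. of_bool (8 * c u x < ?n))"
    unfolding sum.distrib M_win sum_distrib_left[symmetric] by (subst (3) sum.swap) (rule refl)
  also have "\<dots> \<le> card (seeds X Y) * (card X + 15 * sqrt (?N * ln (card L)) + ?n * J / 4)
       + ?n / 8 * (\<Sum>x\<in>X. card (seeds X Y) * tail_bound (card Y))"
    by (intro add_mono M_le mult_left_mono sum_mono tail) auto
  finally have "(\<Sum>u\<in>seeds X Y. \<Sum>x\<in>X. of_bool (win u x))
     \<le> (card (seeds X Y) * (card X + 15 * sqrt (?N * ln (card L)) + ?n * J / 4)
       + ?n / 8 * (card X * (card (seeds X Y) * tail_bound (card Y)))) * (8 / ?n)"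
    using n0 by (simp add: field_simps)
  also have "\<dots> = card (seeds X Y) * (card X * (tail_bound (card Y) + 8 / ?n)
              + 120 * sqrt (?N * ln (card L)) / ?n + 2 * J)"
    using n0 by (simp add: field_simps)
  finally show ?thesis by (simp only: win_def)
qed

definition flip :: "('x \<Rightarrow> 'y) \<times> ('x \<times> 'y) set \<times> ('x \<times> 'y) set \<times> ('x \<times> 'y) set \<Rightarrow> ('x \<Rightarrow> 'y) \<times> ('x \<times> 'y) set \<times> ('x \<times> 'y) set \<times> ('x \<times> 'y) set" where
  "flip = (\<lambda>(t, d, r, r'). (t, Q - d, r', r))"

lemma flip:
  assumes "u \<in> seeds X Y"
  shows "flip u \<in> seeds X Y" "flip (flip u) = u" "fst (flip u) = fst u"
    "left_sets X (flip u) = right_sets X Y u" "right_sets X Y (flip u) = left_sets X u"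
  using assms by (auto simp: flip_def seeds_def left_sets_def right_sets_def)

theorem right_guess_le:
  fixes \<gamma> :: "'x \<Rightarrow> 'l \<Rightarrow> 'z \<Rightarrow> ('x \<times> 'y) set \<Rightarrow> 'y"
  shows "(\<Sum>u\<in>seeds X Y. \<Sum>x\<in>X. of_bool (\<gamma> x (\<tau> (left_sets X u) (right_sets X Y u)) (zs (fst u)) (right_sets X Y u) = fst u x))
         \<le> card (seeds X Y) * (card X * (tail_bound (card Y) + 8 / card Y)
              + 120 * sqrt (card Q * ln (card L)) / card Y + 2 * J)"
proof -
  interpret sw: intersection_game X Y "\<lambda>a b. \<tau> b a" L zs vis J
  proof unfold_locales
    show "\<tau> (right_sets X Y u) (left_sets X u) \<in> L" if "u \<in> seeds X Y" for u
      using transcript_in_L[OF flip(1)[OF that]] flip[OF that] by simp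
    show "\<tau> b' a = l" if "\<tau> b a = l" "\<tau> b' a' = l" for a b a' b' l
      by (rule rect[OF that(2,1)])
  qed (fact finite_X finite_Y Y_nonempty finite_L' zs_upd card_vis)+
  have "(\<Sum>u\<in>seeds X Y. \<Sum>x\<in>X. of_bool (\<gamma> x (\<tau> (left_sets X u) (right_sets X Y u)) (zs (fst u)) (right_sets X Y u) = fst u x) :: real)
    = (\<Sum>u\<in>seeds X Y. \<Sum>x\<in>X. of_bool (\<gamma> x (\<tau> (right_sets X Y u) (left_sets X u)) (zs (fst u)) (left_sets X u) = fst u x))"
    by (rule sum.reindex_bij_witness[of _ flip flip]) (simp_all add: flip)
  thus ?thesis using sw.left_guess_le[of \<gamma>] by simp
qed

end

subsection \<open>Phases of a protocol\<close>

primrec advance :: "player set \<Rightarrow> protocol \<Rightarrow> hpc_input \<Rightarrow> bool list \<times> protocol" where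
  "advance S (Output p g) I = ([], Output p g)"
| "advance S (Speak p m P Q) I =
    (if p \<in> S then
       (if m (I p) then (True # fst (advance S P I), snd (advance S P I))
        else (False # fst (advance S Q I), snd (advance S Q I)))
     else ([], Speak p m P Q))"

definition extend :: "player set \<Rightarrow> bool list \<times> protocol \<Rightarrow> hpc_input \<Rightarrow> bool list \<times> protocol" where
  "extend S h I = (fst h @ fst (advance S (snd h) I), snd (advance S (snd h) I))"

text \<open>Phases are made as long as possible: phase \<open>j\<close> ends when a player outside
  \<open>phase_players j\<close> has to speak.\<close>

primrec stage :: "protocol \<Rightarrow> hpc_input \<Rightarrow> nat \<Rightarrow> bool list \<times> protocol" where
  "stage P I 0 = ([], P)"
| "stage P I (Suc j) = extend (phase_players (Suc j)) (stage P I j) I"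

lemma advance_cong: "(\<And>p. p \<in> S \<Longrightarrow> I p = I' p) \<Longrightarrow> advance S P I = advance S P I'"
  by (induction P) auto

lemma extend_cong: "(\<And>p. p \<in> S \<Longrightarrow> I p = I' p) \<Longrightarrow> extend S h I = extend S h I'"
  unfolding extend_def using advance_cong by metis

lemma answer_advance: "answer (snd (advance S P I)) I = answer P I"
  by (induction P) auto

lemma answer_stage: "answer (snd (stage P I j)) I = answer P I"
  by (induction j) (auto simp: extend_def answer_advance)

text \<open>The bits of one phase form a prefix-free code. The suffixes \<open>c\<close> and
  \<open>c'\<close> allow a concatenation of phases to be decoded phase by phase.\<close>

lemma advance_determined:
  "fst (advance S P I) @ c = fst (advance S P I') @ c' \<Longrightarrow> advance S P I = advance S P I'"
  by (induction P) (auto split: if_splits intro: prod_eqI)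

lemma stage_determined:
  "fst (stage P I j) @ c = fst (stage P I' j) @ c' \<Longrightarrow> stage P I j = stage P I' j"
proof (induction j arbitrary: c c')
  case (Suc j)
  have "stage P I j = stage P I' j"
    by (rule Suc.IH[of "fst (advance (phase_players (Suc j)) (snd (stage P I j)) I) @ c"
          "fst (advance (phase_players (Suc j)) (snd (stage P I' j)) I') @ c'"])
      (use Suc.prems in \<open>simp add: extend_def\<close>)
  moreover from this have "advance (phase_players (Suc j)) (snd (stage P I j)) I
      = advance (phase_players (Suc j)) (snd (stage P I j)) I'"
    using Suc.prems by (intro advance_determined[of _ _ _ c _ c']) (simp add: extend_def)
  ultimately show ?case by (simp add: extend_def)
qed simp

lemma advance_mix:
  assumes "advance S P I = advance S P I'" and "\<And>p. I'' p = I p \<or> I'' p = I' p"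
  shows "advance S P I'' = advance S P I"
  using assms(1)
proof (induction P)
  case (Speak p m P Q)
  thus ?case using assms(2)[of p] by (auto simp: prod_eq_iff split: if_splits)
qed simp

text \<open>Equal stages were equal after every earlier phase by prefix-freeness. In each phase the
  two runs follow the same path, and at each node the mixed input agrees at the speaker with one of
  them.\<close>

lemma stage_mix:
  assumes "stage P I j = stage P I' j" and "\<And>p. I'' p = I p \<or> I'' p = I' p"
  shows "stage P I'' j = stage P I j"
  using assms(1)
proof (induction j)
  case (Suc j)
  have prev: "stage P I j = stage P I' j"
    by (rule stage_determined[of _ _ _ "fst (advance (phase_players (Suc j)) (snd (stage P I j)) I)"
          _ "fst (advance (phase_players (Suc j)) (snd (stage P I' j)) I')"])
      (use Suc.prems in \<open>simp add: extend_def\<close>)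
  have "advance (phase_players (Suc j)) (snd (stage P I j)) I = advance (phase_players (Suc j)) (snd (stage P I j)) I'"
    using Suc.prems prev by (simp add: extend_def prod_eq_iff)
  from advance_mix[OF this assms(2)] Suc.IH[OF prev] show ?case by (simp add: extend_def)
qed simp

lemma length_advance: "length (fst (advance S P I)) + length (speakers (snd (advance S P I)) I) = length (speakers P I)"
  by (induction P) auto

lemma length_stage_le: "length (fst (stage P I j)) \<le> bits_sent P I"
proof -
  have "length (fst (stage P I j)) + length (speakers (snd (stage P I j)) I) = bits_sent P I"
  proof (induction j)
    case (Suc j)
    thus ?case using length_advance[of "phase_players (Suc j)" "snd (stage P I j)" I]
      by (simp add: extend_def)
  qed (simp add: bits_sent_def)
  thus ?thesis by simp
qed

lemma speakers_advance_suffix: "\<exists>ws. speakers P I = ws @ speakers (snd (advance S P I)) I"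
proof (induction P)
  case (Speak p m P Q)
  then obtain ws ws' where "speakers P I = ws @ speakers (snd (advance S P I)) I"
    "speakers Q I = ws' @ speakers (snd (advance S Q I)) I" by blast
  hence "speakers (Speak p m P Q) I =
      (if p \<in> S then p # (if m (I p) then ws else ws') else []) @ speakers (snd (advance S (Speak p m P Q) I)) I"
    by simp
  thus ?case by (rule exI)
qed simp

lemma hd_speakers_advance:
  "speakers (snd (advance S P I)) I = [] \<or> hd (speakers (snd (advance S P I)) I) \<notin> S"
  by (induction P) auto

text \<open>A maximal phase consumes at least any initial block \<open>us\<close> of admissible
  speakers, since it can stop only before a speaker outside \<open>S\<close>.\<close>

lemma speakers_advance:
  assumes "speakers P I = us @ vs" "set us \<subseteq> S"
  shows "\<exists>ws. vs = ws @ speakers (snd (advance S P I)) I"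
proof -
  let ?r = "speakers (snd (advance S P I)) I"
  obtain ws where ws: "us @ vs = ws @ ?r" using speakers_advance_suffix[of P I S] assms(1) by auto
  then obtain zs where "(us = ws @ zs \<and> zs @ vs = ?r) \<or> (us @ zs = ws \<and> vs = zs @ ?r)"
    by (auto simp: append_eq_append_conv2)
  thus ?thesis
  proof
    assume z: "us = ws @ zs \<and> zs @ vs = ?r"
    have "zs = []"
    proof (rule ccontr)
      assume "zs \<noteq> []"
      hence "hd ?r \<in> set us" "?r \<noteq> []" using z by (metis UnCI hd_append2 hd_in_set set_append, auto)
      thus False using hd_speakers_advance[of S P I] assms(2) by auto
    qed
    hence "vs = [] @ ?r" using z by simp
    thus ?thesis by (rule exI)
  qed auto
qed

lemma speakers_Nil: "speakers P I = [] \<Longrightarrow> \<exists>p g. P = Output p g"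
  by (cases P) auto

text \<open>Greedy phases never lag behind the given partition: after \<open>i\<close> of them, the
  speakers still to come form a suffix of the phases from position \<open>i\<close> on. After
  \<open>k\<close> phases none remain.\<close>

lemma stage_Output:
  assumes "within_phases k (speakers P I)"
  shows "\<exists>p g. snd (stage P I k) = Output p g"
proof -
  obtain phs where phs: "speakers P I = concat phs" "length phs \<le> k"
    "\<And>j. j < length phs \<Longrightarrow> set (phs ! j) \<subseteq> phase_players (Suc j)"
    using assms unfolding within_phases_def by blast
  have "\<exists>us. concat (drop i phs) = us @ speakers (snd (stage P I i)) I" for i
  proof (induction i)
    case 0
    thus ?case using phs(1) by (intro exI[of _ "[]"]) simp
  next
    case (Suc i)
    let ?R = "snd (stage P I i)"
    obtain us where us: "concat (drop i phs) = us @ speakers ?R I" using Suc by blast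
    have step: "snd (stage P I (Suc i)) = snd (advance (phase_players (Suc i)) ?R I)"
      by (simp add: extend_def)
    show ?case
    proof (cases "i < length phs")
      case False
      hence "drop i phs = []" "drop (Suc i) phs = []" by auto
      hence "speakers ?R I = []" using us by simp
      then obtain p g where "?R = Output p g" using speakers_Nil by blast
      thus ?thesis unfolding step by (simp add: \<open>drop (Suc i) phs = []\<close>)
    next
      case True
      hence "phs ! i @ concat (drop (Suc i) phs) = us @ speakers ?R I"
        using us by (simp add: Cons_nth_drop_Suc[symmetric])
      then obtain zs where z: "(phs ! i = us @ zs \<and> zs @ concat (drop (Suc i) phs) = speakers ?R I) \<or>
          (phs ! i @ zs = us \<and> concat (drop (Suc i) phs) = zs @ speakers ?R I)"
        by (auto simp: append_eq_append_conv2)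
      thus ?thesis
      proof
        assume z: "phs ! i = us @ zs \<and> zs @ concat (drop (Suc i) phs) = speakers ?R I"
        show ?thesis unfolding step
          by (rule speakers_advance[of _ _ zs]) (use z phs(3)[OF True] in auto)
      next
        assume z: "phs ! i @ zs = us \<and> concat (drop (Suc i) phs) = zs @ speakers ?R I"
        obtain ws where "speakers ?R I = ws @ speakers (snd (advance (phase_players (Suc i)) ?R I)) I"
          using speakers_advance_suffix by blast
        hence "concat (drop (Suc i) phs) = (zs @ ws) @ speakers (snd (advance (phase_players (Suc i)) ?R I)) I"
          using z by simp
        thus ?thesis unfolding step by (rule exI)
      qed
    qed
  qed
  from this[of k] have "speakers (snd (stage P I k)) I = []" using phs(2) by simp
  thus ?thesis by (rule speakers_Nil)
qed

text \<open>By prefix-freeness the bits sent determine the stage, and there are fewer than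
  \<open>2 ^ Suc b\<close> bit strings of length at most \<open>b\<close>.\<close>

lemma card_stages_le:
  assumes "\<And>I. I \<in> \<I> \<Longrightarrow> bits_sent P I \<le> b"
  shows "finite ((\<lambda>I. stage P I j) ` \<I>)" "card ((\<lambda>I. stage P I j) ` \<I>) \<le> 2 ^ Suc b"
proof -
  let ?S = "(\<lambda>I. stage P I j) ` \<I>" and ?B = "{bs :: bool list. set bs \<subseteq> UNIV \<and> length bs \<le> b}"
  have inj: "inj_on fst ?S"
  proof (rule inj_onI)
    fix s s' assume "s \<in> ?S" "s' \<in> ?S" and eq: "fst s = fst s'"
    then obtain I I' where "s = stage P I j" "s' = stage P I' j" by blast
    thus "s = s'" using eq stage_determined[of P I j "[]" I' "[]"] by simp
  qed
  have sub: "fst ` ?S \<subseteq> ?B" 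
  proof
    fix bs assume "bs \<in> fst ` ?S"
    then obtain I where I: "I \<in> \<I>" "bs = fst (stage P I j)" by blast
    show "bs \<in> ?B" using order.trans[OF length_stage_le[of P I j] assms[OF I(1)]] I(2) by simp
  qed
  have fin: "finite ?B" by (rule finite_lists_length_le) simp
  show "finite ?S" using finite_imageD[OF finite_subset[OF sub fin] inj] .
  have "card ?S = card (fst ` ?S)" using inj by (simp add: card_image)
  also have "\<dots> \<le> card ?B" by (rule card_mono[OF fin sub])
  also have "\<dots> = (\<Sum>i\<le>b. 2 ^ i)" by (subst card_lists_length_le) auto
  also have "\<dots> \<le> 2 ^ Suc b" by (induction b) auto
  finally show "card ?S \<le> 2 ^ Suc b" .
qed

section \<open>Four-player inputs and their rectangle properties\<close>

definition row_sets :: "(nat \<times> nat) set \<Rightarrow> input" where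
  "row_sets a = (\<lambda>i. {j. (i, j) \<in> a})"

definition assemble :: "input \<Rightarrow> input \<Rightarrow> input \<Rightarrow> input \<Rightarrow> hpc_input" where
  "assemble a b c d = case_player a b c d"

lemma assemble_simps [simp]:
  "assemble a b c d PA = a" "assemble a b c d PB = b" "assemble a b c d PC = c" "assemble a b c d PD = d"
  by (simp_all add: assemble_def)

text \<open>The flag tells whether the first two inputs go to \<open>PA, PB\<close> or to
  \<open>PC, PD\<close>, so that odd and even steps share one argument.\<close>

definition assemble_sides :: "bool \<Rightarrow> input \<Rightarrow> input \<Rightarrow> input \<Rightarrow> input \<Rightarrow> hpc_input" where
  "assemble_sides \<sigma> a b c d = (if \<sigma> then assemble a b c d else assemble c d a b)"

lemma stage_rect:
  assumes "stage P (assemble_sides \<sigma> a b c d) j = h" "stage P (assemble_sides \<sigma> a' b' c d) j = h"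
  shows "stage P (assemble_sides \<sigma> a b' c d) j = h"
proof -
  have "stage P (assemble_sides \<sigma> a b' c d) j = stage P (assemble_sides \<sigma> a b c d) j"
  proof (rule stage_mix)
    fix p
    show "assemble_sides \<sigma> a b' c d p = assemble_sides \<sigma> a b c d p \<or> assemble_sides \<sigma> a b' c d p = assemble_sides \<sigma> a' b' c d p"
      by (cases p) (auto simp: assemble_sides_def)
  qed (use assms in simp)
  thus ?thesis using assms by simp
qed

lemma stage_rect_sides:
  assumes "stage P (assemble_sides \<sigma> a b c d) j = h" "stage P (assemble_sides \<sigma> a' b' c' d') j = h"
  shows "stage P (assemble_sides \<sigma> a b c' d') j = h"
proof -
  have "stage P (assemble_sides \<sigma> a b c' d') j = stage P (assemble_sides \<sigma> a b c d) j"
  proof (rule stage_mix)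
    fix p
    show "assemble_sides \<sigma> a b c' d' p = assemble_sides \<sigma> a b c d p \<or> assemble_sides \<sigma> a b c' d' p = assemble_sides \<sigma> a' b' c' d' p"
      by (cases p) (auto simp: assemble_sides_def)
  qed (use assms in simp)
  thus ?thesis using assms by simp
qed

subsection \<open>Pointer chasing\<close>

lemma sum_image_rectangles:
  fixes f :: "'h \<Rightarrow> 'u \<Rightarrow> 'v \<Rightarrow> real" and H :: "'u \<Rightarrow> 'v \<Rightarrow> 'h"
  assumes fin: "finite U" "finite V"
    and rect: "\<And>u v u' v' h. u \<in> U \<Longrightarrow> u' \<in> U \<Longrightarrow> v \<in> V \<Longrightarrow> v' \<in> V \<Longrightarrow> H u v = h \<Longrightarrow> H u' v' = h \<Longrightarrow> H u v' = h"
  defines "a \<equiv> \<lambda>h. {u\<in>U. \<exists>v\<in>V. H u v = h}" and "c \<equiv> \<lambda>h. {v\<in>V. \<exists>u\<in>U. H u v = h}"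
  shows "(\<Sum>u\<in>U. \<Sum>v\<in>V. f (H u v) u v) = (\<Sum>h\<in>case_prod H ` (U \<times> V). \<Sum>v\<in>c h. \<Sum>u\<in>a h. f h u v)"
proof -
  have "(\<Sum>u\<in>U. \<Sum>v\<in>V. f (H u v) u v) = (\<Sum>p\<in>U \<times> V. f (case_prod H p) (fst p) (snd p))"
    by (simp add: sum.cartesian_product case_prod_unfold)
  also have "\<dots> = (\<Sum>h\<in>case_prod H ` (U \<times> V). \<Sum>p\<in>{p\<in>U \<times> V. case_prod H p = h}. f (case_prod H p) (fst p) (snd p))"
    using fin by (intro sum.image_gen) auto
  also have "\<dots> = (\<Sum>h\<in>case_prod H ` (U \<times> V). \<Sum>p\<in>{p\<in>U \<times> V. case_prod H p = h}. f h (fst p) (snd p))"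
    by (intro sum.cong refl) auto
  also have "\<dots> = (\<Sum>h\<in>case_prod H ` (U \<times> V). \<Sum>p\<in>a h \<times> c h. f h (fst p) (snd p))"
  proof (intro sum.cong refl)
    fix h
    have "{p\<in>U \<times> V. case_prod H p = h} = a h \<times> c h"
    proof (rule set_eqI)
      fix p :: "'u \<times> 'v"
      obtain u v where p: "p = (u, v)" by (cases p)
      have "H u v = h" if "u \<in> U" "v \<in> V" "u' \<in> U" "v' \<in> V" "H u v' = h" "H u' v = h" for u' v'
        by (rule rect[OF that(1,3,4,2,5,6)])
      thus "p \<in> {p \<in> U \<times> V. case_prod H p = h} \<longleftrightarrow> p \<in> a h \<times> c h"
        unfolding p a_def c_def by fastforce
    qed
    thus "{p\<in>U \<times> V. case_prod H p = h} = a h \<times> c h" .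
  qed
  also have "\<dots> = (\<Sum>h\<in>case_prod H ` (U \<times> V). \<Sum>u\<in>a h. \<Sum>v\<in>c h. f h u v)"
    by (simp add: sum.cartesian_product case_prod_unfold)
  also have "\<dots> = (\<Sum>h\<in>case_prod H ` (U \<times> V). \<Sum>v\<in>c h. \<Sum>u\<in>a h. f h u v)"
    by (intro sum.cong refl sum.swap)
  finally show ?thesis .
qed

text \<open>Given \<open>H u v\<close>, the seeds \<open>u\<close> and \<open>v\<close> are independent. Hence \<open>e\<close> may be maximised over the
  \<open>v\<close> that lead to a given pointer \<open>\<zeta> h v = x\<close>, and \<open>x\<close> may then be taken uniform and independent
  of \<open>u\<close>.\<close>

lemma uniform_pointer_step:
  fixes H :: "'u \<Rightarrow> 'v \<Rightarrow> 'h" and \<zeta> :: "'h \<Rightarrow> 'v \<Rightarrow> 'x" and e :: "'h \<Rightarrow> 'v \<Rightarrow> 'u \<Rightarrow> real"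
    and D E :: real
  assumes fin: "finite U" "finite V" and X: "finite X" "X \<noteq> {}"
    and rect: "\<And>u v u' v' h. u \<in> U \<Longrightarrow> u' \<in> U \<Longrightarrow> v \<in> V \<Longrightarrow> v' \<in> V \<Longrightarrow> H u v = h \<Longrightarrow> H u' v' = h \<Longrightarrow> H u v' = h"
    and near: "\<And>\<psi>. (\<And>h x. 0 \<le> \<psi> h x \<and> \<psi> h x \<le> 1) \<Longrightarrow>
       (\<Sum>u\<in>U. \<Sum>v\<in>V. \<psi> (H u v) (\<zeta> (H u v) v)) \<le> (\<Sum>u\<in>U. \<Sum>v\<in>V. (\<Sum>x\<in>X. \<psi> (H u v) x) / card X) + D"
    and e: "\<And>h v u. e h v u \<le> 1"
    and bound: "\<And>w v. (\<And>h x v'. w h x = Some v' \<Longrightarrow> v' \<in> V \<and> \<zeta> h v' = x \<and> (\<exists>u\<in>U. H u v' = h)) \<Longrightarrow> v \<in> V \<Longrightarrow>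
       (\<Sum>u\<in>U. \<Sum>x\<in>X. case w (H u v) x of None \<Rightarrow> 0 | Some v' \<Rightarrow> e (H u v) v' u) \<le> E"
  shows "(\<Sum>u\<in>U. \<Sum>v\<in>V. e (H u v) v u) \<le> D + card V * E / card X"
proof -
  define a where "a h = {u\<in>U. \<exists>v\<in>V. H u v = h}" for h
  define c where "c h = {v\<in>V. \<exists>u\<in>U. H u v = h}" for h
  define R where "R = case_prod H ` (U \<times> V)"
  have group: "(\<Sum>u\<in>U. \<Sum>v\<in>V. f (H u v) u v) = (\<Sum>h\<in>R. \<Sum>v\<in>c h. \<Sum>u\<in>a h. f h u v)" for f :: "'h \<Rightarrow> 'u \<Rightarrow> 'v \<Rightarrow> real"
    unfolding a_def c_def R_def by (rule sum_image_rectangles[OF fin]) (rule rect)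
  have fin_ac: "finite (a h)" "finite (c h)" for h using fin by (auto simp: a_def c_def)
  define g where "g h v = (\<Sum>u\<in>a h. e h v u)" for h v
  \<comment> \<open>Only positive maxima are recorded. Otherwise \<open>w\<close> is
    \<open>None\<close> and counts as 0, which keeps \<open>G\<close> nonnegative and still above
    every \<open>g h v\<close>.\<close>
  define best where "best h x v \<longleftrightarrow> v \<in> c h \<and> \<zeta> h v = x \<and> g h v > 0 \<and> (\<forall>v'\<in>c h. \<zeta> h v' = x \<longrightarrow> g h v' \<le> g h v)" for h x v
  define w where "w h x = (if \<exists>v. best h x v then Some (SOME v. best h x v) else None)" for h x
  have w_best: "best h x v" if "w h x = Some v" for h x v
    using that someI_ex[of "best h x"] by (auto simp: w_def split: if_splits)
  define G where "G h x = (case w h x of None \<Rightarrow> 0 | Some v \<Rightarrow> g h v)" for h x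
  have G_ge: "g h v \<le> G h (\<zeta> h v)" if "v \<in> c h" for h v
  proof (cases "g h v \<le> 0")
    case True
    thus ?thesis using w_best[of h "\<zeta> h v"] by (auto simp: G_def best_def less_imp_le split: option.split)
  next
    case False
    let ?C = "{v'\<in>c h. \<zeta> h v' = \<zeta> h v}"
    have C: "finite (g h ` ?C)" "g h ` ?C \<noteq> {}" using fin_ac that by auto
    from Max_in[OF this] obtain v' where v': "v' \<in> ?C" "g h v' = Max (g h ` ?C)" by auto
    have "g h v'' \<le> g h v'" if "v'' \<in> ?C" for v''
      unfolding v'(2) using C that by (intro Max_ge) auto
    moreover from this[of v] have "g h v' > 0" using False that by simp
    ultimately have "best h (\<zeta> h v) v'" using v'(1) by (auto simp: best_def)
    hence "w h (\<zeta> h v) = Some (SOME v'. best h (\<zeta> h v) v')" unfolding w_def by meson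
    from w_best[OF this] this show ?thesis using that by (auto simp: G_def best_def)
  qed
  have G0: "0 \<le> G h x" for h x
    using w_best[of h x] by (auto simp: G_def best_def less_imp_le split: option.split)
  have G1: "G h x \<le> card (a h)" for h x
  proof -
    have "g h v \<le> (\<Sum>u\<in>a h. 1)" for v unfolding g_def by (intro sum_mono e)
    thus ?thesis by (auto simp: G_def split: option.split)
  qed
  \<comment> \<open>Tests in \<open>near\<close> take values in \<open>[0, 1]\<close>; summing
    \<open>\<psi>\<close> over \<open>a h\<close> restores \<open>G\<close>.\<close>
  define \<psi> where "\<psi> h x = G h x / card (a h)" for h x
  have \<psi>: "0 \<le> \<psi> h x \<and> \<psi> h x \<le> 1" for h x
    using G0[of h x] G1[of h x] by (cases "card (a h) = 0") (auto simp: \<psi>_def divide_le_eq)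
  have \<psi>_card: "(\<Sum>u\<in>a h. \<psi> h x) = G h x" for h x
    using G0[of h x] G1[of h x] by (cases "card (a h) = 0") (auto simp: \<psi>_def)
  have "(\<Sum>u\<in>U. \<Sum>v\<in>V. e (H u v) v u) = (\<Sum>h\<in>R. \<Sum>v\<in>c h. g h v)"
    unfolding g_def by (rule group[of "\<lambda>h u v. e h v u"])
  also have "\<dots> \<le> (\<Sum>h\<in>R. \<Sum>v\<in>c h. G h (\<zeta> h v))" by (intro sum_mono G_ge)
  also have "\<dots> = (\<Sum>u\<in>U. \<Sum>v\<in>V. \<psi> (H u v) (\<zeta> (H u v) v))"
    unfolding \<psi>_card[symmetric] by (rule group[of "\<lambda>h u v. \<psi> h (\<zeta> h v)", symmetric])
  also have "\<dots> \<le> (\<Sum>u\<in>U. \<Sum>v\<in>V. (\<Sum>x\<in>X. \<psi> (H u v) x) / card X) + D" by (rule near[OF \<psi>])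
  also have "(\<Sum>u\<in>U. \<Sum>v\<in>V. (\<Sum>x\<in>X. \<psi> (H u v) x) / card X) = (\<Sum>h\<in>R. \<Sum>v\<in>c h. \<Sum>u\<in>a h. (\<Sum>x\<in>X. \<psi> h x) / card X)"
    by (rule group[of "\<lambda>h u v. (\<Sum>x\<in>X. \<psi> h x) / card X"])
  also have "\<dots> = (\<Sum>h\<in>R. \<Sum>v\<in>c h. \<Sum>u\<in>a h. (\<Sum>x\<in>X. case w h x of None \<Rightarrow> 0 | Some v' \<Rightarrow> e h v' u) / card X)"
  proof (rule sum.cong[OF refl], rule sum.cong[OF refl])
    fix h v
    have "(\<Sum>u\<in>a h. \<Sum>x\<in>X. \<psi> h x) = (\<Sum>x\<in>X. G h x)"
      by (subst sum.swap) (simp only: \<psi>_card)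
    also have "\<dots> = (\<Sum>x\<in>X. \<Sum>u\<in>a h. case w h x of None \<Rightarrow> 0 | Some v' \<Rightarrow> e h v' u)"
      by (intro sum.cong refl) (auto simp: G_def g_def split: option.split)
    also have "\<dots> = (\<Sum>u\<in>a h. \<Sum>x\<in>X. case w h x of None \<Rightarrow> 0 | Some v' \<Rightarrow> e h v' u)" by (rule sum.swap)
    finally show "(\<Sum>u\<in>a h. (\<Sum>x\<in>X. \<psi> h x) / card X) = (\<Sum>u\<in>a h. (\<Sum>x\<in>X. case w h x of None \<Rightarrow> 0 | Some v' \<Rightarrow> e h v' u) / card X)"
      by (simp only: sum_divide_distrib[symmetric])
  qed
  also have "\<dots> = (\<Sum>u\<in>U. \<Sum>v\<in>V. (\<Sum>x\<in>X. case w (H u v) x of None \<Rightarrow> 0 | Some v' \<Rightarrow> e (H u v) v' u) / card X)"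
    by (rule group[of "\<lambda>h u v. (\<Sum>x\<in>X. case w h x of None \<Rightarrow> 0 | Some v' \<Rightarrow> e h v' u) / card X", symmetric])
  also have "\<dots> = (\<Sum>v\<in>V. (\<Sum>u\<in>U. \<Sum>x\<in>X. case w (H u v) x of None \<Rightarrow> 0 | Some v' \<Rightarrow> e (H u v) v' u) / card X)"
    by (subst sum.swap) (simp only: sum_divide_distrib)
  also have "\<dots> \<le> (\<Sum>v\<in>V. E / card X)"
  proof (intro sum_mono divide_right_mono bound)
    fix h x v' assume "w h x = Some v'"
    thus "v' \<in> V \<and> \<zeta> h v' = x \<and> (\<exists>u\<in>U. H u v' = h)" using w_best by (auto simp: best_def c_def)
  qed auto
  finally show ?thesis by simp
qed

section \<open>Pointer walks and inputs with prescribed targets\<close>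

primrec walk :: "(nat \<Rightarrow> nat) \<Rightarrow> (nat \<Rightarrow> nat) \<Rightarrow> nat \<Rightarrow> nat" where
  "walk t s 0 = 1"
| "walk t s (Suc j) = (if even j then t (walk t s j) else s (walk t s j))"

definition walk_sides :: "bool \<Rightarrow> (nat \<Rightarrow> nat) \<Rightarrow> (nat \<Rightarrow> nat) \<Rightarrow> nat \<Rightarrow> nat" where
  "walk_sides \<sigma> t s = (if \<sigma> then walk t s else walk s t)"

lemma walk_sides_0 [simp]: "walk_sides \<sigma> t s 0 = 1"
  by (simp add: walk_sides_def)

lemma walk_sides_Suc:
  "walk_sides \<sigma> t s (Suc j) = (if even j = \<sigma> then t (walk_sides \<sigma> t s j) else s (walk_sides \<sigma> t s j))"
  by (auto simp: walk_sides_def)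

lemma walk_sides_mem:
  assumes "1 \<in> X" "\<And>x. x \<in> X \<Longrightarrow> t x \<in> X" "\<And>x. x \<in> X \<Longrightarrow> s x \<in> X"
  shows "walk_sides \<sigma> t s j \<in> X"
  by (induction j) (use assms in \<open>auto simp: walk_sides_Suc\<close>)

definition meets :: "nat \<Rightarrow> input \<Rightarrow> input \<Rightarrow> (nat \<Rightarrow> nat) \<Rightarrow> bool" where
  "meets n a b t \<longleftrightarrow> (\<forall>x\<in>{1..n}. a x \<subseteq> {1..n} \<and> b x \<subseteq> {1..n} \<and> a x \<inter> b x = {t x}) \<and>
     (\<forall>x. x \<notin> {1..n} \<longrightarrow> a x = {} \<and> b x = {})"

lemma meets_mem: "meets n a b t \<Longrightarrow> x \<in> {1..n} \<Longrightarrow> t x \<in> {1..n}"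
  unfolding meets_def by blast

lemma hpc_instance_assemble:
  assumes "meets n a b t" "meets n c d s"
  shows "hpc_instance n (assemble_sides \<sigma> a b c d)"
proof -
  have "hpc_instance n (assemble a b c d)" if "meets n a b t" "meets n c d s" for a b c d t s
    unfolding hpc_instance_def
  proof (intro conjI ballI allI impI)
    fix p i assume "i \<notin> {1..n}"
    thus "assemble a b c d p i = {}" using that unfolding meets_def by (cases p) auto
  qed (use that in \<open>auto simp: set_int_instance_def meets_def\<close>)
  thus ?thesis using assms by (simp add: assemble_sides_def)
qed

lemma pointer_assemble:
  assumes n: "n \<ge> 1" and m: "meets n a b t" "meets n c d s"
  shows "pointer (assemble_sides \<sigma> a b c d) j = walk_sides \<sigma> t s j"
proof -
  have "pointer (assemble a b c d) j = walk t s j"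
    if m: "meets n a b t" "meets n c d s" for a b c d t s
  proof (induction j)
    case (Suc j)
    have "walk_sides True t s j \<in> {1..n}" using n meets_mem[OF m(1)] meets_mem[OF m(2)] by (intro walk_sides_mem) auto
    hence "walk t s j \<in> {1..n}" by (simp add: walk_sides_def)
    hence "a (walk t s j) \<inter> b (walk t s j) = {t (walk t s j)}" "c (walk t s j) \<inter> d (walk t s j) = {s (walk t s j)}"
      using m unfolding meets_def by blast+
    thus ?case using Suc by (simp add: f_AB_def f_CD_def target_def)
  qed simp
  thus ?thesis using m by (simp add: assemble_sides_def walk_sides_def)
qed

lemma sets_mem:
  assumes "u \<in> seeds X Y"
  shows "left_sets X u \<subseteq> X \<times> Y" "right_sets X Y u \<subseteq> X \<times> Y"
    "(x, y) \<in> left_sets X u \<and> (x, y) \<in> right_sets X Y u \<longleftrightarrow> x \<in> X \<and> y = fst u x"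
  using assms by (auto simp: seeds_def left_sets_def right_sets_def plant_def)

text \<open>The guess \<open>0\<close>, which is never correct, stands for no guess.\<close>

definition second_player :: "bool \<Rightarrow> player" where
  "second_player \<sigma> = (if \<sigma> then PB else PD)"

text \<open>The second slot of \<open>assemble_sides\<close> is filled with \<open>a\<close> as a
  dummy, since its owner is excluded. An announcement by the other pair also counts here, as a guess
  that ignores \<open>a\<close>.\<close>

definition first_guess :: "bool \<Rightarrow> protocol \<Rightarrow> input \<Rightarrow> input \<Rightarrow> input \<Rightarrow> nat" where
  "first_guess \<sigma> P c d a = (case P of
     Output p g \<Rightarrow> if p = second_player \<sigma> then 0 else g (assemble_sides \<sigma> a a c d p) | _ \<Rightarrow> 0)"

definition second_guess :: "bool \<Rightarrow> protocol \<Rightarrow> input \<Rightarrow> nat" where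
  "second_guess \<sigma> P b = (case P of Output p g \<Rightarrow> if p = second_player \<sigma> then g b else 0 | _ \<Rightarrow> 0)"

lemma answer_le_guesses:
  assumes "P = Output p g"
  shows "(of_bool (answer P (assemble_sides \<sigma> a b c d) = x) :: real)
     \<le> of_bool (first_guess \<sigma> P c d a = x) + of_bool (second_guess \<sigma> P b = x)"
  using assms by (cases p) (auto simp: first_guess_def second_guess_def second_player_def assemble_sides_def)

lemma sum_seeds_target:
  assumes "finite X" "finite Y" "Y \<noteq> {}" "x \<in> X"
  shows "(\<Sum>u\<in>seeds X Y. f (fst u x)) = (\<Sum>u\<in>seeds X Y. (\<Sum>y\<in>Y. f y) / card Y :: real)"
proof -
  have n0: "real (card Y) > 0" using assms by (simp add: card_gt_0_iff)
  have split: "(\<Sum>u\<in>seeds X Y. g (fst u)) = (\<Sum>t\<in>X \<rightarrow>\<^sub>E Y. card (Pow (X \<times> Y) \<times> Pow (X \<times> Y) \<times> Pow (X \<times> Y)) * g t)"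
    for g :: "_ \<Rightarrow> real"
    unfolding seeds_def by (subst sum.cartesian_product') simp
  have "card Y * (\<Sum>t\<in>X \<rightarrow>\<^sub>E Y. f (t x)) = (\<Sum>t\<in>X \<rightarrow>\<^sub>E Y. \<Sum>y\<in>Y. f (t x))"
    by (simp add: sum_distrib_left)
  also have "\<dots> = (\<Sum>t\<in>X \<rightarrow>\<^sub>E Y. \<Sum>y\<in>Y. f ((t(x := y)) x))"
    by (rule sum_exchange_target[OF assms(4), of "\<lambda>t y. f (t x)"])
  finally have "(\<Sum>t\<in>X \<rightarrow>\<^sub>E Y. f (t x)) = (\<Sum>t\<in>X \<rightarrow>\<^sub>E Y. (\<Sum>y\<in>Y. f y) / card Y)"
    using n0 by (simp add: field_simps)
  thus ?thesis
    unfolding split[of "\<lambda>t. f (t x)"] split[of "\<lambda>t. (\<Sum>y\<in>Y. f y) / card Y"] sum_distrib_left[symmetric] by simp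
qed

lemma sqrt_ln_card_le:
  assumes "c \<le> 2 ^ Suc b" "c > 0"
  shows "sqrt (real m * ln (real c)) \<le> sqrt (real m * real (Suc b))"
proof -
  have "real c \<le> 2 ^ Suc b" using assms(1) by (metis of_nat_le_iff of_nat_numeral of_nat_power)
  hence "ln (real c) \<le> ln (2 ^ Suc b)" using assms(2) by simp
  also have "\<dots> = real (Suc b) * ln 2" by (rule ln_realpow)
  also have "\<dots> \<le> real (Suc b) * 1" using ln_2_less_1 by (intro mult_left_mono) auto
  finally show ?thesis by (intro real_sqrt_le_mono mult_left_mono) auto
qed

section \<open>Induction over the phases of a deterministic protocol\<close>

locale hpc_protocol =
  fixes n k b :: nat and P :: protocol
  assumes n1: "n \<ge> 1"
    and phases: "\<And>I. hpc_instance n I \<Longrightarrow> within_phases k (speakers P I)"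
    and bits: "\<And>I. hpc_instance n I \<Longrightarrow> bits_sent P I \<le> b"
begin

abbreviation "X \<equiv> {1..n}"
abbreviation "U \<equiv> seeds X X"

definition inst where
  "inst \<sigma> u v = assemble_sides \<sigma> (row_sets (left_sets X u)) (row_sets (right_sets X X u))
     (row_sets (left_sets X v)) (row_sets (right_sets X X v))"

text \<open>The earlier pointers are added to the transcript, but pointer \<open>j\<close> is not:
  it is then a function of this history and one seed, and stays to be predicted.\<close>

definition hist where
  "hist \<sigma> j u v = (stage P (inst \<sigma> u v) j, map (walk_sides \<sigma> (fst u) (fst v)) [0..<j])"

lemma meets_rows:
  assumes u: "u \<in> U"
  shows "meets n (row_sets (left_sets X u)) (row_sets (right_sets X X u)) (fst u)"
proof -
  have "row_sets (left_sets X u) x \<subseteq> X" "row_sets (right_sets X X u) x \<subseteq> X" for x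
    using sets_mem(1,2)[OF u] by (auto simp: row_sets_def)
  moreover have "row_sets (left_sets X u) x \<inter> row_sets (right_sets X X u) x = {fst u x}" if "x \<in> X" for x
    using sets_mem(3)[OF u, of x] that by (auto simp: row_sets_def)
  moreover have "row_sets (left_sets X u) x = {} \<and> row_sets (right_sets X X u) x = {}" if "x \<notin> X" for x
    using sets_mem(1,2)[OF u] that by (auto simp: row_sets_def)
  ultimately show ?thesis unfolding meets_def by blast
qed

lemma legal: "u \<in> U \<Longrightarrow> v \<in> U \<Longrightarrow> hpc_instance n (inst \<sigma> u v)"
  unfolding inst_def by (rule hpc_instance_assemble[OF meets_rows meets_rows])

lemma pointer_inst: "u \<in> U \<Longrightarrow> v \<in> U \<Longrightarrow> pointer (inst \<sigma> u v) j = walk_sides \<sigma> (fst u) (fst v) j"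
  unfolding inst_def by (rule pointer_assemble[OF n1 meets_rows meets_rows])

lemma seed_mem: "u \<in> U \<Longrightarrow> x \<in> X \<Longrightarrow> fst u x \<in> X"
  using meets_mem[OF meets_rows] .

lemma finite_U: "finite U"
  unfolding seeds_def by (intro finite_cartesian_product finite_PiE) auto

lemma inst_swap: "inst (\<not> \<sigma>) v u = inst \<sigma> u v"
  by (simp add: inst_def assemble_sides_def)

lemma walk_sides_swap: "walk_sides (\<not> \<sigma>) s t = walk_sides \<sigma> t s"
  by (simp add: walk_sides_def)

lemma hist_swap: "hist (\<not> \<sigma>) j v u = hist \<sigma> j u v"
  by (simp add: hist_def inst_swap walk_sides_swap)

text \<open>Each pointer arises from its predecessor by a target of one pair alone. The recorded
  pointers agree in both histories, so the walk for the mixed seeds is the same.\<close>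

lemma hist_rect:
  assumes "hist \<sigma> j u v = h" "hist \<sigma> j u' v' = h"
  shows "hist \<sigma> j u v' = h"
proof -
  have "stage P (inst \<sigma> u v) j = fst h" "stage P (inst \<sigma> u' v') j = fst h"
    using assms by (auto simp: hist_def)
  hence "stage P (inst \<sigma> u v') j = fst h"
    unfolding inst_def by (rule stage_rect_sides)
  moreover have "walk_sides \<sigma> (fst u) (fst v') i = walk_sides \<sigma> (fst u) (fst v) i" if "i < j" for i
    using that
  proof (induction i)
    case (Suc i)
    have "walk_sides \<sigma> (fst u) (fst v) i' = walk_sides \<sigma> (fst u') (fst v') i'" if "i' < j" for i'
      using assms that by (auto simp: hist_def)
    from this[of i] this[of "Suc i"] show ?case using Suc
      by (cases "even i = \<sigma>") (simp_all add: walk_sides_Suc)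
  qed simp
  ultimately show ?thesis using assms(1) by (auto simp: hist_def)
qed

definition "transcripts j = (\<lambda>I. stage P I j) ` {I. hpc_instance n I}"

lemma finite_transcripts: "finite (transcripts j)" "card (transcripts j) \<le> 2 ^ Suc b"
  unfolding transcripts_def using card_stages_le[of "{I. hpc_instance n I}" P b j] bits by auto

lemma walk_sides_upd:
  assumes "x \<notin> set (map (walk_sides \<sigma> t s) [0..<j])" "i < j"
  shows "walk_sides \<sigma> (t(x := y)) s i = walk_sides \<sigma> t s i"
  using assms(2)
proof (induction i)
  case (Suc i)
  have "walk_sides \<sigma> t s i \<noteq> x" using assms(1) Suc.prems by auto
  thus ?case using Suc by (simp add: walk_sides_Suc)
qed simp

text \<open>With the seed \<open>v\<close> of the other pair fixed, the seed \<open>u\<close> is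
  played against. All recorded pointers count as visited rows, even those that index the other
  universe; this overcount is still at most \<open>k\<close>.\<close>

lemma game:
  assumes v: "v \<in> U" and j: "j \<le> k"
  shows "intersection_game X X
    (\<lambda>a b. stage P (assemble_sides \<sigma> (row_sets a) (row_sets b) (row_sets (left_sets X v)) (row_sets (right_sets X X v))) j)
    (transcripts j) (\<lambda>t. map (walk_sides \<sigma> t (fst v)) [0..<j])
    (\<lambda>t. set (map (walk_sides \<sigma> t (fst v)) [0..<j])) k"
proof
  show "stage P (assemble_sides \<sigma> (row_sets (left_sets X u)) (row_sets (right_sets X X u)) (row_sets (left_sets X v)) (row_sets (right_sets X X v))) j \<in> transcripts j"
    if "u \<in> U" for u
    unfolding transcripts_def using legal[OF that v, of \<sigma>] by (auto simp: inst_def)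
  show "map (walk_sides \<sigma> (t(x := y)) (fst v)) [0..<j] = map (walk_sides \<sigma> t (fst v)) [0..<j]"
    if "x \<in> X - set (map (walk_sides \<sigma> t (fst v)) [0..<j])" for t x y
    using walk_sides_upd that by (intro map_cong) auto
  show "card (X \<inter> set (map (walk_sides \<sigma> t (fst v)) [0..<j])) \<le> k" for t
  proof -
    have "card (X \<inter> set (map (walk_sides \<sigma> t (fst v)) [0..<j])) \<le> card (set (map (walk_sides \<sigma> t (fst v)) [0..<j]))"
      by (intro card_mono) auto
    also have "\<dots> \<le> j" using card_length[of "map (walk_sides \<sigma> t (fst v)) [0..<j]"] by simp
    finally show ?thesis using j by simp
  qed
  show "X \<noteq> {}" using n1 by simp
  show "stage P (assemble_sides \<sigma> (row_sets a) (row_sets b') (row_sets (left_sets X v)) (row_sets (right_sets X X v))) j = l"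
    if "stage P (assemble_sides \<sigma> (row_sets a) (row_sets b) (row_sets (left_sets X v)) (row_sets (right_sets X X v))) j = l"
       "stage P (assemble_sides \<sigma> (row_sets a') (row_sets b') (row_sets (left_sets X v)) (row_sets (right_sets X X v))) j = l" for a b a' b' l
    using that by (rule stage_rect)
qed (simp_all add: finite_transcripts)

text \<open>Sums over seeds replace expectations, so \<open>D\<close> is to be compared with
  \<open>(card U)\<^sup>2\<close>.\<close>

definition near_uniform :: "bool \<Rightarrow> nat \<Rightarrow> real \<Rightarrow> bool" where
  "near_uniform \<sigma> j D \<longleftrightarrow> (\<forall>F. (\<forall>h y. 0 \<le> F h y \<and> F h y \<le> 1) \<longrightarrow>
     (\<Sum>u\<in>U. \<Sum>v\<in>U. F (hist \<sigma> j u v) (walk_sides \<sigma> (fst u) (fst v) j))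
       \<le> (\<Sum>u\<in>U. \<Sum>v\<in>U. (\<Sum>y\<in>X. F (hist \<sigma> j u v) y) / card X) + D)"

lemma near_uniform_swap:
  assumes "near_uniform \<sigma> j D"
  shows "near_uniform \<sigma>' j D"
proof (cases "\<sigma>' = \<sigma>")
  case False
  hence \<sigma>': "\<sigma>' = (\<not> \<sigma>)" by auto
  have swap: "(\<Sum>u\<in>U. \<Sum>v\<in>U. f (hist \<sigma>' j u v) (walk_sides \<sigma>' (fst u) (fst v) j))
      = (\<Sum>u\<in>U. \<Sum>v\<in>U. f (hist \<sigma> j u v) (walk_sides \<sigma> (fst u) (fst v) j))" for f :: "_ \<Rightarrow> _ \<Rightarrow> real"
    by (subst sum.swap) (simp only: \<sigma>' hist_swap walk_sides_swap)
  show ?thesis unfolding near_uniform_def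
  proof (intro allI impI)
    fix F :: "(bool list \<times> protocol) \<times> nat list \<Rightarrow> nat \<Rightarrow> real"
    assume "\<forall>h y. 0 \<le> F h y \<and> F h y \<le> 1"
    thus "(\<Sum>u\<in>U. \<Sum>v\<in>U. F (hist \<sigma>' j u v) (walk_sides \<sigma>' (fst u) (fst v) j))
       \<le> (\<Sum>u\<in>U. \<Sum>v\<in>U. (\<Sum>y\<in>X. F (hist \<sigma>' j u v) y) / card X) + D"
      using assms unfolding near_uniform_def swap[of F] swap[of "\<lambda>h _. (\<Sum>y\<in>X. F h y) / card X"] by blast
  qed
qed (use assms in simp)

text \<open>For \<open>\<sigma> = even j\<close> phase \<open>Suc j\<close> is spoken by the pair
  with seed \<open>v\<close>, whereas the target that gives pointer \<open>Suc j\<close> belongs to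
  \<open>u\<close>. Hence the phase can be simulated from the history and \<open>v\<close> with any
  seed in place of \<open>u\<close>.\<close>

lemma stage_Suc_passive:
  assumes "\<sigma> = even j"
  shows "stage P (inst \<sigma> u v) (Suc j) = extend (phase_players (Suc j)) (stage P (inst \<sigma> u v) j) (inst \<sigma> u' v)"
  unfolding stage.simps
  by (rule extend_cong) (use assms in \<open>auto simp: phase_players_def inst_def assemble_sides_def split: if_splits\<close>)

text \<open>In phase 1 only \<open>PC\<close> and \<open>PD\<close> speak, while the first pointer
  is a target of \<open>PA\<close> and \<open>PB\<close>. It is exactly uniform and independent of
  the history.\<close>

lemma near_uniform_1: "near_uniform \<sigma> 1 0"
proof (rule near_uniform_swap[of False])
  show "near_uniform False 1 0"
    unfolding near_uniform_def
  proof (intro allI impI)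
    fix F :: "(bool list \<times> protocol) \<times> nat list \<Rightarrow> nat \<Rightarrow> real"
    define H where "H u = hist False 1 u u" for u
    have h: "hist False 1 u v = H u" for u v
    proof -
      have "stage P (inst False u v) 1 = stage P (inst False u u) 1"
        unfolding One_nat_def stage.simps
        by (rule extend_cong) (auto simp: phase_players_def inst_def assemble_sides_def)
      thus ?thesis by (simp add: hist_def H_def)
    qed
    have "walk_sides False t s 1 = s 1" for t s by (simp add: walk_sides_def)
    moreover have "(\<Sum>u\<in>U. \<Sum>v\<in>U. F (H u) (fst v 1)) = (\<Sum>u\<in>U. \<Sum>v\<in>U. (\<Sum>y\<in>X. F (H u) y) / card X)"
      using n1 by (intro sum.cong refl sum_seeds_target) auto
    ultimately show "(\<Sum>u\<in>U. \<Sum>v\<in>U. F (hist False 1 u v) (walk_sides False (fst u) (fst v) 1))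
       \<le> (\<Sum>u\<in>U. \<Sum>v\<in>U. (\<Sum>y\<in>X. F (hist False 1 u v) y) / card X) + 0"
      unfolding h by simp
  qed
qed

definition next_pointer where "next_pointer h v = fst v (last (snd h))"

lemma next_pointer_hist:
  assumes "\<sigma> = even j" "j \<ge> 1"
  shows "next_pointer (hist \<sigma> j u v) v = walk_sides \<sigma> (fst u) (fst v) j"
proof -
  obtain i where "j = Suc i" using assms(2) by (cases j) auto
  thus ?thesis using assms(1) by (auto simp: next_pointer_def hist_def walk_sides_Suc)
qed

lemma card_transcripts_pos:
  assumes "u \<in> U"
  shows "card (transcripts j) > 0"
proof -
  have "stage P (inst True u u) j \<in> transcripts j"
    using legal[OF assms assms] unfolding transcripts_def by blast
  thus ?thesis using finite_transcripts(1)[of j] by (auto simp: card_gt_0_iff)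
qed

lemma sqrt_transcripts_le:
  assumes "u \<in> U"
  shows "sqrt (card (X \<times> X) * ln (card (transcripts j))) / card X \<le> sqrt (Suc b)"
proof -
  have "sqrt (card (X \<times> X) * ln (card (transcripts j))) \<le> sqrt (card (X \<times> X) * real (Suc b))"
    using finite_transcripts card_transcripts_pos[OF assms] by (intro sqrt_ln_card_le)
  also have "\<dots> = sqrt (real n ^ 2 * real (Suc b))" by (simp add: power2_eq_square card_cartesian_product)
  also have "\<dots> = n * sqrt (Suc b)" by (simp add: real_sqrt_mult)
  finally show ?thesis using n1 by (simp add: divide_le_eq mult.commute)
qed

lemma near_uniform_next_pointer:
  assumes D: "near_uniform (even j) j D" and j: "j \<ge> 1" and \<psi>: "\<And>h x. 0 \<le> \<psi> h x \<and> \<psi> h x \<le> 1"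
  shows "(\<Sum>u\<in>U. \<Sum>v\<in>U. \<psi> (hist (even j) j u v) (next_pointer (hist (even j) j u v) v))
      \<le> (\<Sum>u\<in>U. \<Sum>v\<in>U. (\<Sum>x\<in>X. \<psi> (hist (even j) j u v) x) / card X) + D"
  unfolding next_pointer_hist[OF refl j] using D \<psi> unfolding near_uniform_def by blast

lemma near_uniform_Suc:
  assumes j: "1 \<le> j" "j \<le> k" and D: "near_uniform (even j) j D"
  shows "near_uniform \<sigma>' (Suc j) (D + (card U)\<^sup>2 * (k + 60 * sqrt (Suc b)) / n)"
proof (rule near_uniform_swap[of "even j"])
  define \<sigma> where "\<sigma> = even j"
  \<comment> \<open>The next history, computed without \<open>u\<close>.\<close>
  define G where "G h v = (extend (phase_players (Suc j)) (fst h) (inst \<sigma> undefined v), snd h @ [next_pointer h v])"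
    for h :: "(bool list \<times> protocol) \<times> nat list" and v
  have hist_Suc: "hist \<sigma> (Suc j) u v = G (hist \<sigma> j u v) v" for u v
    using stage_Suc_passive[OF \<sigma>_def, of u v undefined] next_pointer_hist[OF \<sigma>_def j(1), of u v]
    by (simp add: hist_def G_def)
  have walk_Suc: "walk_sides \<sigma> (fst u) (fst v) (Suc j) = fst u (next_pointer (hist \<sigma> j u v) v)" for u v
    using next_pointer_hist[OF \<sigma>_def j(1), of u v] by (simp add: walk_sides_Suc \<sigma>_def)
  show "near_uniform (even j) (Suc j) (D + (card U)\<^sup>2 * (k + 60 * sqrt (Suc b)) / n)"
    unfolding near_uniform_def \<sigma>_def[symmetric]
  proof (intro allI impI)
    fix F :: "(bool list \<times> protocol) \<times> nat list \<Rightarrow> nat \<Rightarrow> real"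
    assume F: "\<forall>h y. 0 \<le> F h y \<and> F h y \<le> 1"
    define e where "e h v u = F (G h v) (fst u (next_pointer h v)) - (\<Sum>y\<in>X. F (G h v) y) / card X" for h v and u :: "(nat \<Rightarrow> nat) \<times> (nat \<times> nat) set \<times> (nat \<times> nat) set \<times> (nat \<times> nat) set"
    have "(\<Sum>u\<in>U. \<Sum>v\<in>U. e (hist \<sigma> j u v) v u) \<le> D + card U * (card U * (k + 60 * sqrt (Suc b))) / card X"
    proof (rule uniform_pointer_step[where U = U and V = U and X = X and H = "hist \<sigma> j" and e = e and \<zeta> = next_pointer])
      show "e h v u \<le> 1" for h v u
      proof -
        have "(\<Sum>y\<in>X. F (G h v) y) / card X \<ge> 0"
          by (rule divide_nonneg_nonneg[OF sum_nonneg]) (use F in blast, simp)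
        moreover have "F (G h v) (fst u (next_pointer h v)) \<le> 1" using F by blast
        ultimately show ?thesis unfolding e_def by linarith
      qed
      fix w v
      assume w: "\<And>h x v'. w h x = Some v' \<Longrightarrow> v' \<in> U \<and> next_pointer h v' = x \<and> (\<exists>u\<in>U. hist \<sigma> j u v' = h)"
        and v: "v \<in> U"
      interpret game: intersection_game X X
        "\<lambda>a b. stage P (assemble_sides \<sigma> (row_sets a) (row_sets b) (row_sets (left_sets X v)) (row_sets (right_sets X X v))) j"
        "transcripts j" "\<lambda>t. map (walk_sides \<sigma> t (fst v)) [0..<j]"
        "\<lambda>t. set (map (walk_sides \<sigma> t (fst v)) [0..<j])" k
        by (rule game[OF v j(2)])
      \<comment> \<open>Once \<open>v'\<close> is chosen from the history and \<open>x\<close>, the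
        extended history contains nothing else, so \<open>F\<close> becomes a test for a game in
        which only \<open>u\<close> varies.\<close>
      define \<phi> where "\<phi> x l z y = (case w (l, z) x of None \<Rightarrow> 0 | Some v' \<Rightarrow> F (G (l, z) v') y)" for x l z y
      have \<phi>: "0 \<le> \<phi> x l z y \<and> \<phi> x l z y \<le> 1" for x l z y
        using F by (cases "w (l, z) x") (simp_all add: \<phi>_def del: split_paired_All)
      have "(\<Sum>u\<in>U. \<Sum>x\<in>X. case w (hist \<sigma> j u v) x of None \<Rightarrow> 0 | Some v' \<Rightarrow> e (hist \<sigma> j u v) v' u)
        = (\<Sum>u\<in>U. \<Sum>x\<in>X. \<phi> x (fst (hist \<sigma> j u v)) (snd (hist \<sigma> j u v)) (fst u x)
            - (\<Sum>y\<in>X. \<phi> x (fst (hist \<sigma> j u v)) (snd (hist \<sigma> j u v)) y) / card X)"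
        using w by (intro sum.cong refl) (auto simp: \<phi>_def e_def split: option.split)
      also have "\<dots> \<le> card U * (k + 60 * sqrt (card (X \<times> X) * ln (card (transcripts j))) / card X)"
        unfolding hist_def fst_conv snd_conv inst_def by (rule game.target_close_to_uniform[OF \<phi>])
      also have "\<dots> \<le> card U * (k + 60 * sqrt (Suc b))"
        using sqrt_transcripts_le[OF v, of j] by (intro mult_left_mono add_left_mono) (simp_all only: times_divide_eq_right[symmetric] mult_left_mono of_nat_0_le_iff zero_le_numeral)
      finally show "(\<Sum>u\<in>U. \<Sum>x\<in>X. case w (hist \<sigma> j u v) x of None \<Rightarrow> 0 | Some v' \<Rightarrow> e (hist \<sigma> j u v) v' u)
        \<le> card U * (k + 60 * sqrt (Suc b))" .
    next
      show "finite U" by (rule finite_U)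
      show "finite U" by (rule finite_U)
      show "hist \<sigma> j u v' = h" if "hist \<sigma> j u v = h" "hist \<sigma> j u' v' = h" for u v u' v' h
        using that by (rule hist_rect)
      show "(\<Sum>u\<in>U. \<Sum>v\<in>U. \<psi> (hist \<sigma> j u v) (next_pointer (hist \<sigma> j u v) v))
          \<le> (\<Sum>u\<in>U. \<Sum>v\<in>U. (\<Sum>x\<in>X. \<psi> (hist \<sigma> j u v) x) / card X) + D"
        if "\<And>h x. 0 \<le> \<psi> h x \<and> \<psi> h x \<le> 1" for \<psi>
        using that unfolding \<sigma>_def by (rule near_uniform_next_pointer[OF D j(1)])
    qed (use n1 in auto)
    thus "(\<Sum>u\<in>U. \<Sum>v\<in>U. F (hist \<sigma> (Suc j) u v) (walk_sides \<sigma> (fst u) (fst v) (Suc j)))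
       \<le> (\<Sum>u\<in>U. \<Sum>v\<in>U. (\<Sum>y\<in>X. F (hist \<sigma> (Suc j) u v) y) / card X) + (D + (card U)\<^sup>2 * (k + 60 * sqrt (Suc b)) / n)"
      unfolding hist_Suc walk_Suc e_def sum_subtractf by (simp add: power2_eq_square mult_ac)
  qed
qed

lemma near_uniform_all:
  assumes "1 \<le> j" "j \<le> k"
  shows "near_uniform \<sigma> j (real j * ((card U)\<^sup>2 * (k + 60 * sqrt (Suc b)) / n))"
  using assms
proof (induction j arbitrary: \<sigma> rule: dec_induct)
  case base
  show ?case using near_uniform_1[of \<sigma>] unfolding near_uniform_def
    by (smt (verit) divide_nonneg_nonneg mult_nonneg_nonneg of_nat_0_le_iff real_sqrt_ge_zero zero_le_power2)
next
  case (step j)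
  have "real (Suc j) * c = real j * c + c" for c by (simp add: distrib_right)
  with near_uniform_Suc[OF step(1) _ step.IH] step.prems show ?case
    by (simp only: Suc_leD)
qed

text \<open>Pointer \<open>k - 1\<close> is nearly uniform by induction, which is why
  \<open>k \<ge> 2\<close>. In the last step the announcer knows its own set, so the guess bounds
  replace \<open>target_close_to_uniform\<close>, once for each player of the pair; hence
  \<open>2 * B\<close>.\<close>

theorem success_le:
  assumes k: "k \<ge> 2"
  shows "(\<Sum>u\<in>U. \<Sum>v\<in>U. of_bool (answer P (inst True u v) = pointer (inst True u v) k) :: real)
     \<le> (card U)\<^sup>2 * (k * (k + 60 * sqrt (Suc b)) / n + 2 * tail_bound n + (16 + 240 * sqrt (Suc b) + 4 * k) / n)"
proof -
  define j where "j = k - 1"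
  define \<sigma> where "\<sigma> = even j"
  have j: "1 \<le> j" "j \<le> k" "Suc j = k" using k by (auto simp: j_def)
  define D where "D = real j * ((card U)\<^sup>2 * (k + 60 * sqrt (Suc b)) / n)"
  define R where "R h v = snd (extend (phase_players k) (fst h) (inst \<sigma> undefined v))"
    for h :: "(bool list \<times> protocol) \<times> nat list" and v
  define e :: "_ \<Rightarrow> _ \<Rightarrow> _ \<Rightarrow> real" where
    "e h v u = of_bool (answer (R h v) (inst \<sigma> u v) = fst u (next_pointer h v))" for h v u
  have R: "R (hist \<sigma> j u v) v = snd (stage P (inst \<sigma> u v) k)" for u v
    using stage_Suc_passive[OF \<sigma>_def, of u v undefined] by (simp add: R_def hist_def j(3))
  define B where "B = card U * (n * tail_bound n + 8 + 120 * sqrt (Suc b) + 2 * k)"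
  have "(\<Sum>u\<in>U. \<Sum>v\<in>U. of_bool (answer P (inst True u v) = pointer (inst True u v) k) :: real)
     = (\<Sum>u\<in>U. \<Sum>v\<in>U. of_bool (answer P (inst \<sigma> u v) = pointer (inst \<sigma> u v) k))"
  proof (cases \<sigma>)
    case False
    show ?thesis
      using inst_swap[of False] False by (subst sum.swap) simp
  qed simp
  also have "\<dots> = (\<Sum>u\<in>U. \<Sum>v\<in>U. e (hist \<sigma> j u v) v u)"
  proof (intro sum.cong refl)
    fix u v assume uv: "u \<in> U" "v \<in> U"
    have "walk_sides \<sigma> (fst u) (fst v) k = fst u (next_pointer (hist \<sigma> j u v) v)"
      using next_pointer_hist[OF \<sigma>_def j(1), of u v] walk_sides_Suc[of \<sigma> "fst u" "fst v" j]
      by (simp add: \<sigma>_def j(3))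
    thus "of_bool (answer P (inst \<sigma> u v) = pointer (inst \<sigma> u v) k) = e (hist \<sigma> j u v) v u"
      by (simp add: e_def R answer_stage pointer_inst[OF uv])
  qed
  also have "\<dots> \<le> D + card U * (2 * B) / card X"
  proof (rule uniform_pointer_step[where U = U and V = U and X = X and H = "hist \<sigma> j" and e = e and \<zeta> = next_pointer])
    show "e h v u \<le> 1" for h v u by (simp add: e_def)
    fix w v
    assume w: "\<And>h x v'. w h x = Some v' \<Longrightarrow> v' \<in> U \<and> next_pointer h v' = x \<and> (\<exists>u\<in>U. hist \<sigma> j u v' = h)"
      and v: "v \<in> U"
    interpret game: intersection_game X X
      "\<lambda>a b. stage P (assemble_sides \<sigma> (row_sets a) (row_sets b) (row_sets (left_sets X v)) (row_sets (right_sets X X v))) j"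
      "transcripts j" "\<lambda>t. map (walk_sides \<sigma> t (fst v)) [0..<j]"
      "\<lambda>t. set (map (walk_sides \<sigma> t (fst v)) [0..<j])" k
      by (rule game[OF v j(2)])
    define \<gamma>1 where "\<gamma>1 x l z a = (case w (l, z) x of None \<Rightarrow> 0 | Some v' \<Rightarrow>
      first_guess \<sigma> (R (l, z) v') (row_sets (left_sets X v')) (row_sets (right_sets X X v')) (row_sets a))" for x l z a
    define \<gamma>2 where "\<gamma>2 x l z a = (case w (l, z) x of None \<Rightarrow> 0 | Some v' \<Rightarrow>
      second_guess \<sigma> (R (l, z) v') (row_sets a))" for x l z a
    have "(\<Sum>u\<in>U. \<Sum>x\<in>X. case w (hist \<sigma> j u v) x of None \<Rightarrow> 0 | Some v' \<Rightarrow> e (hist \<sigma> j u v) v' u)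
      \<le> (\<Sum>u\<in>U. \<Sum>x\<in>X. of_bool (\<gamma>1 x (fst (hist \<sigma> j u v)) (snd (hist \<sigma> j u v)) (left_sets X u) = fst u x)
         + of_bool (\<gamma>2 x (fst (hist \<sigma> j u v)) (snd (hist \<sigma> j u v)) (right_sets X X u) = fst u x))"
    proof (intro sum_mono)
      fix u x assume u: "u \<in> U" and x: "x \<in> X"
      show "(case w (hist \<sigma> j u v) x of None \<Rightarrow> 0 | Some v' \<Rightarrow> e (hist \<sigma> j u v) v' u)
        \<le> of_bool (\<gamma>1 x (fst (hist \<sigma> j u v)) (snd (hist \<sigma> j u v)) (left_sets X u) = fst u x)
         + of_bool (\<gamma>2 x (fst (hist \<sigma> j u v)) (snd (hist \<sigma> j u v)) (right_sets X X u) = fst u x)"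
      proof (cases "w (hist \<sigma> j u v) x")
        case (Some v')
        from w[OF this] obtain u' where v': "v' \<in> U" "next_pointer (hist \<sigma> j u v) v' = x"
          "u' \<in> U" "hist \<sigma> j u' v' = hist \<sigma> j u v" by blast
        \<comment> \<open>The history belongs to the seeds \<open>u, v'\<close> as well, so
          \<open>R\<close> is the true state of a legal run after \<open>k\<close> phases and must
          be an \<open>Output\<close>.\<close>
        have "hist \<sigma> j u v' = hist \<sigma> j u v" by (rule hist_rect[OF refl v'(4)])
        hence "R (hist \<sigma> j u v) v' = snd (stage P (inst \<sigma> u v') k)" using R[of u v'] by simp
        then obtain p g where "R (hist \<sigma> j u v) v' = Output p g"
          using stage_Output[OF phases[OF legal[OF u v'(1)]]] by metis
        from answer_le_guesses[OF this] show ?thesis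
          unfolding Some \<gamma>1_def \<gamma>2_def prod.collapse option.case e_def v'(2) inst_def .
      qed simp
    qed
    also have "\<dots> \<le> card U * (card X * (tail_bound (card X) + 8 / card X)
              + 120 * sqrt (card (X \<times> X) * ln (card (transcripts j))) / card X + 2 * k)
            + card U * (card X * (tail_bound (card X) + 8 / card X)
              + 120 * sqrt (card (X \<times> X) * ln (card (transcripts j))) / card X + 2 * k)"
      unfolding sum.distrib hist_def fst_conv snd_conv inst_def
      by (intro add_mono game.left_guess_le game.right_guess_le)
    also have "\<dots> \<le> B + B"
    proof -
      have "120 * sqrt (card (X \<times> X) * ln (card (transcripts j))) / card X \<le> 120 * sqrt (Suc b)"
        using sqrt_transcripts_le[OF v, of j] unfolding times_divide_eq_right[symmetric] by simp
      moreover have "card X * (tail_bound (card X) + 8 / card X) = n * tail_bound n + 8"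
        using n1 by (simp add: distrib_left)
      ultimately have "card U * (card X * (tail_bound (card X) + 8 / card X)
              + 120 * sqrt (card (X \<times> X) * ln (card (transcripts j))) / card X + 2 * k) \<le> B"
        unfolding B_def by (intro mult_left_mono) auto
      from add_mono[OF this this] show ?thesis .
    qed
    finally show "(\<Sum>u\<in>U. \<Sum>x\<in>X. case w (hist \<sigma> j u v) x of None \<Rightarrow> 0 | Some v' \<Rightarrow> e (hist \<sigma> j u v) v' u) \<le> 2 * B"
      by simp
  next
    show "finite U" by (rule finite_U)
    show "finite U" by (rule finite_U)
    show "hist \<sigma> j u v' = h" if "hist \<sigma> j u v = h" "hist \<sigma> j u' v' = h" for u v u' v' h
      using that by (rule hist_rect)
    show "(\<Sum>u\<in>U. \<Sum>v\<in>U. \<psi> (hist \<sigma> j u v) (next_pointer (hist \<sigma> j u v) v))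
        \<le> (\<Sum>u\<in>U. \<Sum>v\<in>U. (\<Sum>x\<in>X. \<psi> (hist \<sigma> j u v) x) / card X) + D"
      if "\<And>h x. 0 \<le> \<psi> h x \<and> \<psi> h x \<le> 1" for \<psi>
      using that unfolding \<sigma>_def by (rule near_uniform_next_pointer[OF near_uniform_all[OF j(1,2), folded D_def] j(1)])
  qed (use n1 in auto)
  also have "\<dots> \<le> k * ((card U)\<^sup>2 * (k + 60 * sqrt (Suc b)) / n) + card U * (2 * B) / card X"
    unfolding D_def using j by (intro add_right_mono mult_right_mono) auto
  also have "\<dots> = (card U)\<^sup>2 * (k * (k + 60 * sqrt (Suc b)) / n + 2 * tail_bound n + (16 + 240 * sqrt (Suc b) + 4 * k) / n)"
    using n1 by (simp add: B_def field_simps power2_eq_square)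
  finally show ?thesis .
qed

end

subsection \<open>A single instance in all rows\<close>

context hpc_protocol
begin

definition wide :: "(nat \<times> nat) set \<Rightarrow> input" where
  "wide a = (\<lambda>i. if i \<in> X then {j. (1, j) \<in> a} else {})"

definition trivial :: input where
  "trivial = (\<lambda>i. if i \<in> X then {1} else {})"

text \<open>The last pointer is a target of \<open>PA, PB\<close> exactly for odd \<open>k\<close>;
  that pair gets the hard instance. As its rows are all alike, the position before the last step
  does not matter.\<close>

definition single :: "(nat \<Rightarrow> nat) \<times> (nat \<times> nat) set \<times> (nat \<times> nat) set \<times> (nat \<times> nat) set \<Rightarrow> hpc_input" where
  "single u = assemble_sides (odd k) (wide (left_sets {1} u)) (wide (right_sets {1} X u)) trivial trivial"

abbreviation "V \<equiv> seeds {1 :: nat} X"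

lemma meets_trivial: "meets n trivial trivial (\<lambda>_. 1)"
  using n1 by (auto simp: meets_def trivial_def)

lemma meets_wide:
  assumes u: "u \<in> V"
  shows "meets n (wide (left_sets {1} u)) (wide (right_sets {1} X u)) (\<lambda>_. fst u 1)"
proof -
  have "wide (left_sets {1} u) x \<subseteq> X" "wide (right_sets {1} X u) x \<subseteq> X" for x
    using sets_mem(1,2)[OF u] by (auto simp: wide_def)
  moreover have "wide (left_sets {1} u) x \<inter> wide (right_sets {1} X u) x = {fst u 1}" if "x \<in> X" for x
    using sets_mem(3)[OF u, of 1] that by (auto simp: wide_def)
  moreover have "wide (left_sets {1} u) x = {} \<and> wide (right_sets {1} X u) x = {}" if "x \<notin> X" for x
    using that by (auto simp: wide_def)
  ultimately show ?thesis unfolding meets_def by blast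
qed

lemma legal_single: "u \<in> V \<Longrightarrow> hpc_instance n (single u)"
  unfolding single_def by (rule hpc_instance_assemble[OF meets_wide meets_trivial])

lemma pointer_single:
  assumes u: "u \<in> V" and k: "k \<ge> 1"
  shows "pointer (single u) k = fst u 1"
proof -
  obtain i where "k = Suc i" using k by (cases k) auto
  thus ?thesis
    unfolding single_def pointer_assemble[OF n1 meets_wide[OF u] meets_trivial] by (simp add: walk_sides_Suc)
qed

definition "single_transcripts = (\<lambda>u. stage P (single u) k) ` V"

lemma finite_V: "finite V"
  unfolding seeds_def by (intro finite_cartesian_product finite_PiE) auto

lemma V_nonempty: "V \<noteq> {}"
  using n1 by (auto simp: seeds_def PiE_eq_empty_iff)

lemma card_single_transcripts: "0 < card single_transcripts" "card single_transcripts \<le> 2 ^ Suc b"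
proof -
  show "0 < card single_transcripts"
    using finite_V V_nonempty by (auto simp: single_transcripts_def card_gt_0_iff)
  have "single_transcripts \<subseteq> transcripts k"
    using legal_single by (auto simp: single_transcripts_def transcripts_def)
  thus "card single_transcripts \<le> 2 ^ Suc b"
    using finite_transcripts[of k] card_mono order.trans by blast
qed

text \<open>With one phase only \<open>PC\<close> and \<open>PD\<close> may speak, and their inputs
  are trivial. The logarithm vanishes, so for large \<open>n\<close> no amount of communication
  helps.\<close>

lemma card_single_transcripts_1:
  assumes k: "k = 1"
  shows "card single_transcripts = 1"
proof -
  have "stage P (single u) k = stage P (single u') k" for u u'
  proof -
    have odd: "odd k" using k by simp
    have first: "stage P I k = extend (phase_players 1) ([], P) I" for I by (simp add: k)
    show ?thesis unfolding first
      by (rule extend_cong) (use odd in \<open>auto simp: phase_players_def single_def assemble_sides_def\<close>)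
  qed
  hence "single_transcripts = {stage P (single undefined) k}"
    using V_nonempty unfolding single_transcripts_def by blast
  thus ?thesis by simp
qed

lemma single_success_le:
  assumes k: "k \<ge> 1"
  shows "(\<Sum>u\<in>V. of_bool (answer P (single u) = pointer (single u) k) :: real)
    \<le> card V * (2 * tail_bound n + 16 / n + 240 * sqrt (n * ln (card single_transcripts)) / n)"
proof -
  define \<sigma> where "\<sigma> = odd k"
  define \<tau> where "\<tau> a b = stage P (assemble_sides \<sigma> (wide a) (wide b) trivial trivial) k" for a b
  have \<tau>: "\<tau> (left_sets {1} u) (right_sets {1} X u) = stage P (single u) k" for u
    by (simp add: \<tau>_def single_def \<sigma>_def)
  interpret game: intersection_game "{1 :: nat}" X \<tau> single_transcripts "\<lambda>_. ()" "\<lambda>_. {}" 0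
  proof
    show "\<tau> (left_sets {1} u) (right_sets {1} X u) \<in> single_transcripts" if "u \<in> V" for u
      using that unfolding \<tau> single_transcripts_def by blast
    show "\<tau> a b' = l" if "\<tau> a b = l" "\<tau> a' b' = l" for a b a' b' l
      using that unfolding \<tau>_def by (rule stage_rect)
    show "finite single_transcripts" using finite_V by (simp add: single_transcripts_def)
  qed (use n1 in auto)
  define \<gamma>1 where "\<gamma>1 x l z a = first_guess \<sigma> (snd l) trivial trivial (wide a)"
    for x :: nat and l :: "bool list \<times> protocol" and z :: unit and a
  define \<gamma>2 where "\<gamma>2 x l z a = second_guess \<sigma> (snd l) (wide a)"
    for x :: nat and l :: "bool list \<times> protocol" and z :: unit and a
  define T where "T u = \<tau> (left_sets {1} u) (right_sets {1} X u)" for u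
  define B where "B = tail_bound n + 8 / n + 120 * sqrt (n * ln (card single_transcripts)) / n"
  have "(\<Sum>u\<in>V. of_bool (answer P (single u) = pointer (single u) k) :: real)
    \<le> (\<Sum>u\<in>V. of_bool (\<gamma>1 1 (T u) () (left_sets {1} u) = fst u 1) + of_bool (\<gamma>2 1 (T u) () (right_sets {1} X u) = fst u 1))"
  proof (rule sum_mono)
    fix u assume u: "u \<in> V"
    obtain p g where "snd (stage P (single u) k) = Output p g"
      using stage_Output[OF phases[OF legal_single[OF u]]] by blast
    from answer_le_guesses[OF this, of \<sigma> "wide (left_sets {1} u)" "wide (right_sets {1} X u)" trivial trivial "fst u 1"]
    show "of_bool (answer P (single u) = pointer (single u) k)
      \<le> (of_bool (\<gamma>1 1 (T u) () (left_sets {1} u) = fst u 1) + of_bool (\<gamma>2 1 (T u) () (right_sets {1} X u) = fst u 1) :: real)"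
      unfolding pointer_single[OF u k] \<gamma>1_def \<gamma>2_def T_def \<tau>
      using answer_stage[of P "single u" k] by (simp add: single_def \<sigma>_def)
  qed
  also have "\<dots> = (\<Sum>u\<in>V. of_bool (\<gamma>1 1 (T u) () (left_sets {1} u) = fst u 1)) + (\<Sum>u\<in>V. of_bool (\<gamma>2 1 (T u) () (right_sets {1} X u) = fst u 1))"
    by (rule sum.distrib)
  also have "\<dots> \<le> card V * B + card V * B"
    using game.left_guess_le[of \<gamma>1] game.right_guess_le[of \<gamma>2] unfolding T_def B_def
    by (intro add_mono) (simp_all add: card_cartesian_product del: sum_of_bool_eq)
  also have "\<dots> = card V * (2 * tail_bound n + 16 / n + 240 * sqrt (n * ln (card single_transcripts)) / n)"
    by (simp add: B_def algebra_simps)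
  finally show ?thesis .
qed

lemma U_pos: "real (card U) > 0"
  using finite_U n1 by (auto simp: card_gt_0_iff seeds_def PiE_eq_empty_iff)

lemma V_pos: "real (card V) > 0"
  using finite_V V_nonempty by (simp add: card_gt_0_iff)

end

section \<open>Averaging over the coins and choice of constants\<close>

lemma tail_bound_tendsto_0: "tail_bound \<longlonglongrightarrow> 0"
proof -
  define q :: real where "q = 2 powr (1 / 8) * (7 / 8)"
  \<comment> \<open>Comparing eighth powers gives \<open>q < 1\<close> without a numerical estimate
    of the root.\<close>
  have "(2 powr (1 / 8)) ^ 8 = (2 :: real)"
    by (simp add: powr_realpow[symmetric] powr_powr)
  hence "q ^ 8 = 2 * (7 / 8) ^ 8" by (simp only: q_def power_mult_distrib)
  hence "q ^ 8 < 1 ^ 8" by (simp add: power_divide)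
  hence "q < 1" by (rule power_less_imp_less_base) simp
  moreover have "q \<ge> 0" by (simp add: q_def)
  ultimately have "(\<lambda>n. 8 / 7 * q ^ n) \<longlonglongrightarrow> 8 / 7 * 0"
    by (intro tendsto_mult_left LIMSEQ_power_zero) simp
  moreover have "\<forall>\<^sub>F n in sequentially. 8 / 7 * q ^ n = tail_bound n"
    using eventually_ge_at_top[of 1]
  proof eventually_elim
    case (elim n)
    then obtain m where m: "n = Suc m" by (cases n) auto
    have 2: "2 powr (real n / 8) = (2 powr (1 / 8)) ^ n"
      by (simp add: powr_realpow[symmetric] powr_powr)
    show ?case unfolding tail_bound_def q_def power_mult_distrib 2 by (simp add: m)
  qed
  ultimately show ?thesis using Lim_transform_eventually by fastforce
qed

text \<open>The number of correctly solved inputs takes finitely many values, so its maximum over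
  the possibly infinite support is attained, and it is at least the mean.\<close>

lemma exists_good_protocol:
  assumes "solves_hpc n k \<delta> R" "finite S" "\<And>s. s \<in> S \<Longrightarrow> hpc_instance n (I s)"
  shows "\<exists>P\<in>set_pmf R. \<delta> * card S \<le> (\<Sum>s\<in>S. of_bool (answer P (I s) = pointer (I s) k))"
proof -
  define f :: "protocol \<Rightarrow> real" where "f P = (\<Sum>s\<in>S. of_bool (answer P (I s) = pointer (I s) k))" for P
  have f_card: "f P = card {s\<in>S. answer P (I s) = pointer (I s) k}" for P
    using assms(2) by (simp add: f_def Int_def)
  have "f ` set_pmf R \<subseteq> real ` {..card S}"
    using assms(2) by (auto simp: f_card intro!: imageI card_mono)
  hence fin: "finite (f ` set_pmf R)" by (rule finite_subset) simp
  have ne: "f ` set_pmf R \<noteq> {}" using set_pmf_not_empty[of R] by simp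
  obtain P where P: "P \<in> set_pmf R" "f P = Max (f ` set_pmf R)" using Max_in[OF fin ne] by auto
  have "\<delta> * card S = (\<Sum>s\<in>S. \<delta>)" by simp
  also have "\<dots> \<le> (\<Sum>s\<in>S. measure_pmf.prob R {P. answer P (I s) = pointer (I s) k})"
    using assms(1,3) unfolding solves_hpc_def by (intro sum_mono) auto
  also have "\<dots> = (\<Sum>s\<in>S. measure_pmf.expectation R (\<lambda>P. of_bool (answer P (I s) = pointer (I s) k)))"
  proof (intro sum.cong refl)
    fix s
    have "(\<lambda>P. of_bool (answer P (I s) = pointer (I s) k) :: real) = indicator {P. answer P (I s) = pointer (I s) k}"
      by (auto simp: indicator_def)
    thus "measure_pmf.prob R {P. answer P (I s) = pointer (I s) k}
        = measure_pmf.expectation R (\<lambda>P. of_bool (answer P (I s) = pointer (I s) k))"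
      by simp
  qed
  also have "\<dots> = measure_pmf.expectation R f"
    unfolding f_def
    by (rule Bochner_Integration.integral_sum[symmetric])
      (rule measure_pmf.integrable_const_bound[where B = 1], auto)
  also have "\<dots> \<le> f P"
  proof (rule measure_pmf.integral_le_const)
    show "integrable (measure_pmf R) f"
      using fin by (intro measure_pmf.integrable_const_bound[where B = "card S"])
        (auto simp: f_card AE_measure_pmf_iff intro!: card_mono assms(2))
    show "AE x in measure_pmf R. f x \<le> f P"
      using fin by (auto simp: AE_measure_pmf_iff P(2))
  qed
  finally show ?thesis using P(1) unfolding f_def by blast
qed

theorem theorem5p1:
  fixes \<delta> :: real
  assumes "\<delta> > 0"
  shows "\<exists>c>0. \<exists>n\<^sub>0. \<forall>n\<ge>n\<^sub>0. \<forall>k\<ge>1. \<forall>R b.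
           k_phase n k R \<and> solves_hpc n k \<delta> R \<and> comm_at_most n R b \<longrightarrow>
             real b \<ge> c * ((real n)\<^sup>2 / (real k)\<^sup>2 + real n)"
proof -
  define d where "d = min \<delta> 1"
  \<comment> \<open>For small \<open>k\<close> the errors sum to at most \<open>5 * \<theta> + 300 *
    d / 1300 + 2 * d / 16 + 16 * d / 256 < d\<close>, where 5 = 1 + 4 and 300 = 60 + 240 collect
    coefficients of \<open>success_le\<close>. For large \<open>k\<close>,
    \<open>240 * sqrt \<eta>\<close> replaces the first two terms. Of \<open>\<eta>\<close>, one
    half is used by \<open>c\<close>; the other absorbs the 1 in \<open>Suc b\<close>.\<close>
  define \<theta> where "\<theta> = d / 20"
  define \<eta> where "\<eta> = (d / 1300)\<^sup>2"
  define c where "c = \<eta> / 2 / (1 + 1 / \<theta>)"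
  have d: "0 < d" "d \<le> 1" "d \<le> \<delta>" using assms by (auto simp: d_def)
  have \<theta>: "0 < \<theta>" "\<theta> \<le> 1" using d by (auto simp: \<theta>_def)
  have \<eta>: "0 < \<eta>" using d by (simp add: \<eta>_def)
  have sqrt_\<eta>: "sqrt \<eta> = d / 1300" using d by (simp add: \<eta>_def real_sqrt_divide)
  have "1 + 1 / \<theta> > 0" using \<theta> by (simp add: add_pos_pos)
  hence c: "0 < c" "c * (1 + 1 / \<theta>) = \<eta> / 2"
    using \<eta> unfolding c_def by (simp, metis less_numeral_extra(3) nonzero_eq_divide_eq)
  have "\<forall>\<^sub>F n in sequentially. tail_bound n < d / 16"
    by (rule order_tendstoD(2)[OF tail_bound_tendsto_0]) (use d in simp)
  moreover have "\<forall>\<^sub>F n in sequentially. 1 / real n < min (d / 256) (\<eta> / 2)"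
    by (rule order_tendstoD(2)[OF lim_1_over_n]) (use d \<eta> in simp)
  ultimately have "\<forall>\<^sub>F n in sequentially. tail_bound n < d / 16 \<and> 1 / real n < min (d / 256) (\<eta> / 2) \<and> n \<ge> 1"
    using eventually_ge_at_top[of 1] by eventually_elim auto
  then obtain n0 where n0: "\<And>n. n \<ge> n0 \<Longrightarrow> tail_bound n < d / 16 \<and> 1 / real n < min (d / 256) (\<eta> / 2) \<and> n \<ge> 1"
    unfolding eventually_sequentially by blast
  show ?thesis
  proof (intro exI[of _ c] conjI c(1) exI[of _ n0] allI impI)
    fix n k :: nat and R b
    assume n: "n0 \<le> n" and k: "1 \<le> k"
      and H: "k_phase n k R \<and> solves_hpc n k \<delta> R \<and> comm_at_most n R b"
    have nb: "tail_bound n < d / 16" "1 / real n < d / 256" "1 / real n < \<eta> / 2" "n \<ge> 1"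
      using n0[OF n] by auto
    have prot: "hpc_protocol n k b P" if "P \<in> set_pmf R" for P
      using that H nb(4) unfolding k_phase_def comm_at_most_def by unfold_locales auto
    show "c * ((real n)\<^sup>2 / (real k)\<^sup>2 + real n) \<le> real b"
    proof (rule ccontr)
      assume "\<not> ?thesis"
      hence b: "real b < c * ((real n)\<^sup>2 / (real k)\<^sup>2 + real n)" by simp
      have single_bound: "\<delta> \<le> 2 * tail_bound n + 16 / n + 240 * sqrt (n * ln r) / n"
        if r: "\<And>P. P \<in> set_pmf R \<Longrightarrow> real (card (hpc_protocol.single_transcripts n k P)) \<le> r" for r
      proof -
        \<comment> \<open>\<open>P0\<close> only gives access to the hard inputs, which do not
          depend on the protocol; \<open>P\<close> is then chosen by averaging over them.\<close>
        obtain P0 where "P0 \<in> set_pmf R" using set_pmf_not_empty[of R] by blast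
        then interpret P0: hpc_protocol n k b P0 by (rule prot)
        have "solves_hpc n k \<delta> R" using H by blast
        from exists_good_protocol[OF this P0.finite_V, of P0.single, OF P0.legal_single]
        obtain P where P: "P \<in> set_pmf R"
          "\<delta> * card P0.V \<le> (\<Sum>u\<in>P0.V. of_bool (answer P (P0.single u) = pointer (P0.single u) k))" by blast
        interpret P: hpc_protocol n k b P by (rule prot[OF P(1)])
        note P(2)
        also have "(\<Sum>u\<in>P0.V. of_bool (answer P (P0.single u) = pointer (P0.single u) k))
          \<le> card P0.V * (2 * tail_bound n + 16 / n + 240 * sqrt (n * ln (card P.single_transcripts)) / n)"
          by (rule P.single_success_le[OF k])
        finally have "\<delta> \<le> 2 * tail_bound n + 16 / n + 240 * sqrt (n * ln (card P.single_transcripts)) / n"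
          using P0.V_pos by (simp add: mult.commute)
        also have "\<dots> \<le> 2 * tail_bound n + 16 / n + 240 * sqrt (n * ln r) / n"
        proof -
          have "ln (card P.single_transcripts) \<le> ln r"
            using r[OF P(1)] P.card_single_transcripts(1) by simp
          hence "sqrt (n * ln (card P.single_transcripts)) \<le> sqrt (n * ln r)"
            by (intro real_sqrt_le_mono mult_left_mono) auto
          thus ?thesis by (intro add_left_mono divide_right_mono mult_left_mono) auto
        qed
        finally show ?thesis .
      qed
      consider "k = 1" | "real k ^ 2 > \<theta> * n" | "k \<ge> 2" "real k ^ 2 \<le> \<theta> * n" using k by linarith
      thus False
      proof cases
        case 1
        have "\<delta> \<le> 2 * tail_bound n + 16 / n + 240 * sqrt (n * ln 1) / n"
          by (rule single_bound) (use hpc_protocol.card_single_transcripts_1[OF prot 1] in simp)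
        thus False using nb d by simp
      next
        case 2
        have "(real n)\<^sup>2 / (real k)\<^sup>2 \<le> n / \<theta>"
        proof -
          have "(real n)\<^sup>2 * \<theta> = real n * (\<theta> * n)" by (simp add: power2_eq_square)
          also have "\<dots> \<le> real n * (real k)\<^sup>2" using 2 by (intro mult_left_mono) auto
          finally show ?thesis using k \<theta> by (simp add: field_simps)
        qed
        hence "c * ((real n)\<^sup>2 / (real k)\<^sup>2 + real n) \<le> c * (n / \<theta> + n)"
          using c by (intro mult_left_mono) auto
        also have "\<dots> = n * (c * (1 + 1 / \<theta>))" by (simp add: field_simps)
        finally have "c * ((real n)\<^sup>2 / (real k)\<^sup>2 + real n) \<le> n * (\<eta> / 2)" unfolding c(2) .
        from order.strict_trans2[OF b this] have "real b / n < \<eta> / 2" using nb(4) by (simp add: divide_less_eq mult.commute)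
        moreover have "real (Suc b) / n = real b / n + 1 / n" by (simp add: add_divide_distrib)
        ultimately have Sb: "real (Suc b) / n \<le> \<eta>" using nb(3) by linarith
        have "\<delta> \<le> 2 * tail_bound n + 16 / n + 240 * sqrt (n * ln (2 ^ Suc b)) / n"
        proof (rule single_bound)
          fix P assume "P \<in> set_pmf R"
          from hpc_protocol.card_single_transcripts(2)[OF prot[OF this]]
          show "real (card (hpc_protocol.single_transcripts n k P)) \<le> 2 ^ Suc b"
            by (metis of_nat_le_iff of_nat_numeral of_nat_power)
        qed
        also have "sqrt (n * ln (2 ^ Suc b)) / n \<le> sqrt \<eta>"
        proof -
          have "sqrt (n * ln (2 ^ Suc b)) \<le> sqrt (n * real (Suc b))"
            using sqrt_ln_card_le[of "2 ^ Suc b" b n] by simp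
          also have "\<dots> = sqrt ((real n)\<^sup>2 * (real (Suc b) / n))"
            using nb(4) by (simp add: power2_eq_square)
          also have "\<dots> \<le> sqrt ((real n)\<^sup>2 * \<eta>)"
            using Sb by (intro real_sqrt_le_mono mult_left_mono) auto
          also have "\<dots> = n * sqrt \<eta>" by (simp add: real_sqrt_mult)
          finally show ?thesis using nb(4) by (simp add: divide_le_eq mult.commute)
        qed
        hence "240 * sqrt (n * ln (2 ^ Suc b)) / n \<le> 240 * sqrt \<eta>" by simp
        ultimately have "\<delta> \<le> 2 * tail_bound n + 16 / n + 240 * sqrt \<eta>" by linarith
        thus False using nb d by (simp add: sqrt_\<eta>)
      next
        case 3
        obtain P0 where "P0 \<in> set_pmf R" using set_pmf_not_empty[of R] by blast
        then interpret P0: hpc_protocol n k b P0 by (rule prot)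
        let ?I = "\<lambda>(u, v). P0.inst True u v"
        have "solves_hpc n k \<delta> R" using H by blast
        from exists_good_protocol[OF this, of "P0.U \<times> P0.U" ?I]
        obtain P where P: "P \<in> set_pmf R"
          "\<delta> * card (P0.U \<times> P0.U) \<le> (\<Sum>s\<in>P0.U \<times> P0.U. of_bool (answer P (?I s) = pointer (?I s) k))"
          using P0.finite_U P0.legal by auto
        interpret P: hpc_protocol n k b P by (rule prot[OF P(1)])
        define s where "s = sqrt (Suc b)"
        have "\<delta> * (card P0.U)\<^sup>2 \<le> (\<Sum>u\<in>P0.U. \<Sum>v\<in>P0.U. of_bool (answer P (P0.inst True u v) = pointer (P0.inst True u v) k))"
          using P(2) by (simp add: card_cartesian_product power2_eq_square sum.cartesian_product case_prod_unfold)
        also have "\<dots> \<le> (card P0.U)\<^sup>2 * (k * (k + 60 * s) / n + 2 * tail_bound n + (16 + 240 * s + 4 * k) / n)"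
          unfolding s_def by (rule P.success_le[OF 3(1)])
        finally have main: "\<delta> \<le> k * (k + 60 * s) / n + 2 * tail_bound n + (16 + 240 * s + 4 * k) / n"
          using P0.U_pos by (simp add: mult.commute)
        have npos: "real n > 0" using nb(4) by simp
        have kk: "(real k)\<^sup>2 / n \<le> \<theta>" using 3(2) npos by (simp add: divide_le_eq)
        have s0: "s \<ge> 0" by (simp add: s_def)
        have ksn: "k * s / n \<le> d / 1300"
        proof -
          \<comment> \<open>The assumed bound on \<open>b\<close> makes the first term at most
            \<open>\<eta> / 2\<close>, and \<open>1 / n < \<eta> / 2\<close> handles the
            second.\<close>
          have "(k * s / n)\<^sup>2 = (real k)\<^sup>2 * b / (real n)\<^sup>2 + (real k)\<^sup>2 / (real n)\<^sup>2"
            by (simp add: s_def power_divide power_mult_distrib add_divide_distrib[symmetric] algebra_simps)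
          also have "(real k)\<^sup>2 * b / (real n)\<^sup>2 \<le> c * (1 + (real k)\<^sup>2 / n)"
          proof -
            have "(real k)\<^sup>2 * b \<le> (real k)\<^sup>2 * (c * ((real n)\<^sup>2 / (real k)\<^sup>2 + real n))"
              using b by (intro mult_left_mono) auto
            also have "\<dots> = c * (1 + (real k)\<^sup>2 / n) * (real n)\<^sup>2"
              using k npos by (simp add: field_simps power2_eq_square)
            finally show ?thesis using npos by (simp add: divide_le_eq)
          qed
          also have "c * (1 + (real k)\<^sup>2 / n) \<le> c * (1 + 1 / \<theta>)"
          proof -
            have "1 \<le> 1 / \<theta>" using \<theta> by simp
            hence "(real k)\<^sup>2 / n \<le> 1 / \<theta>" using kk \<theta> by linarith
            thus ?thesis using c(1) by (intro mult_left_mono) auto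
          qed
          also have "(real k)\<^sup>2 / (real n)\<^sup>2 \<le> 1 / n"
          proof -
            have "(real k)\<^sup>2 / (real n)\<^sup>2 = ((real k)\<^sup>2 / n) * (1 / n)" by (simp add: power2_eq_square)
            also have "\<dots> \<le> 1 * (1 / n)" using kk \<theta> by (intro mult_right_mono) auto
            finally show ?thesis by simp
          qed
          finally have "(k * s / n)\<^sup>2 \<le> \<eta>" using c(2) nb(3) by linarith
          hence "k * s / n \<le> sqrt \<eta>" by (rule real_le_rsqrt)
          thus ?thesis by (simp add: sqrt_\<eta>)
        qed
        have sn: "s / n \<le> k * s / n"
        proof -
          have "1 * s \<le> k * s" using k s0 by (intro mult_right_mono) auto
          thus ?thesis using npos by (simp add: divide_right_mono)
        qed
        have kn: "k / n \<le> (real k)\<^sup>2 / n"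
        proof -
          have "1 * real k \<le> real k * real k" using k by (intro mult_right_mono) auto
          thus ?thesis using npos by (simp add: divide_right_mono power2_eq_square)
        qed
        have "k * (k + 60 * s) / n + 2 * tail_bound n + (16 + 240 * s + 4 * k) / n
          = (real k)\<^sup>2 / n + 60 * (k * s / n) + 2 * tail_bound n + 16 * (1 / n) + 240 * (s / n) + 4 * (k / n)"
          by (simp add: add_divide_distrib power2_eq_square algebra_simps)
        with main have "\<delta> \<le> 5 * \<theta> + 300 * (d / 1300) + 2 * (d / 16) + 16 * (d / 256)"
          using kk ksn sn kn nb(1,2) by linarith
        thus False using d by (simp add: \<theta>_def)
      qed
    qed
  qed
qed

end
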